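(* Let $\varphi$ be an $N$-function with complementary function $\varphi_*$, let $I=(0,a)$ with $0<a\le\infty$, and let $w$ be a positive decreasing weight function on $I$ with $W(t)=\int_0^tw<\infty$ for $t\in I$. Then the space $\mathcal{M}_{\varphi,w}$ is equal to the Köthe dual of the Orlicz-Lorentz space $\Lambda^0_{\varphi_*,w}$, that is, $(\Lambda^0_{\varphi_*,w})'=\mathcal{M}_{\varphi,w}$ with equality of norms.
   Context: An Orlicz function is a convex, strictly increasing $\varphi:\mathbb{R}_+\to\mathbb{R}_+$ with $\varphi(0)=0$; it is an $N$-function if $\lim_{t\to\infty}\varphi(t)/t=\infty$ and $\lim_{t\to0}\varphi(t)/t=0$. $\varphi_*(t)=\sup_{s>0}\{st-\varphi(s)\}$. "Decreasing" means non-increasing. $L^0$ is the set of Lebesgue measurable $f:I\to\mathbb{R}$. For $f\in L^0$, $d_f(s)=|\{t\in I:|f(t)|>s\}|$ and $f^*(t)=\inf\{s\ge0:d_f(s)\le t\}$. A weight function is a non-negative decreasing function in $L^0$. $g\prec f$ means $\int_0^tg^*\le\int_0^tf^*$ for all $t\in I$. $P(f)=\inf\{\int_I\varphi(|f|/v)v: v\prec w,\ v\ge0\}$, where at points with $v(t)=0$ the integrand is $0$ if $f(t)=0$ and $\infty$ otherwise; $\|f\|_{\mathcal{M}}=\inf\{\epsilon>0:P(f/\epsilon)\le1\}$; $\mathcal{M}_{\varphi,w}=\{f\in L^0:\|f\|_{\mathcal{M}}<\infty\}$. The Köthe dual of a normed space $E\subset L^0$ is $E'=\{f\in L^0: fg\in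 L_1(I)\ \forall g\in E\}$, with norm $\|f\|_{E'}=\sup\{\int_I|fg|: g\in E,\ \|g\|_E\le1\}$. $L_\varphi(w)=\{f\in L^0:\exists\lambda>0,\ \int_I\varphi(\lambda|f|)w<\infty\}$ with Luxemburg norm $\|f\|_{L_\varphi(w)}=\inf\{\epsilon>0:\int_I\varphi(|f|/\epsilon)w\le1\}$. $\Lambda_{\varphi_*,w}$ is the set of $f\in L^0$ with $f^*\in L_{\varphi_*}(w)$; $\Lambda^0_{\varphi_*,w}$ is this space with the Orlicz norm $\|f\|^0_{\Lambda_{\varphi_*,w}}=\sup\{\int_If^*gw: g\in L_\varphi(w),\ \|g\|_{L_\varphi(w)}\le1\}$. *)

theory Defs
  imports "HOL-Analysis.Analysis"
begin

(* A function on the half-line [0,\<infinity>) is a real function whose values on the negative axis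
   are irrelevant; \<phi> \<ge> 0 on {0..} follows from \<phi> 0 = 0 and monotonicity. *)
definition orlicz_function :: "(real \<Rightarrow> real) \<Rightarrow> bool" where
  "orlicz_function \<phi> \<longleftrightarrow> convex_on {0..} \<phi> \<and> strict_mono_on {0..} \<phi> \<and> \<phi> 0 = 0"

definition N_function :: "(real \<Rightarrow> real) \<Rightarrow> bool" where
  "N_function \<phi> \<longleftrightarrow> orlicz_function \<phi> \<and>
     filterlim (\<lambda>t. \<phi> t / t) at_top at_top \<and> ((\<lambda>t. \<phi> t / t) \<longlongrightarrow> 0) (at_right 0)"

(* For an N-function the set below is bounded above for every t, so the real supremum is genuine. *)
definition complementary :: "(real \<Rightarrow> real) \<Rightarrow> real \<Rightarrow> real" where
  "complementary \<phi> t = (SUP s\<in>{0<..}. s * t - \<phi> s)"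

definition interval :: "ereal \<Rightarrow> real set" where
  "interval a = {t. 0 < t \<and> ereal t < a}"

(* A function on I is a real function on the whole line whose values off I are irrelevant: every
   notion below depends on the restriction to I only. *)
definition L0 :: "real set \<Rightarrow> (real \<Rightarrow> real) set" where
  "L0 I = borel_measurable (lebesgue_on I)"

definition weight_function :: "real set \<Rightarrow> (real \<Rightarrow> real) \<Rightarrow> bool" where
  "weight_function I w \<longleftrightarrow> w \<in> L0 I \<and> (\<forall>t\<in>I. 0 \<le> w t) \<and> antimono_on I w"

definition distrib_fun :: "real set \<Rightarrow> (real \<Rightarrow> real) \<Rightarrow> real \<Rightarrow> ennreal" where
  "distrib_fun I f s = emeasure lebesgue {t \<in> I. \<bar>f t\<bar> > s}"

(* The infimum of the empty set is \<infinity>; this occurs when I is unbounded and every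
   superlevel set of |f| has infinite measure. *)
definition rearr :: "real set \<Rightarrow> (real \<Rightarrow> real) \<Rightarrow> real \<Rightarrow> ennreal" where
  "rearr I f t = (INF s\<in>{s. 0 \<le> s \<and> distrib_fun I f s \<le> ennreal t}. ennreal s)"

definition submajorized :: "real set \<Rightarrow> (real \<Rightarrow> real) \<Rightarrow> (real \<Rightarrow> real) \<Rightarrow> bool" where
  "submajorized I g f \<longleftrightarrow>
     (\<forall>t\<in>I. (\<integral>\<^sup>+ s. rearr I g s \<partial>lebesgue_on {0<..<t}) \<le> (\<integral>\<^sup>+ s. rearr I f s \<partial>lebesgue_on {0<..<t}))"

(* A normed function space is given by its carrier set together with an ennreal-valued norm,
   which is to be read on the carrier. *)

definition luxemburg :: "((real \<Rightarrow> real) \<Rightarrow> ennreal) \<Rightarrow> (real \<Rightarrow> real) \<Rightarrow> ennreal" where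
  "luxemburg \<rho> f = (INF \<epsilon>\<in>{\<epsilon>. 0 < \<epsilon> \<and> \<rho> (\<lambda>t. f t / \<epsilon>) \<le> 1}. ennreal \<epsilon>)"

definition orlicz_modular ::
  "(real \<Rightarrow> real) \<Rightarrow> (real \<Rightarrow> real) \<Rightarrow> real set \<Rightarrow> (real \<Rightarrow> real) \<Rightarrow> ennreal" where
  "orlicz_modular \<phi> w I f = (\<integral>\<^sup>+ t. ennreal (\<phi> \<bar>f t\<bar> * w t) \<partial>lebesgue_on I)"

definition orlicz_space :: "(real \<Rightarrow> real) \<Rightarrow> (real \<Rightarrow> real) \<Rightarrow> real set \<Rightarrow> (real \<Rightarrow> real) set" where
  "orlicz_space \<phi> w I = {f \<in> L0 I. \<exists>c>0. orlicz_modular \<phi> w I (\<lambda>t. c * f t) < \<infinity>}"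

definition orlicz_norm :: "(real \<Rightarrow> real) \<Rightarrow> (real \<Rightarrow> real) \<Rightarrow> real set \<Rightarrow> (real \<Rightarrow> real) \<Rightarrow> ennreal" where
  "orlicz_norm \<phi> w I = luxemburg (orlicz_modular \<phi> w I)"

definition orlicz_lorentz :: "(real \<Rightarrow> real) \<Rightarrow> (real \<Rightarrow> real) \<Rightarrow> real set \<Rightarrow> (real \<Rightarrow> real) set" where
  "orlicz_lorentz \<psi> w I =
     {f \<in> L0 I. (\<forall>t\<in>I. rearr I f t < \<infinity>) \<and> (\<lambda>t. enn2real (rearr I f t)) \<in> orlicz_space \<psi> w I}"

(* The Orlicz norm on the Orlicz-Lorentz space of the function complementary to \<phi>.
   There the rearrangement of f is finite and, by Hoelder's inequality, every integral below
   converges; passing to ennreal truncates negative values, which does not affect the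
   supremum since g = 0 is admissible. *)
definition orlicz_lorentz_norm0 ::
  "(real \<Rightarrow> real) \<Rightarrow> (real \<Rightarrow> real) \<Rightarrow> real set \<Rightarrow> (real \<Rightarrow> real) \<Rightarrow> ennreal" where
  "orlicz_lorentz_norm0 \<phi> w I f =
     (SUP g\<in>{g \<in> orlicz_space \<phi> w I. orlicz_norm \<phi> w I g \<le> 1}.
        ennreal (\<integral> t. enn2real (rearr I f t) * g t * w t \<partial>lebesgue_on I))"

definition P_modular ::
  "(real \<Rightarrow> real) \<Rightarrow> (real \<Rightarrow> real) \<Rightarrow> real set \<Rightarrow> (real \<Rightarrow> real) \<Rightarrow> ennreal" where
  "P_modular \<phi> w I f =
     (INF v\<in>{v \<in> L0 I. (\<forall>t\<in>I. 0 \<le> v t) \<and> submajorized I v w}.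
        \<integral>\<^sup>+ t. (if v t = 0 then (if f t = 0 then 0 else \<infinity>)
               else ennreal (\<phi> (\<bar>f t\<bar> / v t) * v t)) \<partial>lebesgue_on I)"

definition M_norm :: "(real \<Rightarrow> real) \<Rightarrow> (real \<Rightarrow> real) \<Rightarrow> real set \<Rightarrow> (real \<Rightarrow> real) \<Rightarrow> ennreal" where
  "M_norm \<phi> w I = luxemburg (P_modular \<phi> w I)"

definition M_space :: "(real \<Rightarrow> real) \<Rightarrow> (real \<Rightarrow> real) \<Rightarrow> real set \<Rightarrow> (real \<Rightarrow> real) set" where
  "M_space \<phi> w I = {f \<in> L0 I. M_norm \<phi> w I f < \<infinity>}"

definition kothe_dual :: "real set \<Rightarrow> (real \<Rightarrow> real) set \<Rightarrow> (real \<Rightarrow> real) set" where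
  "kothe_dual I E = {f \<in> L0 I. \<forall>g\<in>E. integrable (lebesgue_on I) (\<lambda>t. f t * g t)}"

definition kothe_dual_norm ::
  "real set \<Rightarrow> (real \<Rightarrow> real) set \<Rightarrow> ((real \<Rightarrow> real) \<Rightarrow> ennreal) \<Rightarrow> (real \<Rightarrow> real) \<Rightarrow> ennreal" where
  "kothe_dual_norm I E N f =
     (SUP g\<in>{g \<in> E. N g \<le> 1}. \<integral>\<^sup>+ t. ennreal \<bar>f t * g t\<bar> \<partial>lebesgue_on I)"

end

theory Submission
  imports Defs "HOL-Library.Diagonal_Subsequence"
begin

text \<open>
  Write \<open>\<psi>\<close> for the function complementary to \<open>\<phi>\<close> and \<open>\<rho>(g) = \<integral> \<psi>(g\<^sup>*) w\<close>.

  If \<open>\<integral> \<phi>(h) v \<le> 1\<close> with \<open>v \<prec> w\<close>, then \<open>\<integral> h v |g| \<le> \<parallel>g\<parallel>\<^sup>0\<close>: for a step function \<open>g\<close>, transport the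
  masses of \<open>v\<close> on the steps monotonically into those of \<open>w\<close>. As \<open>v \<prec> w\<close>, mass only moves towards
  larger values of \<open>g\<close>, and averaging \<open>h\<close> along the transport gives by Jensen an admissible competitor
  in the definition of \<open>\<parallel>g\<parallel>\<^sup>0\<close>. Hence \<open>\<integral> |f g| \<le> \<parallel>f\<parallel>\<^sub>M \<parallel>g\<parallel>\<^sup>0\<close>.

  Conversely \<open>P(f) \<le> sup\<^sub>g (\<integral> |f| g - \<rho>(g))\<close>. For a step function \<open>f\<close> with ordered steps, let \<open>h\<close> be
  the slopes of the least concave majorant of \<open>\<integral> f\<^sup>*\<close> with respect to \<open>\<integral> w\<close>; then \<open>v = f / h \<prec> w\<close>, and
  choosing \<open>g\<close> as a subgradient of \<open>\<phi>\<close> at \<open>h\<close> turns Young's inequality into an equality. Since \<open>v\<close> is a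
  monotone function of \<open>f\<close>, Helly's selection theorem yields the general case. With
  \<open>\<parallel>g\<parallel>\<^sup>0 \<le> 1 + \<rho>(g)\<close> this bounds \<open>\<parallel>f\<parallel>\<^sub>M\<close> by the dual norm, and a gliding hump argument shows that the
  dual norm is finite on the Koethe dual.
\<close>

section \<open>Complementary functions and finite sequences\<close>

text \<open>\<open>P\<close> is an infimum over weights with no evident compactness, and its
  integrand degenerates at \<open>v = 0\<close>. Both constructions, the transport and the majorant,
  are elementary for finite sequences, so the real work lies in the limits. Fatou's lemma suffices
  for them, because the integrand, with value \<infinity> at \<open>v = 0\<close>,
  \<open>f \<noteq> 0\<close>, is lower semicontinuous (superlinear growth of \<open>\<phi>\<close>)
  and because submajorization by \<open>w\<close> survives limits almost everywhere. Compactness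
  enters only through Helly's theorem; this is why \<open>v\<close> is kept a monotone function of
  \<open>|f|\<close>.

  The dual norm gives a homogeneous inequality, while \<open>P(f) \<le> 1\<close> requires the
  additive one \<open>\<integral> |f| g \<le> 1 + \<rho>(g)\<close>. Passing from \<open>g\<close>
  to \<open>g / (1 + \<rho>(g))\<close> converts one into the other and preserves the constant 1,
  hence the equality of the norms.

  The gliding hump needs an infinite sum inside the Orlicz-Lorentz space. Completeness is replaced
  by two facts: on nonnegative simple functions with support of finite measure
  \<open>\<rho>(g)\<close> is the maximum of \<open>\<integral> v \<psi>(g)\<close> over
  \<open>v \<prec> w\<close>, so it inherits convexity, and Fatou's lemma bounds
  \<open>\<rho>\<close> of the infinite sum.\<close>

lemma convex_on_subconvex_sum:
  fixes f :: "real \<Rightarrow> real" and a y :: "nat \<Rightarrow> real"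
  assumes f: "convex_on C f" "f 0 = 0" "0 \<in> C"
    and a: "\<And>i. i < n \<Longrightarrow> 0 \<le> a i" "(\<Sum>i<n. a i) \<le> 1" and y: "\<And>i. i < n \<Longrightarrow> y i \<in> C"
  shows "f (\<Sum>i<n. a i * y i) \<le> (\<Sum>i<n. a i * f (y i))"
proof -
  \<comment> \<open>The missing mass is placed at the point 0, where \<open>f\<close> vanishes;
    ordinary Jensen then applies to \<open>n + 1\<close> points.\<close>
  define a' where "a' i = (if i < n then a i else 1 - (\<Sum>i<n. a i))" for i
  define y' where "y' i = (if i < n then y i else 0)" for i
  have "f (\<Sum>i<Suc n. a' i *\<^sub>R y' i) \<le> (\<Sum>i<Suc n. a' i * f (y' i))"
  proof (rule convex_on_sum[OF _ _ f(1)])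
    show "(\<Sum>i<Suc n. a' i) = 1" by (simp add: a'_def)
  qed (use assms in \<open>auto simp: a'_def y'_def\<close>)
  then show ?thesis by (simp add: a'_def y'_def f(2))
qed

section \<open>N-functions, supporting lines, and the complementary function\<close>

locale N_fun =
  fixes \<phi> :: "real \<Rightarrow> real"
  assumes N: "N_function \<phi>"
begin

abbreviation "\<psi> \<equiv> complementary \<phi>"

lemma phi_0 [simp]: "\<phi> 0 = 0"
  using N by (simp add: N_function_def orlicz_function_def)

lemma phi_convex: "convex_on {0..} \<phi>"
  using N by (simp add: N_function_def orlicz_function_def)

lemma phi_strict: "0 \<le> x \<Longrightarrow> x < y \<Longrightarrow> \<phi> x < \<phi> y"
  using N by (auto simp: N_function_def orlicz_function_def strict_mono_on_def)

lemma phi_mono: "0 \<le> x \<Longrightarrow> x \<le> y \<Longrightarrow> \<phi> x \<le> \<phi> y"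
  using phi_strict[of x y] by (cases "x = y") auto

lemma phi_nonneg [simp]: "0 \<le> x \<Longrightarrow> 0 \<le> \<phi> x"
  using phi_mono[of 0 x] by simp

lemma phi_pos: "0 < x \<Longrightarrow> 0 < \<phi> x"
  using phi_strict[of 0 x] by simp

lemma phi_scale:
  assumes "0 \<le> l" "l \<le> 1" "0 \<le> x"
  shows "\<phi> (l * x) \<le> l * \<phi> x"
  using convex_onD[OF phi_convex, of l 0 x] assms by (simp add: algebra_simps)

lemma phi_superlinear: "eventually (\<lambda>t. K * t \<le> \<phi> t) at_top"
proof -
  have "eventually (\<lambda>t. K \<le> \<phi> t / t) at_top"
    using N by (auto simp: N_function_def filterlim_at_top)
  with eventually_gt_at_top[of 0] show ?thesis
    by eventually_elim (simp add: field_simps)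
qed

text \<open>Convexity and \<open>\<phi> 0 = 0\<close> give
  \<open>x * \<phi> 1 \<le> \<phi> x\<close> for \<open>x \<ge> 1\<close>. The bound makes
  \<open>\<integral> h v\<close> finite wherever \<open>\<integral> v\<close> and
  \<open>\<integral> \<phi>(h) v\<close> are.\<close>

lemma phi_linear_bound: "0 \<le> x \<Longrightarrow> x \<le> 1 + \<phi> x / \<phi> 1"
proof (cases "x \<le> 1")
  case False
  then have "\<phi> ((1/x) * x) \<le> (1/x) * \<phi> x" by (intro phi_scale) auto
  then have "x * \<phi> 1 \<le> \<phi> x" using False by (simp add: field_simps)
  then have "x \<le> \<phi> x / \<phi> 1" using phi_pos[of 1] by (simp add: field_simps)
  then show ?thesis by simp
qed (use phi_pos[of 1] in \<open>simp add: add_increasing2\<close>)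

lemma phi_subgradient:
  assumes "0 < x"
  obtains p where "0 \<le> p" "\<And>y. 0 \<le> y \<Longrightarrow> \<phi> x + p * (y - x) \<le> \<phi> y"
proof -
  \<comment> \<open>The infimum of the difference quotients to the right of \<open>x\<close>, that
    is, the right derivative. Its sign follows from the supporting line at
    \<open>y = 0\<close>.\<close>
  define p where "p = Inf ((\<lambda>t. (\<phi> x - \<phi> t) / (x - t)) ` ({x<..} \<inter> {0..}))"
  have 1: "\<phi> x + p * (y - x) \<le> \<phi> y" if "0 \<le> y" for y
    using convex_le_Inf_differential[OF phi_convex, of x y] assms that
    by (simp add: p_def interior_Ici[of "-1"])
  have "p * x \<ge> \<phi> x" using 1[of 0] by (simp add: algebra_simps)
  then have "0 \<le> p" using phi_pos[OF assms] assms
    by (smt (verit, best) mult_neg_pos)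
  with 1 that show ?thesis by blast
qed

lemma phi_continuous: "continuous_on {0..} \<phi>"
proof -
  have c1: "continuous_on {0<..} \<phi>"
    by (rule convex_on_continuous) (auto intro: convex_on_subset[OF phi_convex])
  have c2: "(\<phi> \<longlongrightarrow> 0) (at 0 within {0..})"
  proof (rule tendsto_sandwich[of "\<lambda>_. 0" _ _ "\<lambda>x. x * \<phi> 1"])
    show "\<forall>\<^sub>F x in at 0 within {0..}. 0 \<le> \<phi> x"
      by (auto simp: eventually_at intro!: exI[of _ 1])
    show "\<forall>\<^sub>F x in at 0 within {0..}. \<phi> x \<le> x * \<phi> 1"
      by (auto simp: eventually_at dist_real_def intro!: exI[of _ 1])
        (metis abs_of_nonneg less_eq_real_def mult.right_neutral phi_scale zero_le_one)
    show "((\<lambda>x. x * \<phi> 1) \<longlongrightarrow> 0) (at 0 within {0..})"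
      by (auto intro!: tendsto_eq_intros)
  qed auto
  show ?thesis
    unfolding continuous_on_def
  proof
    fix x :: real assume "x \<in> {0..}"
    then consider "x = 0" | "0 < x" by fastforce
    then show "(\<phi> \<longlongrightarrow> \<phi> x) (at x within {0..})"
    proof cases
      case 2
      then have "isCont \<phi> x" using c1 by (simp add: continuous_on_eq_continuous_at)
      then show ?thesis by (metis continuous_at_imp_continuous_at_within continuous_within)
    qed (use c2 in simp)
  qed
qed

lemma phi_measurable [measurable]:
  assumes [measurable]: "f \<in> borel_measurable M"
  shows "(\<lambda>x. \<phi> \<bar>f x\<bar>) \<in> borel_measurable M"
proof -
  \<comment> \<open>Nothing is known of \<open>\<phi>\<close> on the negative axis, so measurability
    is taken from a monotone extension of its restriction to the half-line.\<close>
  have "mono (\<lambda>x. \<phi> (max 0 x))" by (auto simp: mono_def intro!: phi_mono)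
  from borel_measurable_mono[OF this] have "(\<lambda>x. \<phi> (max 0 x)) \<in> borel_measurable borel" .
  then have "(\<lambda>x. \<phi> (max 0 \<bar>f x\<bar>)) \<in> borel_measurable M" by measurable
  then show ?thesis by simp
qed

text \<open>Superlinear growth enters here: beyond \<open>M\<close> the term \<open>s * t\<close> is
  absorbed by \<open>\<phi> s\<close>, so the real supremum defining \<open>\<psi>\<close> is
  genuine.\<close>

lemma psi_bdd: "bdd_above ((\<lambda>s. s * t - \<phi> s) ` {0<..})"
proof -
  obtain M where M: "\<And>s. s \<ge> M \<Longrightarrow> t * s \<le> \<phi> s"
    using phi_superlinear[of t] by (auto simp: eventually_at_top_linorder)
  have "s * t - \<phi> s \<le> \<bar>M\<bar> * \<bar>t\<bar>" if "0 < s" for s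
  proof (cases "s \<ge> M")
    case True
    have "s * t - \<phi> s \<le> 0" using M[OF True] by (simp add: mult.commute)
    also have "0 \<le> \<bar>M\<bar> * \<bar>t\<bar>" by simp
    finally show ?thesis .
  next
    case False
    have "s * t \<le> s * \<bar>t\<bar>" using that by (intro mult_left_mono) auto
    also have "\<dots> \<le> \<bar>M\<bar> * \<bar>t\<bar>" using False that by (intro mult_right_mono) auto
    finally show ?thesis using phi_pos[OF that] by simp
  qed
  then show ?thesis by (intro bdd_aboveI2) auto
qed

lemma psi_ge: "0 < s \<Longrightarrow> s * t - \<phi> s \<le> \<psi> t"
  unfolding complementary_def by (rule cSUP_upper[OF _ psi_bdd]) auto

lemma psi_le: "(\<And>s. 0 < s \<Longrightarrow> s * t - \<phi> s \<le> c) \<Longrightarrow> \<psi> t \<le> c"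
  unfolding complementary_def by (rule cSUP_least) auto

text \<open>The supremum runs over \<open>s > 0\<close> only, so monotonicity, and convexity below,
  hold on the whole line. Continuity and measurability of \<open>\<psi>\<close> then follow with no
  one-sided argument at 0.\<close>

lemma psi_mono: "mono \<psi>"
proof
  fix x y :: real assume "x \<le> y"
  show "\<psi> x \<le> \<psi> y"
  proof (rule psi_le)
    fix s :: real assume s: "0 < s"
    have "s * x \<le> s * y" using \<open>x \<le> y\<close> s by simp
    then show "s * x - \<phi> s \<le> \<psi> y" using psi_ge[OF s, of y] by linarith
  qed
qed

lemma psi_nonneg [simp]:
  assumes "0 \<le> t" shows "0 \<le> \<psi> t"
proof (rule ccontr)
  assume "\<not> 0 \<le> \<psi> t"
  then have n: "\<psi> t < 0" by simp
  \<comment> \<open>The value \<open>s = 0\<close> is excluded from the supremum, so a small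
    \<open>s\<close> replaces it: \<open>e\<close> is chosen with
    \<open>\<phi> e \<le> - \<psi> t / 2\<close>.\<close>
  define e where "e = min 1 (- \<psi> t / (2 * \<phi> 1))"
  have p1: "0 < \<phi> 1" by (simp add: phi_pos)
  have e: "0 < e" "e \<le> 1" using n p1 by (auto simp: e_def divide_neg_pos)
  have "\<phi> e \<le> e * \<phi> 1" using phi_scale[of e 1] e by simp
  also have "\<dots> \<le> (- \<psi> t / (2 * \<phi> 1)) * \<phi> 1"
    using p1 by (intro mult_right_mono) (auto simp: e_def)
  also have "\<dots> = - \<psi> t / 2" using p1 by simp
  finally have "\<phi> e \<le> - \<psi> t / 2" .
  moreover have "e * t - \<phi> e \<le> \<psi> t" using psi_ge e by blast
  moreover have "0 \<le> e * t" using e assms by simp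
  ultimately show False using n by linarith
qed

lemma psi_0 [simp]: "\<psi> 0 = 0"
proof (rule antisym)
  show "\<psi> 0 \<le> 0" by (rule psi_le) (use phi_pos less_imp_le in auto)
qed simp

lemma young:
  assumes "0 \<le> s" "0 \<le> t" shows "s * t \<le> \<phi> s + \<psi> t"
  using psi_ge[of s t] assms by (cases "s = 0") auto

text \<open>The equality case of Young's inequality: along a supporting line of slope
  \<open>p\<close> at \<open>h\<close>, the expression \<open>s * p - \<phi> s\<close> is largest at
  \<open>s = h\<close>.\<close>

lemma psi_subgradient_eq:
  assumes "0 < h" "\<And>y. 0 \<le> y \<Longrightarrow> \<phi> h + p * (y - h) \<le> \<phi> y"
  shows "\<psi> p = h * p - \<phi> h"
proof (rule antisym)
  show "\<psi> p \<le> h * p - \<phi> h"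
  proof (rule psi_le)
    fix s :: real assume "0 < s"
    then show "s * p - \<phi> s \<le> h * p - \<phi> h"
      using assms(2)[of s] by (simp add: algebra_simps)
  qed
qed (rule psi_ge[OF assms(1)])

lemma psi_convex: "convex_on UNIV \<psi>"
proof (rule convex_onI)
  fix t x y :: real assume t: "0 < t" "t < 1"
  show "\<psi> ((1 - t) *\<^sub>R x + t *\<^sub>R y) \<le> (1 - t) * \<psi> x + t * \<psi> y"
  proof (rule psi_le)
    fix s :: real assume s: "0 < s"
    have "(1 - t) * (s * x - \<phi> s) + t * (s * y - \<phi> s) \<le> (1 - t) * \<psi> x + t * \<psi> y"
      using t by (intro add_mono mult_left_mono psi_ge s) auto
    then show "s * ((1 - t) *\<^sub>R x + t *\<^sub>R y) - \<phi> s \<le> (1 - t) * \<psi> x + t * \<psi> y"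
      by (simp add: algebra_simps)
  qed
qed auto

lemma psi_scale:
  assumes "0 \<le> l" "l \<le> 1"
  shows "\<psi> (l * x) \<le> l * \<psi> x"
  using convex_onD[OF psi_convex, of l 0 x] assms by (simp add: algebra_simps)

lemma psi_continuous: "continuous_on UNIV \<psi>"
  by (rule convex_on_continuous[OF open_UNIV psi_convex])

lemma psi_measurable [measurable]: "\<psi> \<in> borel_measurable borel"
  by (rule borel_measurable_mono[OF psi_mono])

end

text \<open>Lay the masses \<open>V\<close> and the masses \<open>W\<close> end to end from 0; the
  \<open>i\<close>-th interval of \<open>V\<close> sends to the \<open>j\<close>-th of
  \<open>W\<close> what they share. The condition on partial sums says that the \<open>i\<close>-th
  interval of \<open>V\<close> ends no later than the \<open>i\<close>-th of \<open>W\<close>, so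
  mass moves only to indices \<open>j \<le> i\<close>.\<close>

lemma transport_plan:
  fixes V W :: "nat \<Rightarrow> real"
  assumes V: "\<And>i. i < n \<Longrightarrow> 0 \<le> V i" and W: "\<And>i. i < n \<Longrightarrow> 0 \<le> W i"
    and le: "\<And>j. j \<le> n \<Longrightarrow> (\<Sum>i<j. V i) \<le> (\<Sum>i<j. W i)"
  obtains \<pi> where "\<And>i j. i < n \<Longrightarrow> j < n \<Longrightarrow> 0 \<le> \<pi> i j"
    and "\<And>i. i < n \<Longrightarrow> (\<Sum>j<n. \<pi> i j) = V i"
    and "\<And>j. j < n \<Longrightarrow> (\<Sum>i<n. \<pi> i j) \<le> W j"
    and "\<And>i j. i < n \<Longrightarrow> j < n \<Longrightarrow> i < j \<Longrightarrow> \<pi> i j = 0"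
proof -
  define v w where "v j = (\<Sum>i<j. V i)" and "w j = (\<Sum>i<j. W i)" for j
  define cl where "cl j x = min (max x (w j)) (w (Suc j))" for j x
  \<comment> \<open>the length of the overlap of \<open>[v i, v (Suc i)]\<close> and \<open>[w j, w (Suc j)]\<close>\<close>
  define \<pi> where "\<pi> i j = cl j (v (Suc i)) - cl j (v i)" for i j
  have vS: "v i \<le> v (Suc i)" if "i < n" for i using V[OF that] by (simp add: v_def)
  have wS: "w i \<le> w (Suc i)" if "i < n" for i using W[OF that] by (simp add: w_def)
  have wmono: "i \<le> j \<Longrightarrow> w i \<le> w j" if "j \<le> n" for i j
    using that by (induction j) (auto simp: le_Suc_eq intro: order_trans[OF _ wS])
  have vmono: "i \<le> j \<Longrightarrow> v i \<le> v j" if "j \<le> n" for i j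
    using that by (induction j) (auto simp: le_Suc_eq intro: order_trans[OF _ vS])
  have v0: "0 \<le> v i" if "i \<le> n" for i using vmono[OF that, of 0] by (simp add: v_def)
  have w0: "0 \<le> w i" if "i \<le> n" for i using wmono[OF that, of 0] by (simp add: w_def)
  \<comment> \<open>\<open>cl j x - w j\<close> is the length of the part of \<open>[0, x]\<close>
    inside the \<open>j\<close>-th interval of \<open>W\<close>. These parts fill
    \<open>[0, min x (w k)]\<close>.\<close>
  have cl_sum: "(\<Sum>j<k. cl j x - w j) = min x (w k)" if "k \<le> n" "0 \<le> x" for k x
    using that
  proof (induction k)
    case (Suc k)
    then show ?case using wS[of k] by (auto simp: cl_def min_def max_def)
  qed (simp add: w_def)
  show thesis
  proof (rule that[of \<pi>])
    show "0 \<le> \<pi> i j" if "i < n" "j < n" for i j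
      using vS[OF that(1)] by (auto simp: \<pi>_def cl_def)
    show "(\<Sum>j<n. \<pi> i j) = V i" if "i < n" for i
    proof -
      have "(\<Sum>j<n. \<pi> i j) = (\<Sum>j<n. (cl j (v (Suc i)) - w j) - (cl j (v i) - w j))"
        by (simp add: \<pi>_def)
      also have "\<dots> = min (v (Suc i)) (w n) - min (v i) (w n)"
        using cl_sum[OF order_refl v0[of "Suc i"]] cl_sum[OF order_refl v0[of i]] that
        by (simp only: sum_subtractf[of _ _ "{..<n}"])
      also have "\<dots> = v (Suc i) - v i"
      proof -
        have "v (Suc i) \<le> v n" "v i \<le> v n" using that by (auto intro!: vmono)
        moreover have "v n \<le> w n" using le[of n] by (simp add: v_def w_def)
        ultimately show ?thesis by simp
      qed
      finally show ?thesis by (simp add: v_def)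
    qed
    show "(\<Sum>i<n. \<pi> i j) \<le> W j" if "j < n" for j
    proof -
      have "(\<Sum>i<n. \<pi> i j) = cl j (v n) - cl j (v 0)"
        unfolding \<pi>_def by (rule sum_lessThan_telescope)
      also have "\<dots> \<le> w (Suc j) - w j"
        using wS[OF that] by (auto simp: cl_def)
      finally show ?thesis by (simp add: w_def)
    qed
    show "\<pi> i j = 0" if "i < n" "j < n" "i < j" for i j
    proof -
      have "v (Suc i) \<le> w (Suc i)" using le[of "Suc i"] that by (simp add: v_def w_def)
      also have "\<dots> \<le> w j" using that by (intro wmono) auto
      finally have "v (Suc i) \<le> w j" .
      with vS[OF that(1)] wS[OF that(2)] show ?thesis by (auto simp: \<pi>_def cl_def)
    qed
  qed
qed

text \<open>\<open>k j\<close> averages \<open>h\<close> over the mass that arrives at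
  \<open>j\<close>. Less than \<open>W j\<close> may arrive; the deficit counts as value 0, so the
  subconvex form of Jensen is used. Mass moves to smaller indices, where the decreasing
  \<open>c\<close> is larger, which gives the second estimate.\<close>

lemma (in N_fun) transport_weights:
  fixes V W c h :: "nat \<Rightarrow> real"
  assumes V: "\<And>i. i < n \<Longrightarrow> 0 \<le> V i" and W: "\<And>i. i < n \<Longrightarrow> 0 < W i"
    and le: "\<And>j. j \<le> n \<Longrightarrow> (\<Sum>i<j. V i) \<le> (\<Sum>i<j. W i)"
    and h: "\<And>i. i < n \<Longrightarrow> 0 \<le> h i"
    and c: "\<And>i j. i \<le> j \<Longrightarrow> j < n \<Longrightarrow> c j \<le> c i"
  obtains k where "\<And>i. i < n \<Longrightarrow> 0 \<le> k i"
    and "(\<Sum>i<n. \<phi> (k i) * W i) \<le> (\<Sum>i<n. \<phi> (h i) * V i)"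
    and "(\<Sum>i<n. c i * h i * V i) \<le> (\<Sum>i<n. c i * k i * W i)"
proof -
  obtain \<pi> where p0: "\<And>i j. i < n \<Longrightarrow> j < n \<Longrightarrow> 0 \<le> \<pi> i j"
    and pV: "\<And>i. i < n \<Longrightarrow> (\<Sum>j<n. \<pi> i j) = V i"
    and pW: "\<And>j. j < n \<Longrightarrow> (\<Sum>i<n. \<pi> i j) \<le> W j"
    and pl: "\<And>i j. i < n \<Longrightarrow> j < n \<Longrightarrow> i < j \<Longrightarrow> \<pi> i j = 0"
    by (rule transport_plan[of n V W, OF V less_imp_le[OF W] le]) (assumption+, rule that)
  define k where "k j = (\<Sum>i<n. \<pi> i j / W j * h i)" for j
  have k0: "0 \<le> k j" if "j < n" for j
    unfolding k_def using that h p0 W by (intro sum_nonneg mult_nonneg_nonneg divide_nonneg_nonneg) (auto simp: less_imp_le)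
  have jensen: "\<phi> (k j) * W j \<le> (\<Sum>i<n. \<pi> i j * \<phi> (h i))" if j: "j < n" for j
  proof -
    have "(\<Sum>i<n. \<pi> i j / W j) \<le> 1"
      using pW[OF j] W[OF j] by (simp add: sum_divide_distrib[symmetric])
    then have "\<phi> (k j) \<le> (\<Sum>i<n. \<pi> i j / W j * \<phi> (h i))"
      unfolding k_def using p0 W j h
      by (intro convex_on_subconvex_sum[OF phi_convex]) (auto simp: less_imp_le)
    then have "\<phi> (k j) * W j \<le> (\<Sum>i<n. \<pi> i j / W j * \<phi> (h i)) * W j"
      using W[OF j] by (intro mult_right_mono) auto
    also have "\<dots> = (\<Sum>i<n. \<pi> i j * \<phi> (h i))"
      using W[OF j] by (simp add: sum_distrib_right)
    finally show ?thesis .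
  qed
  show thesis
  proof (rule that[of k])
    show "0 \<le> k i" if "i < n" for i by (rule k0[OF that])
    have "(\<Sum>j<n. \<phi> (k j) * W j) \<le> (\<Sum>j<n. \<Sum>i<n. \<pi> i j * \<phi> (h i))"
      by (intro sum_mono jensen) auto
    also have "\<dots> = (\<Sum>i<n. \<Sum>j<n. \<pi> i j * \<phi> (h i))" by (rule sum.swap)
    also have "\<dots> = (\<Sum>i<n. \<phi> (h i) * V i)"
      by (intro sum.cong) (auto simp: sum_distrib_right[symmetric] pV)
    finally show "(\<Sum>i<n. \<phi> (k i) * W i) \<le> (\<Sum>i<n. \<phi> (h i) * V i)" .
    have "(\<Sum>i<n. c i * h i * V i) = (\<Sum>i<n. \<Sum>j<n. \<pi> i j * c i * h i)"
      by (intro sum.cong) (auto simp: sum_distrib_right[symmetric] sum_distrib_left[symmetric] pV mult_ac)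
    also have "\<dots> \<le> (\<Sum>i<n. \<Sum>j<n. \<pi> i j * c j * h i)"
    proof (intro sum_mono)
      fix i j assume "i \<in> {..<n}" "j \<in> {..<n}"
      then have ij: "i < n" "j < n" by auto
      show "\<pi> i j * c i * h i \<le> \<pi> i j * c j * h i"
      proof (cases "i < j")
        case False
        then show ?thesis using c[of j i] ij p0[OF ij] h[of i] by (intro mult_right_mono mult_left_mono) auto
      qed (use pl ij in simp)
    qed
    also have "\<dots> = (\<Sum>j<n. \<Sum>i<n. \<pi> i j * c j * h i)" by (rule sum.swap)
    also have "\<dots> = (\<Sum>j<n. c j * k j * W j)"
    proof (intro sum.cong refl)
      fix j assume "j \<in> {..<n}"
      then have "W j \<noteq> 0" using W[of j] by auto
      then show "(\<Sum>i<n. \<pi> i j * c j * h i) = c j * k j * W j"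
        by (simp add: k_def sum_distrib_left sum_distrib_right mult_ac)
    qed
    finally show "(\<Sum>i<n. c i * h i * V i) \<le> (\<Sum>i<n. c i * k i * W i)" .
  qed
qed

text \<open>\<open>h\<close> are the slopes of the least concave majorant of the polygon through the points
  \<open>(\<Sum>i<j. W i, \<Sum>i<j. F i)\<close>, and \<open>m\<close> are the lengths of the steps.\<close>
definition majorant_slopes where
  "majorant_slopes n F W m h \<longleftrightarrow> (\<forall>i<n. 0 < h i) \<and> (\<forall>i j. i \<le> j \<longrightarrow> j < n \<longrightarrow> h j \<le> h i) \<and>
     (\<forall>j\<le>n. (\<Sum>i<j. F i / h i) \<le> (\<Sum>i<j. W i)) \<and>
     (\<forall>\<gamma> :: real \<Rightarrow> real. (\<Sum>i<n. \<gamma> (h i) * (F i / h i)) = (\<Sum>i<n. \<gamma> (h i) * W i)) \<and>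
     (\<forall>i j. i \<le> j \<longrightarrow> j < n \<longrightarrow> F j / h j / m j \<le> F i / h i / m i) \<and>
     (\<forall>H. (\<forall>j\<le>n. (\<Sum>i<j. F i) \<le> H * (\<Sum>i<j. W i)) \<longrightarrow> (\<forall>i<n. h i \<le> H))"
  for n :: nat and F W m h :: "nat \<Rightarrow> real"

text \<open>For \<open>v i = F i / h i / m i\<close>: (3) becomes the submajorization of
  \<open>v\<close>, (5) its monotonicity, and (4) says that \<open>F / h\<close> and
  \<open>W\<close> have the same total on each face, where \<open>h\<close> is constant. (6) serves
  the induction, bounding the later slopes by that of the first face.\<close>

lemma majorant_slopesD:
  assumes "majorant_slopes n F W m h"
  shows "i < n \<Longrightarrow> 0 < h i"
    and "i \<le> j \<Longrightarrow> j < n \<Longrightarrow> h j \<le> h i"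
    and "j \<le> n \<Longrightarrow> (\<Sum>i<j. F i / h i) \<le> (\<Sum>i<j. W i)"
    and "(\<Sum>i<n. \<gamma> (h i) * (F i / h i)) = (\<Sum>i<n. \<gamma> (h i) * W i)"
    and "i \<le> j \<Longrightarrow> j < n \<Longrightarrow> F j / h j / m j \<le> F i / h i / m i"
    and "(\<And>j. j \<le> n \<Longrightarrow> (\<Sum>i<j. F i) \<le> H * (\<Sum>i<j. W i)) \<Longrightarrow> i < n \<Longrightarrow> h i \<le> H"
  using assms unfolding majorant_slopes_def by simp_all

text \<open>The first face ends at the maximum of \<open>(\<Sum>i<j. F i) / (\<Sum>i<j. W i)\<close>; splitting it off leaves a
  shorter polygon.\<close>
lemma majorant_slopes_exist:
  fixes F W m :: "nat \<Rightarrow> real"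
  assumes "\<And>i. i < n \<Longrightarrow> 0 < F i" "\<And>i. i < n \<Longrightarrow> 0 < W i" "\<And>i. i < n \<Longrightarrow> 0 < m i"
    and "\<And>i j. i \<le> j \<Longrightarrow> j < n \<Longrightarrow> F j / m j \<le> F i / m i"
    and "\<And>i j. i \<le> j \<Longrightarrow> j < n \<Longrightarrow> W j / m j \<le> W i / m i"
  shows "\<exists>h. majorant_slopes n F W m h"
  using assms
proof (induction n arbitrary: F W m rule: less_induct)
  case (less n)
  show ?case
  proof (cases "n = 0")
    case False
    define R where "R j = (\<Sum>i<j. F i) / (\<Sum>i<j. W i)" for j
    have "Max (R ` {1..n}) \<in> R ` {1..n}" using False by (intro Max_in) auto
    then obtain J where Jn: "J \<in> {1..n}" and JM: "R J = Max (R ` {1..n})" by auto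
    have Jmax: "R j \<le> R J" if "j \<in> {1..n}" for j using that by (auto simp: JM)
    define H where "H = R J"
    have Wpos: "0 < (\<Sum>i<j. W i)" if "j \<in> {1..n}" for j
      using that less.prems(2) by (intro sum_pos) (auto simp: lessThan_empty_iff)
    have Fpos: "0 < (\<Sum>i<j. F i)" if "j \<in> {1..n}" for j
      using that less.prems(1) by (intro sum_pos) (auto simp: lessThan_empty_iff)
    have H0: "0 < H" using Wpos[OF Jn] Fpos[OF Jn] by (simp add: H_def R_def)
    have Fle: "(\<Sum>i<j. F i) \<le> H * (\<Sum>i<j. W i)" if "j \<le> n" for j
    proof (cases "j = 0")
      case False
      then have j: "j \<in> {1..n}" using that by auto
      show ?thesis using Jmax[OF j] Wpos[OF j] by (simp add: H_def R_def[of j] field_simps)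
    qed simp
    have Feq: "(\<Sum>i<J. F i) = H * (\<Sum>i<J. W i)"
      using Wpos[OF Jn] by (simp add: H_def R_def)
    define F' W' m' where "F' i = F (J + i)" and "W' i = W (J + i)" and "m' i = m (J + i)" for i
    have lt: "n - J < n" using Jn by auto
    have split: "(\<Sum>i<J + l. g i) = (\<Sum>i<J. g i) + (\<Sum>i<l. g (J + i))" for g :: "nat \<Rightarrow> real" and l
      by (induction l) auto
    have "\<exists>h. majorant_slopes (n - J) F' W' m' h"
      unfolding F'_def W'_def m'_def by (rule less.IH[OF lt]; rule less.prems) auto
    then obtain h' where "majorant_slopes (n - J) F' W' m' h'" ..
    note h' = majorant_slopesD[OF this]
    \<comment> \<open>The polygon touches the ray of slope \<open>H\<close> at \<open>J\<close> and
      never rises above it, so the polygon restarted at \<open>J\<close> also stays below such a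
      ray.\<close>
    have h'leH: "h' i \<le> H" if "i < n - J" for i
    proof (rule h'(6)[OF _ that])
      fix j assume "j \<le> n - J"
      then have "J + j \<le> n" using Jn by auto
      from Fle[OF this] show "(\<Sum>i<j. F' i) \<le> H * (\<Sum>i<j. W' i)"
        by (simp add: split Feq F'_def W'_def algebra_simps)
    qed
    define h where "h i = (if i < J then H else h' (i - J))" for i
    have hJ: "(\<Sum>i<j. F i / h i) = (\<Sum>i<j. F i) / H" if "j \<le> J" for j
      using that by (auto simp: h_def sum_divide_distrib intro!: sum.cong)
    have A1: "\<forall>i<n. 0 < h i" using H0 h'(1) by (auto simp: h_def)
    have A2: "h j \<le> h i" if "i \<le> j" "j < n" for i j
      using that h'leH h'(2) by (auto simp: h_def)
    have A3: "(\<Sum>i<j. F i / h i) \<le> (\<Sum>i<j. W i)" if "j \<le> n" for j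
    proof (cases "j \<le> J")
      case True
      then show ?thesis using Fle[OF that] H0 by (simp add: hJ divide_le_eq mult.commute)
    next
      case False
      define l where "l = j - J"
      have l: "j = J + l" "l \<le> n - J" using that False by (auto simp: l_def)
      have "(\<Sum>i<j. F i / h i) = (\<Sum>i<J. W i) + (\<Sum>i<l. F' i / h' i)"
        using H0 by (simp add: l split hJ Feq F'_def) (simp add: h_def)
      also have "\<dots> \<le> (\<Sum>i<J. W i) + (\<Sum>i<l. W' i)" using h'(3)[OF l(2)] by simp
      finally show ?thesis by (simp add: l split W'_def)
    qed
    have A4: "(\<Sum>i<n. \<gamma> (h i) * (F i / h i)) = (\<Sum>i<n. \<gamma> (h i) * W i)" for \<gamma> :: "real \<Rightarrow> real"
    proof -
      have n: "n = J + (n - J)" using Jn by auto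
      have "(\<Sum>i<J. \<gamma> (h i) * (F i / h i)) = \<gamma> H * (\<Sum>i<J. F i / h i)"
        by (simp add: h_def sum_distrib_left)
      also have "\<dots> = \<gamma> H * (\<Sum>i<J. W i)" using H0 by (simp add: hJ Feq)
      also have "\<dots> = (\<Sum>i<J. \<gamma> (h i) * W i)" by (simp add: h_def sum_distrib_left)
      finally have "(\<Sum>i<J. \<gamma> (h i) * (F i / h i)) = (\<Sum>i<J. \<gamma> (h i) * W i)" .
      moreover have "(\<Sum>i<n - J. \<gamma> (h (J + i)) * (F (J + i) / h (J + i))) = (\<Sum>i<n - J. \<gamma> (h (J + i)) * W (J + i))"
        using h'(4)[of \<gamma>] by (simp add: h_def F'_def W'_def)
      ultimately show ?thesis by (subst (1 2) n) (simp only: split)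
    qed
    have A5: "F j / h j / m j \<le> F i / h i / m i" if ij: "i \<le> j" "j < n" for i j
    proof -
      consider "j < J" | "i < J" "J \<le> j" | "J \<le> i" by linarith
      then show ?thesis
      proof cases
        case 1
        then have "F j / m j / H \<le> F i / m i / H"
          using H0 by (intro divide_right_mono less.prems(4) ij) auto
        then show ?thesis using 1 ij by (simp add: h_def mult.commute)
      next
        case 3
        then show ?thesis using h'(5)[of "i - J" "j - J"] ij by (simp add: h_def F'_def m'_def)
      next
        case 2
        \<comment> \<open>\<open>b\<close> is the last step of the first face. Touching the ray at
          \<open>J\<close> from below forces \<open>H * W b \<le> F b\<close>, while beyond
          \<open>J\<close> the restarted polygon begins with \<open>F J / h J \<le> W J\<close>. The
          decrease of \<open>W / m\<close> links the two sides of the corner.\<close>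
        define b where "b = J - 1"
        have b: "Suc b = J" "b < n" "b < J" using Jn by (auto simp: b_def)
        have "F j / h j / m j \<le> F J / h J / m J"
          using h'(5)[of 0 "j - J"] 2 ij by (simp add: h_def F'_def m'_def)
        also have "\<dots> \<le> W J / m J"
        proof -
          have "F J / h J \<le> W J" using h'(3)[of 1] 2 ij by (simp add: h_def F'_def W'_def)
          then show ?thesis using less.prems(3)[of J] 2 ij by (intro divide_right_mono) auto
        qed
        also have "\<dots> \<le> W b / m b" using 2 ij b by (intro less.prems(5)) auto
        also have "\<dots> \<le> F b / H / m b"
        proof -
          have "(\<Sum>i<b. F i) + F b = H * ((\<Sum>i<b. W i) + W b)" using Feq b(1)[symmetric] by simp
          moreover have "(\<Sum>i<b. F i) \<le> H * (\<Sum>i<b. W i)" using Fle[of b] b by simp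
          ultimately have "H * W b \<le> F b" by (simp add: algebra_simps)
          then have "W b \<le> F b / H" using H0 by (simp add: field_simps)
          then show ?thesis using less.prems(3)[of b] b by (intro divide_right_mono) auto
        qed
        also have "\<dots> = F b / m b / H" by simp
        also have "\<dots> \<le> F i / m i / H"
          using 2 b H0 by (intro divide_right_mono less.prems(4)) auto
        also have "\<dots> = F i / h i / m i" using 2 by (simp add: h_def)
        finally show ?thesis .
      qed
    qed
    have A6: "h i \<le> K" if "\<forall>j\<le>n. (\<Sum>i<j. F i) \<le> K * (\<Sum>i<j. W i)" "i < n" for K i
    proof -
      have "(\<Sum>i<J. F i) \<le> K * (\<Sum>i<J. W i)" using that Jn by auto
      then have "H \<le> K" using Feq Wpos[OF Jn] by simp
      moreover have "h i \<le> H" using h'leH that by (auto simp: h_def)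
      ultimately show ?thesis by simp
    qed
    show ?thesis unfolding majorant_slopes_def
      by (intro exI[of _ h] conjI allI impI A2 A3 A4 A5) (use A1 A6 in auto)
  qed (simp add: majorant_slopes_def)
qed

section \<open>Decreasing rearrangements\<close>

locale ivl =
  fixes a :: ereal and I :: "real set"
  assumes a_pos: "0 < a" and I_def: "I = interval a"
begin

abbreviation "\<mu> \<equiv> lebesgue_on I"

lemma I_eq: "I = {0<..} \<or> (\<exists>r>0. a = ereal r \<and> I = {0<..<r})"
  using a_pos by (cases a) (auto simp: I_def interval_def)

lemma I_sets [measurable, simp]: "I \<in> sets lebesgue"
  using I_eq by auto

lemma I_pos: "t \<in> I \<Longrightarrow> 0 < t"
  by (simp add: I_def interval_def)

lemma I_down: "t \<in> I \<Longrightarrow> 0 < s \<Longrightarrow> s \<le> t \<Longrightarrow> s \<in> I"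
  by (auto simp: I_def interval_def) (meson ereal_less_eq(3) le_less_trans)

lemma I_lessI: "0 < s \<Longrightarrow> s < t \<Longrightarrow> ereal t \<le> a \<Longrightarrow> s \<in> I"
  by (auto simp: I_def interval_def) (meson less_ereal.simps(1) less_le_trans)

lemma ioo_sub: "ereal t \<le> a \<Longrightarrow> {0<..<t} \<subseteq> I"
  by (auto intro: I_lessI)

lemma I_le: "t \<in> I \<Longrightarrow> ereal t \<le> a"
  by (auto simp: I_def interval_def)

lemma sigma_finite_mu: "sigma_finite_measure \<mu>"
proof (rule sigma_finite_measure_restrict_space)
  show "sigma_finite_measure (lebesgue :: real measure)"
  proof
    show "\<exists>A :: real set set. countable A \<and> A \<subseteq> sets lebesgue \<and> \<Union> A = space lebesgue \<and> (\<forall>a\<in>A. emeasure lebesgue a \<noteq> \<infinity>)"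
    proof (intro exI conjI)
      have "x \<in> (\<Union>n. {- real n..real n})" for x :: real
        using real_arch_simple[of "\<bar>x\<bar>"] by (auto simp: abs_le_iff minus_le_iff)
      then show "\<Union> (range (\<lambda>n. {- real n..real n})) = space lebesgue" by auto
    qed auto
  qed
qed simp

lemma sets_mu: "A \<in> sets \<mu> \<longleftrightarrow> A \<subseteq> I \<and> A \<in> sets lebesgue"
  by (subst sets_restrict_space_iff) auto

lemma borel_mu: "f \<in> borel_measurable borel \<Longrightarrow> f \<in> borel_measurable \<mu>"
  by (simp add: measurable_restrict_space1 measurable_completion)

lemma ident_mu [measurable]: "(\<lambda>x. x) \<in> borel_measurable \<mu>"
  by (rule borel_mu) simp

lemma emeasure_mu: "A \<subseteq> I \<Longrightarrow> emeasure \<mu> A = emeasure lebesgue A"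
  by (rule emeasure_restrict_space) auto

lemma nn_integral_ioo:
  assumes "ereal t \<le> a"
  shows "(\<integral>\<^sup>+ s. p s \<partial>lebesgue_on {0<..<t}) = (\<integral>\<^sup>+ s\<in>{0<..<t}. p s \<partial>\<mu>)"
proof -
  have "(\<integral>\<^sup>+ s\<in>{0<..<t}. p s \<partial>\<mu>) = (\<integral>\<^sup>+ s. p s * indicator {0<..<t} s * indicator I s \<partial>lebesgue)"
    by (rule nn_integral_restrict_space) simp
  also have "\<dots> = (\<integral>\<^sup>+ s. p s * indicator {0<..<t} s \<partial>lebesgue)"
    using ioo_sub[OF assms] by (intro nn_integral_cong) (auto simp: indicator_def)
  also have "\<dots> = (\<integral>\<^sup>+ s. p s \<partial>lebesgue_on {0<..<t})"
    by (rule nn_integral_restrict_space[symmetric]) simp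
  finally show ?thesis by simp
qed

lemma distrib_mu: "distrib_fun I f s = emeasure \<mu> {t \<in> I. s < \<bar>f t\<bar>}"
  by (subst emeasure_mu) (auto simp: distrib_fun_def)

lemma L0_sets:
  assumes "f \<in> L0 I" shows "{t \<in> I. s < \<bar>f t\<bar>} \<in> sets \<mu>"
proof -
  have [measurable]: "f \<in> borel_measurable \<mu>" using assms by (simp add: L0_def)
  have "{t \<in> space \<mu>. s < \<bar>f t\<bar>} \<in> sets \<mu>" by measurable
  then show ?thesis by simp
qed

lemma distrib_antimono:
  assumes "f \<in> L0 I" "s \<le> s'" shows "distrib_fun I f s' \<le> distrib_fun I f s"
  unfolding distrib_mu using assms by (intro emeasure_mono L0_sets) auto

lemma distrib_mono:
  assumes "g \<in> L0 I" "\<And>t. t \<in> I \<Longrightarrow> \<bar>f t\<bar> \<le> \<bar>g t\<bar>" shows "distrib_fun I f s \<le> distrib_fun I g s"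
  unfolding distrib_mu using assms by (intro emeasure_mono L0_sets) force+

lemma rearr_le:
  assumes "0 \<le> s" "distrib_fun I f s \<le> ennreal t" shows "rearr I f t \<le> ennreal s"
  unfolding rearr_def by (rule INF_lower) (use assms in auto)

text \<open>The infimum defining the rearrangement is attained when finite, because the distribution
  function is right-continuous: \<open>{s < |f|}\<close> is the increasing union of the sets
  \<open>{s + 1/(n+1) < |f|}\<close>. Arguments about rearrangements can thus be carried out on
  superlevel sets.\<close>

lemma rearr_le_iff:
  assumes f: "f \<in> L0 I" and s: "0 \<le> s"
  shows "rearr I f t \<le> ennreal s \<longleftrightarrow> distrib_fun I f s \<le> ennreal t"
proof
  assume le: "rearr I f t \<le> ennreal s"
  have d: "distrib_fun I f s' \<le> ennreal t" if "s < s'" for s'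
  proof -
    have "rearr I f t < ennreal s'" using le that s by (metis ennreal_less_iff le_less_trans)
    then obtain s'' where "0 \<le> s''" "distrib_fun I f s'' \<le> ennreal t" "ennreal s'' < ennreal s'"
      unfolding rearr_def by (auto simp: INF_less_iff)
    then show ?thesis using distrib_antimono[OF f, of s'' s'] by (auto simp: ennreal_less_iff intro: order_trans)
  qed
  have "{t \<in> I. s < \<bar>f t\<bar>} = (\<Union>n. {t \<in> I. s + 1 / real (Suc n) < \<bar>f t\<bar>})"
  proof -
    have "\<exists>n. s + 1 / real (Suc n) < y" if "s < y" for y
      using nat_approx_posE[of "y - s"] that by (metis add.commute diff_gt_0_iff_gt less_diff_eq)
    moreover have "s < y" if "s + 1 / real (Suc n) < y" for y n
      using that by (smt (verit) of_nat_0_less_iff zero_less_Suc zero_less_divide_1_iff)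
    ultimately show ?thesis by blast
  qed
  then have "distrib_fun I f s = emeasure \<mu> (\<Union>n. {t \<in> I. s + 1 / real (Suc n) < \<bar>f t\<bar>})"
    by (simp add: distrib_mu)
  also have "\<dots> = (SUP n. emeasure \<mu> {t \<in> I. s + 1 / real (Suc n) < \<bar>f t\<bar>})"
  proof (rule SUP_emeasure_incseq[symmetric])
    show "incseq (\<lambda>n. {t \<in> I. s + 1 / real (Suc n) < \<bar>f t\<bar>})"
    proof (rule incseq_SucI, safe)
      fix n x assume "s + 1 / real (Suc n) < \<bar>f x\<bar>"
      moreover have "1 / real (Suc (Suc n)) \<le> 1 / real (Suc n)" by (simp add: field_simps)
      ultimately show "s + 1 / real (Suc (Suc n)) < \<bar>f x\<bar>" by linarith
    qed
  qed (use L0_sets[OF f] in auto)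
  also have "\<dots> \<le> ennreal t"
    using d by (intro SUP_least) (auto simp: distrib_mu)
  finally show "distrib_fun I f s \<le> ennreal t" .
qed (use s rearr_le in auto)

lemma rearr_gt_iff:
  assumes "f \<in> L0 I" "0 \<le> s"
  shows "ennreal s < rearr I f t \<longleftrightarrow> ennreal t < distrib_fun I f s"
  using rearr_le_iff[OF assms, of t] by (simp add: not_le[symmetric])

lemma rearr_measurable: 
  assumes "f \<in> L0 I" shows "rearr I f \<in> borel_measurable borel"
proof (rule borel_measurableI_greater)
  fix y :: ennreal
  show "{x \<in> space borel. y < rearr I f x} \<in> sets borel"
  proof (cases y)
    case (real r)
    then have "{x \<in> space borel. y < rearr I f x} = {x \<in> space borel. ennreal x < distrib_fun I f r}"
      using rearr_gt_iff[OF assms] by auto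
    also have "\<dots> \<in> sets borel" by measurable
    finally show ?thesis .
  qed simp
qed

lemma rearr_measurable_mu [measurable]:
  "f \<in> L0 I \<Longrightarrow> rearr I f \<in> borel_measurable \<mu>"
  by (rule borel_mu[OF rearr_measurable])

lemma rearr_mono:
  assumes "g \<in> L0 I" "\<And>t. t \<in> I \<Longrightarrow> \<bar>f t\<bar> \<le> \<bar>g t\<bar>" shows "rearr I f t \<le> rearr I g t"
  unfolding rearr_def using distrib_mono[OF assms]
  by (intro INF_superset_mono) (auto intro: order_trans)

lemma rearr_antimono: "s \<le> t \<Longrightarrow> rearr I f t \<le> rearr I f s"
  unfolding rearr_def by (intro INF_superset_mono) (auto intro: order_trans ennreal_leI)

lemma distrib_cong_AE:
  assumes "f \<in> L0 I" "g \<in> L0 I" "AE x in \<mu>. f x = g x"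
  shows "distrib_fun I f s = distrib_fun I g s"
  unfolding distrib_mu using assms(3) by (intro emeasure_eq_AE L0_sets assms) auto

lemma rearr_cong_AE:
  assumes "f \<in> L0 I" "g \<in> L0 I" "AE x in \<mu>. f x = g x"
  shows "rearr I f = rearr I g"
  by (simp add: rearr_def[abs_def] distrib_cong_AE[OF assms])

lemma rearr_scale:
  assumes c: "0 < c" shows "rearr I (\<lambda>x. c * f x) t = ennreal c * rearr I f t"
proof -
  \<comment> \<open>One inequality for all factors suffices; the reverse one is this inequality for
    the factor \<open>1/c\<close>.\<close>
  have le: "ennreal c * rearr I g t \<le> rearr I (\<lambda>x. c * g x) t" if c: "0 < c" for c g
  proof -
    have "ennreal c * rearr I g t \<le> ennreal s"
      if s: "0 \<le> s" "distrib_fun I (\<lambda>x. c * g x) s \<le> ennreal t" for s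
    proof -
      have "{t \<in> I. s / c < \<bar>g t\<bar>} = {t \<in> I. s < \<bar>c * g t\<bar>}"
        using c by (auto simp: abs_mult field_simps)
      then have "rearr I g t \<le> ennreal (s / c)"
        using s c by (intro rearr_le) (auto simp: distrib_fun_def)
      then have "ennreal c * rearr I g t \<le> ennreal c * ennreal (s / c)" by (rule mult_left_mono) simp
      also have "\<dots> = ennreal s" using c s by (simp add: ennreal_mult[symmetric])
      finally show ?thesis .
    qed
    then show ?thesis unfolding rearr_def[of I "\<lambda>x. c * g x"] by (intro INF_greatest) auto
  qed
  have "rearr I (\<lambda>x. c * f x) t = ennreal c * (ennreal (1/c) * rearr I (\<lambda>x. c * f x) t)"
    using c by (simp add: mult.assoc[symmetric] ennreal_mult[symmetric])
  also have "\<dots> \<le> ennreal c * rearr I (\<lambda>x. (1/c) * (c * f x)) t"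
    using c by (intro mult_left_mono le) auto
  also have "(\<lambda>x. (1/c) * (c * f x)) = f" using c by auto
  finally show ?thesis using le[OF c, of f] by (rule antisym)
qed

text \<open>\<open>s < |f x|\<close> is an open condition, so it eventually holds for
  \<open>g n x\<close> as well. Fatou's lemma for the indicators transfers this to distribution
  functions, and \<open>rearr_gt_iff\<close> transfers it back to rearrangements.\<close>

lemma rearr_liminf:
  assumes f: "f \<in> L0 I" and g: "\<And>n. g n \<in> L0 I" and lim: "AE x in \<mu>. (\<lambda>n. g n x) \<longlonglongrightarrow> f x"
  shows "rearr I f t \<le> liminf (\<lambda>n. rearr I (g n) t)"
proof (rule dense_le)
  fix y assume y: "y < rearr I f t"
  then obtain s where s: "0 \<le> s" "y = ennreal s" by (cases y) auto
  have "ennreal t < distrib_fun I f s" using y s rearr_gt_iff[OF f] by auto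
  also have "distrib_fun I f s = (\<integral>\<^sup>+ x. indicator {x \<in> I. s < \<bar>f x\<bar>} x \<partial>\<mu>)"
    by (simp add: distrib_mu L0_sets[OF f])
  also have "\<dots> \<le> (\<integral>\<^sup>+ x. liminf (\<lambda>n. indicator {x \<in> I. s < \<bar>g n x\<bar>} x) \<partial>\<mu>)"
  proof (rule nn_integral_mono_AE, use lim in eventually_elim)
    case (elim x)
    show ?case
    proof (cases "x \<in> {x \<in> I. s < \<bar>f x\<bar>}")
      case True
      have "(\<lambda>n. \<bar>g n x\<bar>) \<longlonglongrightarrow> \<bar>f x\<bar>" using elim by (rule tendsto_rabs)
      then have "\<forall>\<^sub>F n in sequentially. s < \<bar>g n x\<bar>" using True by (auto dest: order_tendstoD)
      then have "\<forall>\<^sub>F n in sequentially. 1 \<le> (indicator {x \<in> I. s < \<bar>g n x\<bar>} x :: ennreal)"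
        by eventually_elim (use True in auto)
      then show ?thesis using True by (auto intro!: Liminf_bounded)
    qed simp
  qed
  also have "\<dots> \<le> liminf (\<lambda>n. \<integral>\<^sup>+ x. indicator {x \<in> I. s < \<bar>g n x\<bar>} x \<partial>\<mu>)"
    by (rule nn_integral_liminf) (use L0_sets[OF g] in auto)
  also have "\<dots> = liminf (\<lambda>n. distrib_fun I (g n) s)"
    using L0_sets[OF g] by (simp add: distrib_mu)
  finally have "\<forall>\<^sub>F n in sequentially. ennreal t < distrib_fun I (g n) s"
    by (rule less_LiminfD)
  then have "\<forall>\<^sub>F n in sequentially. y \<le> rearr I (g n) t"
    by eventually_elim (use rearr_gt_iff[OF g] s in \<open>auto intro: less_imp_le\<close>)
  then show "y \<le> liminf (\<lambda>n. rearr I (g n) t)" by (rule Liminf_bounded)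
qed

text \<open>Tonelli applied to \<open>u x\<close> as the length of
  \<open>{s \<ge> 0. s < u x}\<close>, which also covers \<open>u x = \<infinity>\<close>. With
  \<open>g\<close> as a density it reduces integral inequalities in \<open>u\<close> to superlevel
  sets of \<open>u\<close>.\<close>

lemma layer_cake:
  assumes "sigma_finite_measure M" and [measurable]: "u \<in> borel_measurable M" "g \<in> borel_measurable M"
  shows "(\<integral>\<^sup>+ x. g x * u x \<partial>M) =
    (\<integral>\<^sup>+ s. indicator {0..} s * (\<integral>\<^sup>+ x. g x * indicator {x. ennreal s < u x} x \<partial>M) \<partial>lborel)"
proof -
  interpret M: sigma_finite_measure M by fact
  interpret pair_sigma_finite M lborel ..
  have *: "u x = (\<integral>\<^sup>+ s. indicator {0..} s * indicator {x. ennreal s < u x} x \<partial>lborel)" for x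
  proof -
    have "(\<integral>\<^sup>+ s. indicator {0..} s * indicator {x. ennreal s < u x} x \<partial>lborel)
       = (\<integral>\<^sup>+ s. indicator {s. 0 \<le> s \<and> ennreal s < u x} s \<partial>lborel)"
      by (intro nn_integral_cong) (auto simp: indicator_def)
    also have "\<dots> = emeasure lborel {s. 0 \<le> s \<and> ennreal s < u x}" by simp
    also have "\<dots> = u x"
    proof (cases "u x")
      case (real r)
      then have "{s. 0 \<le> s \<and> ennreal s < u x} = {0..<r}" by (auto simp: ennreal_less_iff)
      then show ?thesis using real by simp
    next
      case top
      then have "{s. 0 \<le> s \<and> ennreal s < u x} = {0..}" by (auto simp: less_top)
      moreover have "emeasure lborel {0::real..} = \<infinity>"
      proof (rule ccontr)
        assume "emeasure lborel {0::real..} \<noteq> \<infinity>"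
        then obtain r where r: "0 \<le> r" "emeasure lborel {0::real..} = ennreal r"
          by (cases "emeasure lborel {0::real..}") auto
        have "ennreal (r + 1) = emeasure lborel {0..r+1}" using r by simp
        also have "\<dots> \<le> ennreal r" unfolding r(2)[symmetric] by (rule emeasure_mono) auto
        finally show False using r by simp
      qed
      ultimately show ?thesis using top by simp
    qed
    finally show ?thesis ..
  qed
  have "(\<integral>\<^sup>+ x. g x * u x \<partial>M) = (\<integral>\<^sup>+ x. (\<integral>\<^sup>+ s. g x * (indicator {0..} s * indicator {x. ennreal s < u x} x) \<partial>lborel) \<partial>M)"
    by (subst *, subst nn_integral_cmult) auto
  also have "\<dots> = (\<integral>\<^sup>+ s. (\<integral>\<^sup>+ x. g x * (indicator {0..} s * indicator {x. ennreal s < u x} x) \<partial>M) \<partial>lborel)"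
    by (rule Fubini'[symmetric]) (simp add: indicator_def[of "{x. ennreal _ < _ x}"], measurable)
  also have "\<dots> = (\<integral>\<^sup>+ s. (\<integral>\<^sup>+ x. indicator {0..} s * (g x * indicator {x. ennreal s < u x} x) \<partial>M) \<partial>lborel)"
    by (simp add: mult_ac)
  also have "\<dots> = (\<integral>\<^sup>+ s. indicator {0..} s * (\<integral>\<^sup>+ x. g x * indicator {x. ennreal s < u x} x \<partial>M) \<partial>lborel)"
    by (intro nn_integral_cong nn_integral_cmult) measurable
  finally show ?thesis .
qed

text \<open>Writing an initial segment as \<open>ennreal x < m\<close> allows
  \<open>m = \<infinity>\<close>, so sets of finite and of infinite measure are compared with
  initial segments in the same way.\<close>

lemma emeasure_initial:
  assumes "m \<le> emeasure \<mu> I"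
  shows "emeasure \<mu> {x \<in> I. ennreal x < m} = m"
proof (cases m)
  case (real r)
  then have eq: "{x \<in> I. ennreal x < m} = I \<inter> {0<..<r}"
    by (auto simp: ennreal_less_iff dest: I_pos)
  from I_eq show ?thesis
  proof
    assume "I = {0<..}"
    then have "I \<inter> {0<..<r} = {0<..<r}" by auto
    then show ?thesis unfolding eq using real by (subst emeasure_mu) auto
  next
    assume "\<exists>r>0. a = ereal r \<and> I = {0<..<r}"
    then obtain b where b: "0 < b" "I = {0<..<b}" by auto
    have "emeasure \<mu> I = ennreal b" using b by (subst emeasure_mu) auto
    then have "r \<le> b" using assms real b by simp
    then have "I \<inter> {0<..<r} = {0<..<r}" using b by auto
    then show ?thesis unfolding eq using real by (subst emeasure_mu) auto
  qed
next
  case top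
  then have "{x \<in> I. ennreal x < m} = I" by (auto simp: less_top)
  then show ?thesis using assms top by (simp add: top_unique)
qed

lemma I_exhaust:
  obtains t where "\<And>n. t n \<in> I" "incseq t" "\<And>x. x \<in> I \<Longrightarrow> \<exists>n. x < t n"
  using I_eq
proof
  assume I: "I = {0<..}"
  show thesis
  proof (rule that[of "\<lambda>n. real (Suc n)"])
    show "\<exists>n. x < real (Suc n)" for x using reals_Archimedean2[of x] by (metis less_Suc_eq of_nat_less_iff order_less_trans)
  qed (auto simp: I incseq_def)
next
  assume "\<exists>r>0. a = ereal r \<and> I = {0<..<r}"
  then obtain r where r: "0 < r" "I = {0<..<r}" by auto
  show thesis
  proof (rule that[of "\<lambda>n. r - r / real (Suc (Suc n))"])
    show "r - r / real (Suc (Suc n)) \<in> I" for n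
    proof -
      have "r / real (Suc (Suc n)) < r / 1" using r by (intro divide_strict_left_mono) auto
      then show ?thesis using r by auto
    qed
    show "incseq (\<lambda>n. r - r / real (Suc (Suc n)))"
      using r by (intro incseq_SucI) (auto intro!: divide_left_mono)
    fix x assume "x \<in> I"
    then have "0 < (r - x) / r" using r by auto
    then obtain n where n: "1 / real (Suc n) < (r - x) / r" using nat_approx_posE by blast
    have "r / real (Suc (Suc n)) \<le> r / real (Suc n)" using r by (intro divide_left_mono) auto
    also have "\<dots> = r * (1 / real (Suc n))" by simp
    also have "\<dots> < r * ((r - x) / r)" using n r by (intro mult_strict_left_mono) auto
    also have "\<dots> = r - x" using r by simp
    finally show "\<exists>n. x < r - r / real (Suc (Suc n))" by (intro exI[of _ n]) simp
  qed
qed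

text \<open>The hypothesis covers end points inside \<open>I\<close>; the full interval, needed when
  \<open>m\<close> exceeds every point of \<open>I\<close>, follows by monotone convergence along an
  exhaustion.\<close>

lemma initial_integral_le:
  assumes [measurable]: "p \<in> borel_measurable \<mu>" "q \<in> borel_measurable \<mu>"
    and le: "\<And>t. t \<in> I \<Longrightarrow> (\<integral>\<^sup>+ s\<in>{0<..<t}. p s \<partial>\<mu>) \<le> (\<integral>\<^sup>+ s\<in>{0<..<t}. q s \<partial>\<mu>)"
  shows "(\<integral>\<^sup>+ x. p x * indicator {x. ennreal x < m} x \<partial>\<mu>) \<le> (\<integral>\<^sup>+ x. q x * indicator {x. ennreal x < m} x \<partial>\<mu>)"
proof -
  have all: "(\<integral>\<^sup>+ x. p x \<partial>\<mu>) \<le> (\<integral>\<^sup>+ x. q x \<partial>\<mu>)"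
  proof -
    obtain t where t: "\<And>n. t n \<in> I" "incseq t" "\<And>x. x \<in> I \<Longrightarrow> \<exists>n. x < t n" using I_exhaust by blast
    have [measurable]: "{0<..<s} \<inter> I \<in> sets \<mu>" for s by (auto simp: sets_mu intro!: sets.Int)
    have "(\<integral>\<^sup>+ x. p x \<partial>\<mu>) = (\<integral>\<^sup>+ x. (SUP n. p x * indicator ({0<..<t n} \<inter> I) x) \<partial>\<mu>)"
    proof (rule nn_integral_cong)
      fix x assume "x \<in> space \<mu>"
      then have x: "x \<in> I" by simp
      then obtain n where "x < t n" using t by blast
      then have "p x \<le> (SUP n. p x * indicator ({0<..<t n} \<inter> I) x)"
        using x I_pos[OF x] by (intro SUP_upper2[of n]) auto
      moreover have "(SUP n. p x * indicator ({0<..<t n} \<inter> I) x) \<le> p x"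
        by (intro SUP_least) (auto simp: indicator_def)
      ultimately show "p x = (SUP n. p x * indicator ({0<..<t n} \<inter> I) x)" by (rule antisym)
    qed
    also have "\<dots> = (SUP n. \<integral>\<^sup>+ x. p x * indicator ({0<..<t n} \<inter> I) x \<partial>\<mu>)"
    proof (rule nn_integral_monotone_convergence_SUP)
      show "incseq (\<lambda>n x. p x * indicator ({0<..<t n} \<inter> I) x)"
        using t(2) by (force simp: incseq_def le_fun_def indicator_def)
    qed measurable
    also have "\<dots> \<le> (\<integral>\<^sup>+ x. q x \<partial>\<mu>)"
    proof (rule SUP_least)
      fix n
      have "(\<integral>\<^sup>+ x. p x * indicator ({0<..<t n} \<inter> I) x \<partial>\<mu>) = (\<integral>\<^sup>+ s\<in>{0<..<t n}. p s \<partial>\<mu>)"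
        by (intro nn_integral_cong) (auto simp: indicator_def)
      also have "\<dots> \<le> (\<integral>\<^sup>+ s\<in>{0<..<t n}. q s \<partial>\<mu>)" by (rule le[OF t(1)])
      also have "\<dots> \<le> (\<integral>\<^sup>+ x. q x \<partial>\<mu>)"
        by (intro nn_integral_mono) (auto simp: indicator_def intro!: ennreal_leI)
      finally show "(\<integral>\<^sup>+ x. p x * indicator ({0<..<t n} \<inter> I) x \<partial>\<mu>) \<le> (\<integral>\<^sup>+ x. q x \<partial>\<mu>)" .
    qed
    finally show ?thesis .
  qed
  show ?thesis
  proof (cases "\<forall>x\<in>I. ennreal x < m")
    case True
    then have "(\<integral>\<^sup>+ x. p x * indicator {x. ennreal x < m} x \<partial>\<mu>) = (\<integral>\<^sup>+ x. p x \<partial>\<mu>)"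
      "(\<integral>\<^sup>+ x. q x * indicator {x. ennreal x < m} x \<partial>\<mu>) = (\<integral>\<^sup>+ x. q x \<partial>\<mu>)"
      by (auto intro!: nn_integral_cong)
    with all show ?thesis by simp
  next
    case False
    then obtain x where x: "x \<in> I" "m \<le> ennreal x" by (auto simp: not_less)
    then obtain t where t: "0 \<le> t" "m = ennreal t" by (cases m) (auto simp: top_unique)
    show ?thesis
    proof (cases "t = 0")
      case True
      then have "(\<integral>\<^sup>+ x. p x * indicator {x. ennreal x < m} x \<partial>\<mu>) = 0" using t by simp
      then show ?thesis by simp
    next
      case False
      then have "t \<in> I" using x t I_pos[OF x(1)] by (intro I_down[OF x(1)]) auto
      have *: "(\<integral>\<^sup>+ x. f x * indicator {x. ennreal x < m} x \<partial>\<mu>) = (\<integral>\<^sup>+ s\<in>{0<..<t}. f s \<partial>\<mu>)" for f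
        using t by (intro nn_integral_cong) (auto simp: indicator_def ennreal_less_iff dest: I_pos)
      show ?thesis unfolding * by (rule le) fact
    qed
  qed
qed

text \<open>At level \<open>s\<close>, the part of \<open>A\<close> where \<open>v > s\<close> has
  measure at most the smaller of \<open>|A|\<close> and the distribution of \<open>v\<close> at
  \<open>s\<close>. That smaller number is the length of the initial segment where both
  \<open>x < |A|\<close> and the rearrangement exceeds \<open>s\<close>.\<close>

lemma integral_le_initial_rearr:
  assumes v: "v \<in> L0 I" "\<And>t. t \<in> I \<Longrightarrow> 0 \<le> v t" and A: "A \<in> sets \<mu>"
  shows "(\<integral>\<^sup>+ x\<in>A. ennreal (v x) \<partial>\<mu>) \<le> (\<integral>\<^sup>+ x. rearr I v x * indicator {x. ennreal x < emeasure \<mu> A} x \<partial>\<mu>)"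
proof -
  have [measurable]: "v \<in> borel_measurable \<mu>" "rearr I v \<in> borel_measurable \<mu>"
    using v(1) rearr_measurable_mu by (auto simp: L0_def)
  note A [measurable]
  have [measurable]: "(\<lambda>x. indicator {x. ennreal x < m} x :: ennreal) \<in> borel_measurable \<mu>" for m
    by (simp add: indicator_def[abs_def]) measurable
  have "(\<integral>\<^sup>+ x\<in>A. ennreal (v x) \<partial>\<mu>) = (\<integral>\<^sup>+ x. indicator A x * ennreal (v x) \<partial>\<mu>)"
    by (simp add: mult.commute)
  also have "\<dots> = (\<integral>\<^sup>+ s. indicator {0..} s * (\<integral>\<^sup>+ x. indicator A x * indicator {x. ennreal s < ennreal (v x)} x \<partial>\<mu>) \<partial>lborel)"
    by (rule layer_cake[OF sigma_finite_mu]) measurable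
  also have "\<dots> \<le> (\<integral>\<^sup>+ s. indicator {0..} s * (\<integral>\<^sup>+ x. indicator {x. ennreal x < emeasure \<mu> A} x * indicator {x. ennreal s < rearr I v x} x \<partial>\<mu>) \<partial>lborel)"
  proof (rule nn_integral_mono)
    fix s :: real
    show "indicator {0..} s * (\<integral>\<^sup>+ x. indicator A x * indicator {x. ennreal s < ennreal (v x)} x \<partial>\<mu>)
      \<le> indicator {0..} s * (\<integral>\<^sup>+ x. indicator {x. ennreal x < emeasure \<mu> A} x * indicator {x. ennreal s < rearr I v x} x \<partial>\<mu>)"
    proof (cases "0 \<le> s")
      case s: True
      define m where "m = min (emeasure \<mu> A) (distrib_fun I v s)"
      have "(\<integral>\<^sup>+ x. indicator A x * indicator {x. ennreal s < ennreal (v x)} x \<partial>\<mu>)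
          = (\<integral>\<^sup>+ x. indicator (A \<inter> {t \<in> I. s < \<bar>v t\<bar>}) x \<partial>\<mu>)"
        using s v(2) by (intro nn_integral_cong) (auto simp: indicator_def ennreal_less_iff)
      also have "\<dots> = emeasure \<mu> (A \<inter> {t \<in> I. s < \<bar>v t\<bar>})"
        using A L0_sets[OF v(1)] by simp
      also have "\<dots> \<le> m"
        using A L0_sets[OF v(1)] by (auto simp: m_def distrib_mu intro!: emeasure_mono)
      also have "m = emeasure \<mu> {x \<in> I. ennreal x < m}"
      proof (rule emeasure_initial[symmetric])
        have "m \<le> emeasure \<mu> A" by (simp add: m_def)
        also have "\<dots> \<le> emeasure \<mu> I" using A by (intro emeasure_mono) (auto simp: sets_mu)
        finally show "m \<le> emeasure \<mu> I" .
      qed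
      also have "\<dots> = (\<integral>\<^sup>+ x. indicator {x \<in> I. ennreal x < m} x \<partial>\<mu>)"
      proof -
        have "{x \<in> space \<mu>. ennreal x < m} \<in> sets \<mu>" by measurable
        then show ?thesis by simp
      qed
      also have "\<dots> = (\<integral>\<^sup>+ x. indicator {x. ennreal x < emeasure \<mu> A} x * indicator {x. ennreal s < rearr I v x} x \<partial>\<mu>)"
        using rearr_gt_iff[OF v(1) s] by (intro nn_integral_cong) (auto simp: indicator_def m_def)
      finally show ?thesis using s by simp
    qed simp
  qed
  also have "\<dots> = (\<integral>\<^sup>+ x. indicator {x. ennreal x < emeasure \<mu> A} x * rearr I v x \<partial>\<mu>)"
    by (rule layer_cake[OF sigma_finite_mu, symmetric]) measurable
  finally show ?thesis by (simp add: mult.commute)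
qed

end

section \<open>The weight, submajorization by it, and its primitive \<open>W\<close>\<close>

locale weight = ivl +
  fixes w :: "real \<Rightarrow> real"
  assumes weight: "weight_function I w" and w_pos: "\<And>t. t \<in> I \<Longrightarrow> 0 < w t"
    and w_int: "\<And>t. t \<in> I \<Longrightarrow> (\<integral>\<^sup>+ s. ennreal (w s) \<partial>lebesgue_on {0<..<t}) < \<infinity>"
begin

lemma w_L0: "w \<in> L0 I"
  using weight by (simp add: weight_function_def)

lemma w_measurable [measurable]: "w \<in> borel_measurable \<mu>"
  using w_L0 by (simp add: L0_def)

lemma w_antimono: "s \<in> I \<Longrightarrow> t \<in> I \<Longrightarrow> s \<le> t \<Longrightarrow> w t \<le> w s"
  using weight by (auto simp: weight_function_def monotone_on_def)

lemma rearr_w_le: "t \<in> I \<Longrightarrow> rearr I w t \<le> ennreal (w t)"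
proof (rule rearr_le)
  assume t: "t \<in> I"
  have "{x \<in> I. w t < \<bar>w x\<bar>} \<subseteq> {0<..<t}"
    using w_antimono[OF t] w_pos I_pos by (force simp: not_le[symmetric])
  then have "distrib_fun I w (w t) \<le> emeasure lebesgue {0<..<t}"
    unfolding distrib_fun_def by (intro emeasure_mono) auto
  then show "distrib_fun I w (w t) \<le> ennreal t" using I_pos[OF t] by simp
  show "0 \<le> w t" using w_pos[OF t] by simp
qed

text \<open>The weight and its rearrangement may differ at the jumps of \<open>w\<close>. This
  integrated inequality and the pointwise \<open>rearr_w_le\<close> together allow either to stand
  for the other in submajorization.\<close>

lemma initial_w_le_rearr:
  assumes "t \<in> I"
  shows "(\<integral>\<^sup>+ s\<in>{0<..<t}. ennreal (w s) \<partial>\<mu>) \<le> (\<integral>\<^sup>+ s\<in>{0<..<t}. rearr I w s \<partial>\<mu>)"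
proof -
  have sub: "{0<..<t} \<subseteq> I" by (rule ioo_sub[OF I_le[OF assms]])
  have "(\<integral>\<^sup>+ s\<in>{0<..<t}. ennreal (w s) \<partial>\<mu>) \<le> (\<integral>\<^sup>+ x. rearr I w x * indicator {x. ennreal x < emeasure \<mu> {0<..<t}} x \<partial>\<mu>)"
    using sub w_pos by (intro integral_le_initial_rearr w_L0) (auto simp: sets_mu less_imp_le)
  also have "emeasure \<mu> {0<..<t} = ennreal t"
    using sub I_pos[OF assms] by (simp add: emeasure_mu)
  also have "(\<integral>\<^sup>+ x. rearr I w x * indicator {x. ennreal x < ennreal t} x \<partial>\<mu>) = (\<integral>\<^sup>+ s\<in>{0<..<t}. rearr I w s \<partial>\<mu>)"
    by (intro nn_integral_cong) (auto simp: indicator_def ennreal_less_iff dest: I_pos)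
  finally show ?thesis .
qed

lemma submajorizedI:
  assumes "\<And>t. t \<in> I \<Longrightarrow> (\<integral>\<^sup>+ s\<in>{0<..<t}. rearr I v s \<partial>\<mu>) \<le> (\<integral>\<^sup>+ s\<in>{0<..<t}. ennreal (w s) \<partial>\<mu>)"
  shows "submajorized I v w"
  unfolding submajorized_def
  using assms initial_w_le_rearr by (auto simp: nn_integral_ioo I_le intro: order_trans)

lemma submajorizedD:
  assumes "submajorized I v w" "t \<in> I"
  shows "(\<integral>\<^sup>+ s\<in>{0<..<t}. rearr I v s \<partial>\<mu>) \<le> (\<integral>\<^sup>+ s\<in>{0<..<t}. ennreal (w s) \<partial>\<mu>)"
proof -
  have "(\<integral>\<^sup>+ s\<in>{0<..<t}. rearr I v s \<partial>\<mu>) \<le> (\<integral>\<^sup>+ s\<in>{0<..<t}. rearr I w s \<partial>\<mu>)"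
    using assms by (auto simp: submajorized_def nn_integral_ioo I_le)
  also have "\<dots> \<le> (\<integral>\<^sup>+ s\<in>{0<..<t}. ennreal (w s) \<partial>\<mu>)"
    using rearr_w_le by (intro nn_integral_mono) (auto simp: indicator_def intro!: ennreal_leI)
  finally show ?thesis .
qed

lemma submajorized_integral_le:
  assumes v: "v \<in> L0 I" "\<And>t. t \<in> I \<Longrightarrow> 0 \<le> v t" "submajorized I v w" and A: "A \<in> sets \<mu>"
  shows "(\<integral>\<^sup>+ x\<in>A. ennreal (v x) \<partial>\<mu>) \<le> (\<integral>\<^sup>+ x. ennreal (w x) * indicator {x. ennreal x < emeasure \<mu> A} x \<partial>\<mu>)"
proof -
  have [measurable]: "rearr I v \<in> borel_measurable \<mu>" using v(1) by (rule rearr_measurable_mu)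
  have "(\<integral>\<^sup>+ x\<in>A. ennreal (v x) \<partial>\<mu>) \<le> (\<integral>\<^sup>+ x. rearr I v x * indicator {x. ennreal x < emeasure \<mu> A} x \<partial>\<mu>)"
    by (rule integral_le_initial_rearr[OF v(1,2) A])
  also have "\<dots> \<le> (\<integral>\<^sup>+ x. ennreal (w x) * indicator {x. ennreal x < emeasure \<mu> A} x \<partial>\<mu>)"
    by (rule initial_integral_le) (use submajorizedD[OF v(3)] in auto)
  finally show ?thesis .
qed

text \<open>Slicing by the levels of \<open>u\<close> reduces the claim to indicators of superlevel
  sets of \<open>u\<close>, where it is \<open>submajorized_integral_le\<close>.\<close>

lemma hardy_littlewood:
  assumes v: "v \<in> L0 I" "\<And>t. t \<in> I \<Longrightarrow> 0 \<le> v t" "submajorized I v w"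
    and u: "u \<in> L0 I" "\<And>t. t \<in> I \<Longrightarrow> 0 \<le> u t"
  shows "(\<integral>\<^sup>+ x. ennreal (v x) * ennreal (u x) \<partial>\<mu>) \<le> (\<integral>\<^sup>+ x. ennreal (w x) * rearr I u x \<partial>\<mu>)"
proof -
  have [measurable]: "v \<in> borel_measurable \<mu>" "u \<in> borel_measurable \<mu>" "rearr I u \<in> borel_measurable \<mu>"
    using v(1) u(1) rearr_measurable_mu by (auto simp: L0_def)
  have "(\<integral>\<^sup>+ x. ennreal (v x) * ennreal (u x) \<partial>\<mu>) =
    (\<integral>\<^sup>+ s. indicator {0..} s * (\<integral>\<^sup>+ x. ennreal (v x) * indicator {x. ennreal s < ennreal (u x)} x \<partial>\<mu>) \<partial>lborel)"
    by (rule layer_cake[OF sigma_finite_mu]) measurable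
  also have "\<dots> \<le> (\<integral>\<^sup>+ s. indicator {0..} s * (\<integral>\<^sup>+ x. ennreal (w x) * indicator {x. ennreal s < rearr I u x} x \<partial>\<mu>) \<partial>lborel)"
  proof (rule nn_integral_mono)
    fix s :: real
    show "indicator {0..} s * (\<integral>\<^sup>+ x. ennreal (v x) * indicator {x. ennreal s < ennreal (u x)} x \<partial>\<mu>)
      \<le> indicator {0..} s * (\<integral>\<^sup>+ x. ennreal (w x) * indicator {x. ennreal s < rearr I u x} x \<partial>\<mu>)"
    proof (cases "0 \<le> s")
      case s: True
      have "(\<integral>\<^sup>+ x. ennreal (v x) * indicator {x. ennreal s < ennreal (u x)} x \<partial>\<mu>)
          = (\<integral>\<^sup>+ x\<in>{t \<in> I. s < \<bar>u t\<bar>}. ennreal (v x) \<partial>\<mu>)"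
        using s u(2) by (intro nn_integral_cong) (auto simp: indicator_def ennreal_less_iff)
      also have "\<dots> \<le> (\<integral>\<^sup>+ x. ennreal (w x) * indicator {x. ennreal x < distrib_fun I u s} x \<partial>\<mu>)"
        unfolding distrib_mu by (rule submajorized_integral_le[OF v L0_sets[OF u(1)]])
      also have "\<dots> = (\<integral>\<^sup>+ x. ennreal (w x) * indicator {x. ennreal s < rearr I u x} x \<partial>\<mu>)"
        by (simp add: rearr_gt_iff[OF u(1) s])
      finally show ?thesis using s by simp
    qed simp
  qed
  also have "\<dots> = (\<integral>\<^sup>+ x. ennreal (w x) * rearr I u x \<partial>\<mu>)"
    by (rule layer_cake[OF sigma_finite_mu, symmetric]) measurable
  finally show ?thesis .
qed

definition "W t = enn2real (\<integral>\<^sup>+ s\<in>{0<..<t}. ennreal (w s) \<partial>\<mu>)"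

lemma W_0 [simp]: "W 0 = 0"
  by (simp add: W_def)

lemma ico_measurable [measurable]: "(\<lambda>x. indicator {s..<t::real} x :: ennreal) \<in> borel_measurable \<mu>"
  "(\<lambda>x. indicator {s<..<t::real} x :: ennreal) \<in> borel_measurable \<mu>"
  by (auto simp: borel_measurable_indicator_iff sets_mu intro!: sets.Int)

lemma nn_integral_split:
  assumes "0 \<le> s" "s \<le> t" and [measurable]: "p \<in> borel_measurable \<mu>"
  shows "(\<integral>\<^sup>+ x\<in>{0<..<t}. p x \<partial>\<mu>) = (\<integral>\<^sup>+ x\<in>{0<..<s}. p x \<partial>\<mu>) + (\<integral>\<^sup>+ x\<in>{s..<t}. p x \<partial>\<mu>)"
proof -
  have "(\<integral>\<^sup>+ x\<in>{0<..<t}. p x \<partial>\<mu>) = (\<integral>\<^sup>+ x. p x * indicator {0<..<s} x + p x * indicator {s..<t} x \<partial>\<mu>)"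
    using assms(1,2) by (intro nn_integral_cong) (auto simp: indicator_def dest: I_pos)
  also have "\<dots> = (\<integral>\<^sup>+ x\<in>{0<..<s}. p x \<partial>\<mu>) + (\<integral>\<^sup>+ x\<in>{s..<t}. p x \<partial>\<mu>)"
    by (rule nn_integral_add) measurable
  finally show ?thesis .
qed

lemma emeasure_ico:
  assumes "0 \<le> s" "s \<le> t" "ereal t \<le> a"
  shows "(\<integral>\<^sup>+ x\<in>{s..<t}. c \<partial>\<mu>) = c * ennreal (t - s)"
proof -
  have "(\<integral>\<^sup>+ x\<in>{s..<t}. c \<partial>\<mu>) = (\<integral>\<^sup>+ x. c * indicator ({s..<t} \<inter> I) x \<partial>\<mu>)"
    by (intro nn_integral_cong) (auto simp: indicator_def)
  also have "\<dots> = c * emeasure \<mu> ({s..<t} \<inter> I)"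
    by (rule nn_integral_cmult_indicator) (auto simp: sets_mu intro!: sets.Int)
  also have "emeasure \<mu> ({s..<t} \<inter> I) = emeasure lebesgue ({s..<t} \<inter> I)"
    by (rule emeasure_mu) auto
  also have "\<dots> = emeasure lebesgue {s..<t}"
  proof (rule emeasure_eq_AE)
    \<comment> \<open>The two sets differ at most in the point 0, which is not in
      \<open>I\<close>.\<close>
    have "AE x in lebesgue. x \<noteq> (0::real)" by (rule AE_completion) (rule AE_lborel_singleton)
    then show "AE x in lebesgue. (x \<in> {s..<t} \<inter> I) = (x \<in> {s..<t})"
      by eventually_elim (use assms I_lessI[OF _ _ assms(3)] in force)
  qed auto
  finally show ?thesis using assms by simp
qed

lemma W_initial:
  assumes "ereal t \<le> a"
  shows "(\<integral>\<^sup>+ s\<in>{0<..<t}. ennreal (w s) \<partial>\<mu>) = ennreal (W t)"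
proof -
  have fin: "(\<integral>\<^sup>+ s\<in>{0<..<x}. ennreal (w s) \<partial>\<mu>) < \<infinity>" if "x \<in> I" for x
    using w_int[OF that] nn_integral_ioo[OF I_le[OF that], of "\<lambda>s. ennreal (w s)"] by simp
  have "(\<integral>\<^sup>+ s\<in>{0<..<t}. ennreal (w s) \<partial>\<mu>) < \<infinity>"
  proof (cases "0 < t")
    case True
    \<comment> \<open>Finiteness is assumed only for points of \<open>I\<close>, while
      \<open>t\<close> may be the right end point. Beyond the midpoint \<open>w\<close> is bounded
      by \<open>w x\<close>, so the remaining piece is finite.\<close>
    define x where "x = t / 2"
    have x: "x \<in> I" "0 < x" "x \<le> t" using True assms by (auto simp: x_def intro!: I_lessI[of _ t])
    have "(\<integral>\<^sup>+ s\<in>{0<..<t}. ennreal (w s) \<partial>\<mu>) =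
      (\<integral>\<^sup>+ s\<in>{0<..<x}. ennreal (w s) \<partial>\<mu>) + (\<integral>\<^sup>+ s\<in>{x..<t}. ennreal (w s) \<partial>\<mu>)"
      using x by (intro nn_integral_split) auto
    also have "(\<integral>\<^sup>+ s\<in>{x..<t}. ennreal (w s) \<partial>\<mu>) \<le> (\<integral>\<^sup>+ s\<in>{x..<t}. ennreal (w x) \<partial>\<mu>)"
      using w_antimono[OF x(1)] by (intro nn_integral_mono) (auto simp: indicator_def intro!: ennreal_leI)
    also have "\<dots> = ennreal (w x) * ennreal (t - x)" using x assms by (intro emeasure_ico) auto
    finally show ?thesis using fin[OF x(1)] by (auto simp: ennreal_mult_less_top order.strict_trans1)
  qed simp
  then show ?thesis by (simp add: W_def)
qed

lemma W_nonneg: "0 \<le> W t" by (simp add: W_def)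

lemma W_interval:
  assumes "0 \<le> s" "s \<le> t" "ereal t \<le> a"
  shows "W s \<le> W t" "(\<integral>\<^sup>+ x\<in>{s..<t}. ennreal (w x) \<partial>\<mu>) = ennreal (W t - W s)"
proof -
  have sa: "ereal s \<le> a" using assms by (metis ereal_less_eq(3) order_trans)
  have eq: "ennreal (W t) = ennreal (W s) + (\<integral>\<^sup>+ x\<in>{s..<t}. ennreal (w x) \<partial>\<mu>)"
    using nn_integral_split[OF assms(1,2), of "\<lambda>x. ennreal (w x)"] by (simp add: W_initial assms sa)
  then have "ennreal (W s) \<le> ennreal (W t)" by simp
  then show le: "W s \<le> W t" by (simp add: W_nonneg)
  have "(\<integral>\<^sup>+ x\<in>{s..<t}. ennreal (w x) \<partial>\<mu>) = ennreal (W t) - ennreal (W s)"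
    unfolding eq by (simp add: ennreal_add_diff_cancel_left)
  then show "(\<integral>\<^sup>+ x\<in>{s..<t}. ennreal (w x) \<partial>\<mu>) = ennreal (W t - W s)"
    by (simp add: ennreal_minus W_nonneg)
qed

lemma W_increment_le:
  assumes "x \<in> I" "x \<le> s" "s \<le> t" "ereal t \<le> a"
  shows "W t - W s \<le> w x * (t - s)"
proof -
  have s: "0 \<le> s" using I_pos[OF assms(1)] assms by simp
  have "ennreal (W t - W s) = (\<integral>\<^sup>+ y\<in>{s..<t}. ennreal (w y) \<partial>\<mu>)"
    using W_interval(2)[OF s assms(3,4)] ..
  also have "\<dots> \<le> (\<integral>\<^sup>+ y\<in>{s..<t}. ennreal (w x) \<partial>\<mu>)"
    using w_antimono[OF assms(1)] assms by (intro nn_integral_mono) (auto simp: indicator_def intro!: ennreal_leI)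
  also have "\<dots> = ennreal (w x * (t - s))"
    using emeasure_ico[OF s assms(3,4)] w_pos[OF assms(1)] assms by (simp add: ennreal_mult)
  finally show ?thesis using w_pos[OF assms(1)] assms by (simp add: ennreal_le_iff2)
      (smt (verit) mult_nonneg_nonneg)
qed

lemma W_increment_ge:
  assumes "x \<in> I" "0 \<le> s" "s \<le> t" "t \<le> x"
  shows "w x * (t - s) \<le> W t - W s"
proof -
  have ta: "ereal t \<le> a" using I_le[OF assms(1)] assms by (metis ereal_less_eq(3) order_trans)
  have "ennreal (w x * (t - s)) = (\<integral>\<^sup>+ y\<in>{s..<t}. ennreal (w x) \<partial>\<mu>)"
    using emeasure_ico[OF assms(2,3) ta] w_pos[OF assms(1)] assms by (simp add: ennreal_mult)
  also have "\<dots> \<le> (\<integral>\<^sup>+ y\<in>{s..<t}. ennreal (w y) \<partial>\<mu>)"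
    using w_antimono[OF _ assms(1)] assms by (intro nn_integral_mono) (auto simp: indicator_def intro!: ennreal_leI)
  also have "\<dots> = ennreal (W t - W s)"
    by (rule W_interval(2)[OF assms(2,3) ta])
  finally show ?thesis using W_interval(1)[OF assms(2,3) ta] by simp
qed

lemma W_strict:
  assumes "0 \<le> s" "s < t" "ereal t \<le> a" shows "W s < W t"
proof -
  define x where "x = (s + t) / 2"
  have x: "x \<in> I" "s < x" "x \<le> t" using assms by (auto simp: x_def intro!: I_lessI[of _ t])
  have "0 < w x * (x - s)" using w_pos[OF x(1)] x by simp
  also have "\<dots> \<le> W x - W s" using x assms by (intro W_increment_ge) auto
  also have "\<dots> \<le> W t - W s" using W_interval(1)[of x t] x assms by simp
  finally show ?thesis by simp
qed

text \<open>The value \<open>w x\<close> separates the chords: the slope of \<open>W\<close> is at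
  least \<open>w x\<close> to the left of \<open>x\<close> and at most \<open>w x\<close> to the
  right. The product form avoids dividing by lengths that may vanish.\<close>

lemma W_concave:
  assumes "0 \<le> s" "s \<le> x" "x \<le> t" "ereal t \<le> a"
  shows "(W t - W s) * (x - s) \<le> (W x - W s) * (t - s)"
proof (cases "s < x \<and> x < t")
  case True
  then have x: "x \<in> I" using assms by (intro I_lessI[of _ t]) auto
  have "(W t - W x) * (x - s) \<le> w x * (t - x) * (x - s)"
    using W_increment_le[OF x order_refl, of t] assms by (intro mult_right_mono) auto
  also have "\<dots> = w x * (x - s) * (t - x)" by simp
  also have "\<dots> \<le> (W x - W s) * (t - x)"
    using W_increment_ge[OF x assms(1) _ order_refl] assms by (intro mult_right_mono) auto
  finally show ?thesis by (simp add: algebra_simps)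
qed (use assms in auto)

end

section \<open>Step functions\<close>

locale steps = weight +
  fixes n :: nat and A :: "nat \<Rightarrow> real set"
  assumes A_sets: "\<And>i. i < n \<Longrightarrow> A i \<in> sets \<mu>"
    and A_disj: "\<And>i j. i < n \<Longrightarrow> j < n \<Longrightarrow> i \<noteq> j \<Longrightarrow> A i \<inter> A j = {}"
    and A_pos: "\<And>i. i < n \<Longrightarrow> emeasure \<mu> (A i) \<noteq> 0"
    and A_fin: "\<And>i. i < n \<Longrightarrow> emeasure \<mu> (A i) \<noteq> \<infinity>"
begin

text \<open>For decreasing \<open>c\<close>, the rearrangement of \<open>step c\<close> takes the
  value \<open>c i\<close> on \<open>[T i, T (Suc i))\<close>, and \<open>\<omega> i\<close> is the
  mass of \<open>w\<close> there. Thus \<open>A i\<close> and this interval are the two homes of the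
  \<open>i\<close>-th step, before and after rearrangement.\<close>

definition "m i = measure \<mu> (A i)"
definition "T j = (\<Sum>i<j. m i)"
definition "step c x = (\<Sum>i<n. c i * indicator (A i) x)" for c :: "nat \<Rightarrow> real"
definition "\<omega> i = W (T (Suc i)) - W (T i)"

lemma m_pos: "i < n \<Longrightarrow> 0 < m i"
  using A_pos[of i] A_fin[of i] by (simp add: m_def measure_def enn2real_positive_iff less_top zero_less_iff_neq_zero)

lemma m_nonneg: "0 \<le> m i" by (simp add: m_def)

lemma emeasure_A: "i < n \<Longrightarrow> emeasure \<mu> (A i) = ennreal (m i)"
  using A_fin[of i] by (simp add: m_def emeasure_eq_ennreal_measure)

lemma T_0 [simp]: "T 0 = 0" by (simp add: T_def)

lemma T_Suc: "T (Suc i) = T i + m i" by (simp add: T_def)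

lemma T_mono: "i \<le> j \<Longrightarrow> T i \<le> T j"
  unfolding T_def by (intro sum_mono2) (auto simp: m_nonneg)

lemma T_nonneg: "0 \<le> T j" by (simp add: T_def m_nonneg sum_nonneg)

lemma UN_sets: "j \<le> n \<Longrightarrow> (\<Union>i<j. A i) \<in> sets \<mu>"
  using A_sets by auto

lemma emeasure_UN: "j \<le> n \<Longrightarrow> emeasure \<mu> (\<Union>i<j. A i) = ennreal (T j)"
proof -
  assume j: "j \<le> n"
  have "(\<Sum>i<j. emeasure \<mu> (A i)) = emeasure \<mu> (\<Union>i<j. A i)"
    using j A_sets A_disj by (intro sum_emeasure) (auto simp: disjoint_family_on_def)
  also have "(\<Sum>i<j. emeasure \<mu> (A i)) = (\<Sum>i<j. ennreal (m i))"
    using j by (intro sum.cong) (auto simp: emeasure_A)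
  also have "\<dots> = ennreal (T j)" by (simp add: T_def m_nonneg)
  finally show ?thesis ..
qed

lemma T_le_a: "j \<le> n \<Longrightarrow> ereal (T j) \<le> a"
proof -
  assume j: "j \<le> n"
  from I_eq show ?thesis
  proof
    assume "I = {0<..}"
    then have "ereal x < a" if "0 < x" for x using that by (auto simp: I_def interval_def)
    then have "ereal (T j + 1) < a" using T_nonneg[of j] by simp
    then show ?thesis by (metis ereal_less_eq(3) le_add_same_cancel1 less_imp_le order_trans zero_le_one)
  next
    assume "\<exists>r>0. a = ereal r \<and> I = {0<..<r}"
    then obtain r where r: "0 < r" "a = ereal r" "I = {0<..<r}" by auto
    have "ennreal (T j) \<le> emeasure \<mu> I"
      unfolding emeasure_UN[OF j, symmetric] using UN_sets[OF j] by (intro emeasure_mono) (auto simp: sets_mu)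
    also have "\<dots> = ennreal r" using r by (subst emeasure_mu) auto
    finally show ?thesis using r by simp
  qed
qed

lemma omega_pos: "i < n \<Longrightarrow> 0 < \<omega> i"
  using W_strict[OF T_nonneg _ T_le_a, of i "Suc i"] m_pos[of i] by (simp add: \<omega>_def T_Suc)

lemma omega_sum: "(\<Sum>i<j. \<omega> i) = W (T j)"
  unfolding \<omega>_def by (subst sum_lessThan_telescope) simp

lemma omega_integral:
  "i < n \<Longrightarrow> (\<integral>\<^sup>+ x\<in>{T i..<T (Suc i)}. ennreal (w x) \<partial>\<mu>) = ennreal (\<omega> i)"
  unfolding \<omega>_def using T_le_a[of "Suc i"] by (intro W_interval(2) T_nonneg T_mono) auto

lemma omega_avg_antimono:
  assumes "i \<le> j" "j < n" shows "\<omega> j / m j \<le> \<omega> i / m i"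
proof (cases "i = j")
  case False
  \<comment> \<open>Both averages are compared with the value of \<open>w\<close> at the right end
    of the \<open>i\<close>-th interval, which lies in \<open>I\<close> because
    \<open>i < j\<close>.\<close>
  define x where "x = T (Suc i)"
  have x: "x \<in> I" unfolding x_def
  proof (rule I_lessI[of _ "T (Suc j)"])
    show "0 < T (Suc i)" using T_nonneg[of i] m_pos[of i] assms by (simp add: T_Suc)
    have "T (Suc i) \<le> T j" using False assms by (intro T_mono) auto
    then show "T (Suc i) < T (Suc j)" using m_pos[of j] assms by (simp add: T_Suc)
  qed (use assms in \<open>auto intro: T_le_a\<close>)
  have "\<omega> j \<le> w x * (T (Suc j) - T j)"
    unfolding \<omega>_def using x assms False by (intro W_increment_le T_le_a) (auto simp: x_def intro: T_mono)
  then have 1: "\<omega> j / m j \<le> w x" using m_pos[of j] assms by (simp add: T_Suc divide_le_eq mult.commute)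
  have "w x * (T (Suc i) - T i) \<le> \<omega> i"
    unfolding \<omega>_def using x by (intro W_increment_ge T_nonneg) (auto simp: x_def intro: T_mono)
  then have "w x \<le> \<omega> i / m i" using m_pos[of i] assms by (simp add: T_Suc le_divide_eq mult.commute)
  with 1 show ?thesis by simp
qed simp

lemma step_A: "i < n \<Longrightarrow> x \<in> A i \<Longrightarrow> step c x = c i"
proof -
  assume i: "i < n" "x \<in> A i"
  have "step c x = (\<Sum>j<n. if j = i then c i else 0)"
    unfolding step_def using A_disj i by (intro sum.cong) (auto simp: indicator_def)
  then show ?thesis using i by simp
qed

lemma step_0: "x \<notin> (\<Union>i<n. A i) \<Longrightarrow> step c x = 0"
  unfolding step_def by (intro sum.neutral) auto

lemma step_cases:
  obtains i where "i < n" "x \<in> A i" "\<And>c. step c x = c i" | "x \<notin> (\<Union>i<n. A i)" "\<And>c. step c x = 0"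
  using step_A step_0 by blast

lemma step_measurable [measurable]: "step c \<in> borel_measurable \<mu>"
  unfolding step_def[abs_def] using A_sets by (intro borel_measurable_sum) auto

lemma step_L0: "step c \<in> L0 I"
  by (simp add: L0_def)

lemma step_nonneg: "(\<And>i. i < n \<Longrightarrow> 0 \<le> c i) \<Longrightarrow> 0 \<le> step c x"
  unfolding step_def by (intro sum_nonneg mult_nonneg_nonneg) auto

lemma nn_integral_pieces:
  assumes [measurable]: "p \<in> borel_measurable \<mu>"
    and 0: "AE x in \<mu>. x \<in> (\<Union>i<n. A i) \<or> p x = 0"
  shows "(\<integral>\<^sup>+ x. p x \<partial>\<mu>) = (\<Sum>i<n. \<integral>\<^sup>+ x\<in>A i. p x \<partial>\<mu>)"
proof -
  have "(\<integral>\<^sup>+ x. p x \<partial>\<mu>) = (\<integral>\<^sup>+ x. (\<Sum>i<n. p x * indicator (A i) x) \<partial>\<mu>)"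
  proof (rule nn_integral_cong_AE, use 0 in eventually_elim)
    case (elim x)
    show ?case
    proof (cases "x \<in> (\<Union>i<n. A i)")
      case True
      then obtain i where i: "i < n" "x \<in> A i" by blast
      have "(\<Sum>j<n. p x * indicator (A j) x) = (\<Sum>j<n. if j = i then p x else 0)"
        using A_disj i by (intro sum.cong) (auto simp: indicator_def)
      then show ?thesis using i by simp
    qed (use elim in \<open>auto simp: indicator_def\<close>)
  qed
  also have "\<dots> = (\<Sum>i<n. \<integral>\<^sup>+ x\<in>A i. p x \<partial>\<mu>)"
    using A_sets by (intro nn_integral_sum) auto
  finally show ?thesis .
qed

lemma nn_integral_const_piece: "i < n \<Longrightarrow> (\<integral>\<^sup>+ x\<in>A i. c \<partial>\<mu>) = c * ennreal (m i)"
  using A_sets[of i] by (simp add: nn_integral_cmult_indicator emeasure_A)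

lemma nn_integral_piecewise:
  assumes q: "q \<in> borel_measurable \<mu>" "\<And>i x. i < n \<Longrightarrow> x \<in> A i \<Longrightarrow> q x = ennreal (b i)"
    and b: "\<And>i. i < n \<Longrightarrow> 0 \<le> b i" and off: "AE x in \<mu>. x \<in> (\<Union>i<n. A i) \<or> q x = 0"
  shows "(\<integral>\<^sup>+ x. q x \<partial>\<mu>) = ennreal (\<Sum>i<n. b i * m i)"
proof -
  have "(\<integral>\<^sup>+ x. q x \<partial>\<mu>) = (\<Sum>i<n. \<integral>\<^sup>+ x\<in>A i. q x \<partial>\<mu>)" by (rule nn_integral_pieces[OF q(1) off])
  also have "\<dots> = (\<Sum>i<n. ennreal (b i * m i))"
  proof (intro sum.cong refl)
    fix i assume "i \<in> {..<n}"
    then have i: "i < n" by simp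
    have "(\<integral>\<^sup>+ x\<in>A i. q x \<partial>\<mu>) = (\<integral>\<^sup>+ x\<in>A i. ennreal (b i) \<partial>\<mu>)"
      using q(2)[OF i] by (intro nn_integral_cong) (auto simp: indicator_def)
    also have "\<dots> = ennreal (b i * m i)"
      using nn_integral_const_piece[OF i] b[OF i] by (simp add: ennreal_mult')
    finally show "(\<integral>\<^sup>+ x\<in>A i. q x \<partial>\<mu>) = ennreal (b i * m i)" .
  qed
  also have "\<dots> = ennreal (\<Sum>i<n. b i * m i)"
    using b by (intro sum_ennreal) (auto simp: m_nonneg)
  finally show ?thesis .
qed

lemma nn_integral_initial_T:
  assumes [measurable]: "p \<in> borel_measurable \<mu>" and j: "j \<le> n"
  shows "(\<integral>\<^sup>+ x\<in>{0<..<T j}. p x \<partial>\<mu>) = (\<Sum>i<j. \<integral>\<^sup>+ x\<in>{T i..<T (Suc i)}. p x \<partial>\<mu>)"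
  using j
proof (induction j)
  case (Suc j)
  have "(\<integral>\<^sup>+ x\<in>{0<..<T (Suc j)}. p x \<partial>\<mu>) =
      (\<integral>\<^sup>+ x\<in>{0<..<T j}. p x \<partial>\<mu>) + (\<integral>\<^sup>+ x\<in>{T j..<T (Suc j)}. p x \<partial>\<mu>)"
    by (intro nn_integral_split T_nonneg T_mono) auto
  with Suc show ?case by simp
qed simp

text \<open>Where \<open>step c\<close> exceeds \<open>c i\<close> only the sets before
  \<open>A i\<close> contribute, and their total measure is \<open>T i\<close>. Together with
  \<open>rearr_step_ge\<close> this fixes the rearrangement on
  \<open>[T i, T (Suc i))\<close>.\<close>

lemma rearr_step_le:
  assumes c: "\<And>i. i < n \<Longrightarrow> 0 \<le> c i" "\<And>i j. i \<le> j \<Longrightarrow> j < n \<Longrightarrow> c j \<le> c i"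
    and i: "i < n" and x: "T i \<le> x"
  shows "rearr I (step c) x \<le> ennreal (c i)"
proof (rule rearr_le[OF c(1)[OF i]])
  have "{t \<in> I. c i < \<bar>step c t\<bar>} \<subseteq> (\<Union>j<i. A j)"
  proof safe
    fix t assume "c i < \<bar>step c t\<bar>"
    then show "t \<in> (\<Union>j<i. A j)"
    proof (cases rule: step_cases[of t])
      case (1 k)
      then have "c i < c k" using c(1)[OF 1(1)] \<open>c i < \<bar>step c t\<bar>\<close> by simp
      then have "k < i" using c(2)[of i k] 1 by (meson not_le)
      then show ?thesis using 1 by blast
    qed (use c(1)[OF i] in auto)
  qed
  then have "distrib_fun I (step c) (c i) \<le> emeasure \<mu> (\<Union>j<i. A j)"
    unfolding distrib_mu using i by (intro emeasure_mono UN_sets) auto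
  also have "\<dots> \<le> ennreal x" using i x by (subst emeasure_UN) (auto intro: ennreal_leI)
  finally show "distrib_fun I (step c) (c i) \<le> ennreal x" .
qed

lemma rearr_step_0:
  assumes x: "T n \<le> x"
  shows "rearr I (step c) x = 0"
proof -
  have "{t \<in> I. 0 < \<bar>step c t\<bar>} \<subseteq> (\<Union>j<n. A j)"
    using step_0 by fastforce
  then have "distrib_fun I (step c) 0 \<le> emeasure \<mu> (\<Union>j<n. A j)"
    unfolding distrib_mu by (intro emeasure_mono UN_sets) auto
  also have "\<dots> \<le> ennreal x" using x by (subst emeasure_UN) (auto intro: ennreal_leI)
  finally have "rearr I (step c) x \<le> ennreal 0" by (intro rearr_le) auto
  then show ?thesis by simp
qed

lemma rearr_step_ge:
  assumes c: "\<And>i. i < n \<Longrightarrow> 0 \<le> c i" "\<And>i j. i \<le> j \<Longrightarrow> j < n \<Longrightarrow> c j \<le> c i"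
    and i: "i < n" and x: "x < T (Suc i)"
  shows "ennreal (c i) \<le> rearr I (step c) x"
proof (rule dense_le)
  fix y assume y: "y < ennreal (c i)"
  then obtain s where s: "0 \<le> s" "y = ennreal s" by (cases y) auto
  then have sc: "s < c i" using y by (simp add: ennreal_less_iff)
  have sub: "(\<Union>j<Suc i. A j) \<subseteq> {t \<in> I. s < \<bar>step c t\<bar>}"
  proof safe
    fix t j assume j: "t \<in> A j" "j < Suc i"
    then have jn: "j < n" using i by simp
    then show "t \<in> I" using A_sets[OF jn] j by (auto simp: sets_mu)
    have "c i \<le> c j" using c(2)[of j i] i j by simp
    then show "s < \<bar>step c t\<bar>" using sc step_A[OF jn j(1)] by simp
  qed
  have "ennreal x < ennreal (T (Suc i))" using x T_nonneg[of i] m_pos[OF i]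
    by (cases "0 \<le> x") (auto simp: ennreal_less_iff ennreal_neg T_Suc simp del: ennreal_plus)
  also have "\<dots> = emeasure \<mu> (\<Union>j<Suc i. A j)" using i by (subst emeasure_UN) auto
  also have "\<dots> \<le> distrib_fun I (step c) s"
    unfolding distrib_mu by (intro emeasure_mono sub L0_sets step_L0)
  finally show "y \<le> rearr I (step c) x"
    using rearr_gt_iff[OF step_L0 s(1)] s by (auto intro: less_imp_le)
qed

text \<open>Checking the nodes \<open>T j\<close> is enough: between two nodes the primitive of the
  rearrangement grows at most linearly while \<open>W\<close> is concave, and beyond
  \<open>T n\<close> the rearrangement vanishes while \<open>W\<close> still increases.\<close>

lemma submajorized_step:
  assumes c: "\<And>i. i < n \<Longrightarrow> 0 \<le> c i" "\<And>i j. i \<le> j \<Longrightarrow> j < n \<Longrightarrow> c j \<le> c i"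
    and le: "\<And>j. j \<le> n \<Longrightarrow> (\<Sum>i<j. c i * m i) \<le> W (T j)"
  shows "submajorized I (step c) w"
proof (rule submajorizedI)
  fix t assume t: "t \<in> I"
  note rearr_measurable_mu[OF step_L0, measurable]
  have piece: "(\<integral>\<^sup>+ x\<in>{T i..<s}. rearr I (step c) x \<partial>\<mu>) \<le> ennreal (c i * (s - T i))"
    if "i < n" "T i \<le> s" "ereal s \<le> a" for i s
  proof -
    have "(\<integral>\<^sup>+ x\<in>{T i..<s}. rearr I (step c) x \<partial>\<mu>) \<le> (\<integral>\<^sup>+ x\<in>{T i..<s}. ennreal (c i) \<partial>\<mu>)"
      using rearr_step_le[of c, OF c that(1)] by (intro nn_integral_mono) (auto simp: indicator_def)
    also have "\<dots> = ennreal (c i * (s - T i))"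
      using that c(1) by (subst emeasure_ico) (auto simp: T_nonneg ennreal_mult)
    finally show ?thesis .
  qed
  have init: "(\<integral>\<^sup>+ x\<in>{0<..<T j}. rearr I (step c) x \<partial>\<mu>) \<le> ennreal (\<Sum>i<j. c i * m i)" if "j \<le> n" for j
  proof -
    have "(\<integral>\<^sup>+ x\<in>{0<..<T j}. rearr I (step c) x \<partial>\<mu>) = (\<Sum>i<j. \<integral>\<^sup>+ x\<in>{T i..<T (Suc i)}. rearr I (step c) x \<partial>\<mu>)"
      using that by (intro nn_integral_initial_T) auto
    also have "\<dots> \<le> (\<Sum>i<j. ennreal (c i * m i))"
    proof (rule sum_mono)
      fix i assume "i \<in> {..<j}"
      then have "i < n" "Suc i \<le> n" using that by auto
      from piece[OF this(1) T_mono T_le_a[OF this(2)]]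
      show "(\<integral>\<^sup>+ x\<in>{T i..<T (Suc i)}. rearr I (step c) x \<partial>\<mu>) \<le> ennreal (c i * m i)"
        by (simp add: T_Suc)
    qed
    also have "\<dots> = ennreal (\<Sum>i<j. c i * m i)"
      using that c(1) by (intro sum_ennreal) (auto simp: m_nonneg)
    finally show ?thesis .
  qed
  have "(\<integral>\<^sup>+ x\<in>{0<..<t}. rearr I (step c) x \<partial>\<mu>) \<le> ennreal (W t)"
  proof (cases "T n \<le> t")
    case True
    have "(\<integral>\<^sup>+ x\<in>{0<..<t}. rearr I (step c) x \<partial>\<mu>) =
      (\<integral>\<^sup>+ x\<in>{0<..<T n}. rearr I (step c) x \<partial>\<mu>) + (\<integral>\<^sup>+ x\<in>{T n..<t}. rearr I (step c) x \<partial>\<mu>)"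
      using True by (intro nn_integral_split T_nonneg) auto
    also have "(\<integral>\<^sup>+ x\<in>{T n..<t}. rearr I (step c) x \<partial>\<mu>) = (\<integral>\<^sup>+ x. 0 \<partial>\<mu>)"
      using rearr_step_0 by (intro nn_integral_cong) (auto simp: indicator_def)
    also have "(\<integral>\<^sup>+ x\<in>{0<..<T n}. rearr I (step c) x \<partial>\<mu>) + (\<integral>\<^sup>+ x. 0 \<partial>\<mu>) \<le> ennreal (\<Sum>i<n. c i * m i)"
      using init[of n] by simp
    also have "\<dots> \<le> ennreal (W (T n))" by (intro ennreal_leI le) simp
    also have "\<dots> \<le> ennreal (W t)" using True t by (intro ennreal_leI W_interval(1) T_nonneg I_le)
    finally show ?thesis .
  next
    case False
    define k where "k = (LEAST k. t < T k)"
    have k: "t < T k" unfolding k_def by (rule LeastI[of "\<lambda>k. t < T k" n]) (use False in simp)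
    have kn: "k \<le> n" unfolding k_def by (rule Least_le) (use False in simp)
    have "k \<noteq> 0" using k I_pos[OF t] by (auto intro: ccontr)
    then obtain j where j: "k = Suc j" by (cases k) auto
    then have jn: "j < n" and tj: "T j \<le> t"
      using kn not_less_Least[of j "\<lambda>k. t < T k"] by (auto simp: k_def[symmetric])
    have "(\<integral>\<^sup>+ x\<in>{0<..<t}. rearr I (step c) x \<partial>\<mu>) =
      (\<integral>\<^sup>+ x\<in>{0<..<T j}. rearr I (step c) x \<partial>\<mu>) + (\<integral>\<^sup>+ x\<in>{T j..<t}. rearr I (step c) x \<partial>\<mu>)"
      using tj by (intro nn_integral_split T_nonneg) auto
    also have "\<dots> \<le> ennreal (\<Sum>i<j. c i * m i) + ennreal (c j * (t - T j))"
      using jn tj t by (intro add_mono init piece I_le) auto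
    also have "\<dots> = ennreal ((\<Sum>i<j. c i * m i) + c j * (t - T j))"
      using jn tj c(1) by (intro ennreal_plus[symmetric] sum_nonneg) (auto simp: m_nonneg)
    also have "\<dots> \<le> ennreal (W t)"
    proof (rule ennreal_leI)
      have conc: "\<omega> j * (t - T j) \<le> (W t - W (T j)) * m j"
        using W_concave[OF T_nonneg tj, of "T (Suc j)"] k j jn T_le_a[of "Suc j"] by (simp add: \<omega>_def T_Suc)
      define l where "l = (t - T j) / m j"
      have mj: "0 < m j" using m_pos[OF jn] .
      have l: "0 \<le> l" "l \<le> 1" "t - T j = l * m j"
        using tj k j mj by (auto simp: l_def T_Suc)
      have e1: "(\<Sum>i<j. c i * m i) \<le> W (T j)" using le[of j] jn by simp
      have e2: "(\<Sum>i<j. c i * m i) + c j * m j \<le> W (T (Suc j))" using le[of "Suc j"] jn by simp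
      have "(\<Sum>i<j. c i * m i) + c j * (t - T j) =
          (1 - l) * (\<Sum>i<j. c i * m i) + l * ((\<Sum>i<j. c i * m i) + c j * m j)"
        by (simp add: l algebra_simps)
      also have "\<dots> \<le> (1 - l) * W (T j) + l * W (T (Suc j))"
        using l e1 e2 by (intro add_mono mult_left_mono) auto
      also have "\<dots> = W (T j) + l * \<omega> j" by (simp add: \<omega>_def algebra_simps)
      also have "l * \<omega> j \<le> W t - W (T j)"
        using conc mj by (simp add: l_def divide_le_eq mult.commute)
      finally show "(\<Sum>i<j. c i * m i) + c j * (t - T j) \<le> W t" by simp
    qed
    finally show ?thesis .
  qed
  then show "(\<integral>\<^sup>+ x\<in>{0<..<t}. rearr I (step c) x \<partial>\<mu>) \<le> (\<integral>\<^sup>+ x\<in>{0<..<t}. ennreal (w x) \<partial>\<mu>)"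
    by (simp add: W_initial I_le t)
qed

end

text \<open>The steps are the level sets of the nonzero values, in decreasing order of value. Level
  sets of measure zero are discarded, since each step must have positive measure; this is why the
  sets cover the support only almost everywhere.\<close>

lemma (in weight) simple_steps:
  assumes u: "simple_function \<mu> u" "\<And>x. x \<in> I \<Longrightarrow> 0 \<le> (u x :: real)"
    and fin: "emeasure \<mu> {x \<in> I. u x \<noteq> 0} < \<infinity>"
  obtains n A c where "steps a I w n A" "\<And>i. i < n \<Longrightarrow> A i = {x \<in> I. u x = c i}"
    "\<And>i. i < n \<Longrightarrow> 0 < c i" "\<And>i j. i < j \<Longrightarrow> j < n \<Longrightarrow> c j < c i"
    "AE x in \<mu>. u x = 0 \<or> x \<in> (\<Union>i<n. A i)"
proof -
  have lev: "{x \<in> I. u x = y} \<in> sets \<mu>" for y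
    using simple_functionD(2)[OF u(1), of "{y}"] by (simp add: vimage_def Int_def conj_commute)
  have finI: "finite (u ` I)" using simple_functionD(1)[OF u(1)] by simp
  define C where "C = {y \<in> u ` I. y \<noteq> 0 \<and> emeasure \<mu> {x \<in> I. u x = y} \<noteq> 0}"
  have finC: "finite C" using finI by (simp add: C_def)
  define n where "n = card C"
  obtain h where h: "bij_betw h {..<n} C" "strict_mono_on {..<n} h"
  proof
    show "bij_betw (\<lambda>i. sorted_list_of_set C ! i) {..<n} C"
      using finC by (intro bij_betw_nth) (auto simp: n_def)
    show "strict_mono_on {..<n} (\<lambda>i. sorted_list_of_set C ! i)"
      using sorted_wrt_nth_less[OF strict_sorted_list_of_set[of C]] by (auto simp: strict_mono_on_def n_def)
  qed
  \<comment> \<open>The sorted list increases, whereas the steps are indexed by decreasing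
    values.\<close>
  define c where "c i = h (n - 1 - i)" for i
  define A where "A i = {x \<in> I. u x = c i}" for i
  have cC: "c i \<in> C" if "i < n" for i
    using that h(1) by (auto simp: c_def bij_betw_def)
  have cdec: "c j < c i" if "i < j" "j < n" for i j
    using that h(2) by (auto simp: c_def strict_mono_on_def)
  have Csurj: "\<exists>i<n. y = c i" if yC: "y \<in> C" for y
  proof -
    obtain k where k: "k < n" "y = h k" using bij_betw_imp_surj_on[OF h(1)] yC by blast
    then have "y = c (n - 1 - k)" by (simp add: c_def)
    then show ?thesis using k(1) by (intro exI[of _ "n - 1 - k"] conjI) simp_all
  qed
  show thesis
  proof (rule that[of n A c])
    show "steps a I w n A"
    proof (unfold_locales)
      show "A i \<in> sets \<mu>" for i unfolding A_def by (rule lev)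
      show "A i \<inter> A j = {}" if "i < n" "j < n" "i \<noteq> j" for i j
        using cdec[of i j] cdec[of j i] that by (cases i j rule: linorder_cases) (auto simp: A_def)
      show "emeasure \<mu> (A i) \<noteq> 0" if "i < n" for i using cC[OF that] by (simp add: C_def A_def)
      show "emeasure \<mu> (A i) \<noteq> \<infinity>" if "i < n" for i
      proof -
        have "{x \<in> I. u x \<noteq> 0} = I - {x \<in> I. u x = 0}" by auto
        then have "{x \<in> I. u x \<noteq> 0} \<in> sets \<mu>" using lev[of 0] by (metis sets.compl_sets space_lebesgue_on)
        then have "emeasure \<mu> (A i) \<le> emeasure \<mu> {x \<in> I. u x \<noteq> 0}"
          using cC[OF that] by (intro emeasure_mono) (auto simp: A_def C_def)
        with fin show ?thesis by auto
      qed
    qed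
    show "A i = {x \<in> I. u x = c i}" for i by (simp add: A_def)
    show "0 < c i" if "i < n" for i
      using cC[OF that] u(2) by (force simp: C_def less_le)
    show "c j < c i" if "i < j" "j < n" for i j by (rule cdec[OF that])
    define Z where "Z = (\<Union>y\<in>u ` I - C - {0}. {x \<in> I. u x = y})"
    have "Z \<in> null_sets \<mu>"
      unfolding Z_def by (rule null_sets.finite_UN) (use finI lev in \<open>auto simp: C_def null_sets_def\<close>)
    then have "AE x in \<mu>. x \<notin> Z" by (rule AE_not_in)
    then show "AE x in \<mu>. u x = 0 \<or> x \<in> (\<Union>i<n. A i)"
    proof (rule AE_mp, intro AE_I2 impI)
      fix x assume "x \<in> space \<mu>" "x \<notin> Z"
      then show "u x = 0 \<or> x \<in> (\<Union>i<n. A i)"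
        using Csurj[of "u x"] by (auto simp: Z_def A_def)
    qed
  qed
qed

section \<open>The Hoelder inequality\<close>

text \<open>Rounds down to the grid of mesh \<open>1/N\<close> and caps at \<open>N\<close>. It is
  monotone in \<open>y\<close>, which keeps the constructed weights monotone functions of
  \<open>|f|\<close>, but not monotone in \<open>N\<close>, so limits are taken with Fatou's
  lemma.\<close>

definition trunc :: "nat \<Rightarrow> real \<Rightarrow> real" where
  "trunc N y = min (real N) (real_of_int \<lfloor>real N * y\<rfloor> / real N)"

lemma trunc_mono: "mono (trunc N)"
  unfolding trunc_def
  by (intro monoI min.mono order_refl divide_right_mono) (auto intro!: floor_mono mult_left_mono)

lemma trunc_nonneg: "0 \<le> y \<Longrightarrow> 0 \<le> trunc N y"
  by (simp add: trunc_def)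

lemma trunc_le:
  assumes "0 \<le> y" shows "trunc N y \<le> y"
proof -
  have "real_of_int \<lfloor>real N * y\<rfloor> / real N \<le> y"
  proof (cases "N = 0")
    case False
    have "real_of_int \<lfloor>real N * y\<rfloor> \<le> real N * y" by simp
    then show ?thesis using False by (simp add: divide_le_eq mult.commute)
  qed (use assms in simp)
  then show ?thesis by (simp add: trunc_def)
qed

lemma trunc_tendsto:
  assumes "0 \<le> y" shows "(\<lambda>N. trunc N y) \<longlonglongrightarrow> y"
proof (rule tendsto_sandwich[of "\<lambda>N. y - 1 / real N" _ _ "\<lambda>_. y"])
  show "\<forall>\<^sub>F N in sequentially. y - 1 / real N \<le> trunc N y"
  proof (rule eventually_sequentiallyI[of "nat \<lceil>y\<rceil> + 1"])
    fix N assume N: "nat \<lceil>y\<rceil> + 1 \<le> N"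
    then have "y \<le> real N" by linarith
    moreover have "0 < real N" using N by simp
    moreover have "y - 1 / real N \<le> real_of_int \<lfloor>real N * y\<rfloor> / real N"
    proof -
      have "real N * y - 1 \<le> real_of_int \<lfloor>real N * y\<rfloor>" by linarith
      then have "(real N * y - 1) / real N \<le> real_of_int \<lfloor>real N * y\<rfloor> / real N"
        by (intro divide_right_mono) auto
      then show ?thesis using \<open>0 < real N\<close> by (simp add: diff_divide_distrib)
    qed
    moreover have "0 \<le> 1 / real N" by simp
    ultimately show "y - 1 / real N \<le> trunc N y" unfolding trunc_def by linarith
  qed
  show "(\<lambda>N. y - 1 / real N) \<longlonglongrightarrow> y"
    using tendsto_diff[OF tendsto_const[of y] lim_1_over_n] by simp
qed (use trunc_le[OF assms] in auto)

lemma trunc_finite: "finite (trunc N ` {0..})"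
proof (rule finite_subset)
  show "trunc N ` {0..} \<subseteq> (\<lambda>k. real k / real N) ` {..N * N}"
  proof (rule image_subsetI)
    fix y :: real assume y: "y \<in> {0..}"
    show "trunc N y \<in> (\<lambda>k. real k / real N) ` {..N * N}"
    proof (cases "N * N \<le> nat \<lfloor>real N * y\<rfloor>")
      case True
      then have "real (N * N) \<le> real (nat \<lfloor>real N * y\<rfloor>)" by linarith
      then have "real N * real N \<le> real_of_int \<lfloor>real N * y\<rfloor>" using y by simp
      then have "trunc N y = real (N * N) / real N"
        by (cases "N = 0") (auto simp: trunc_def min_def field_simps)
      then show ?thesis by blast
    next
      case False
      define k where "k = nat \<lfloor>real N * y\<rfloor>"
      have k: "real_of_int \<lfloor>real N * y\<rfloor> = real k" "k \<le> N * N" using False y by (auto simp: k_def)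
      have "real k \<le> real N * real N" using k(2) by (metis of_nat_le_iff of_nat_mult)
      then have "real k / real N \<le> real N" by (cases "N = 0") (auto simp: divide_le_eq)
      then have "trunc N y = real k / real N" by (simp add: trunc_def k(1))
      then show ?thesis using k(2) by blast
    qed
  qed
qed simp

lemma trunc_measurable [measurable]: "trunc N \<in> borel_measurable borel"
  by (rule borel_measurable_mono[OF trunc_mono])

context ivl
begin

text \<open>The cut-off at \<open>x < N\<close> provides support of finite measure when
  \<open>I\<close> is unbounded.\<close>

definition approx :: "nat \<Rightarrow> (real \<Rightarrow> real) \<Rightarrow> real \<Rightarrow> real" where
  "approx N f x = trunc N \<bar>f x\<bar> * indicator {..<real N} x"

lemma approx_nonneg: "0 \<le> approx N f x"
  by (simp add: approx_def trunc_nonneg)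

lemma approx_le: "approx N f x \<le> \<bar>f x\<bar>"
  using trunc_le[of "\<bar>f x\<bar>" N] trunc_nonneg[of "\<bar>f x\<bar>" N] by (simp add: approx_def indicator_def)

lemma approx_measurable:
  assumes "f \<in> L0 I" shows "approx N f \<in> borel_measurable \<mu>"
proof -
  have [measurable]: "f \<in> borel_measurable \<mu>" using assms by (simp add: L0_def)
  have [measurable]: "(\<lambda>x. indicator {..<real N} x :: real) \<in> borel_measurable \<mu>"
    by (rule borel_mu) simp
  show ?thesis unfolding approx_def[abs_def] by measurable
qed

lemma approx_tendsto: "(\<lambda>N. approx N f x) \<longlonglongrightarrow> \<bar>f x\<bar>"
proof (rule Lim_transform_eventually[OF trunc_tendsto])
  have "\<forall>\<^sub>F N in sequentially. x < real N"
    using reals_Archimedean2[of x] eventually_sequentially by (metis of_nat_le_iff order_less_le_trans)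
  then show "\<forall>\<^sub>F N in sequentially. trunc N \<bar>f x\<bar> = approx N f x"
    by eventually_elim (simp add: approx_def)
qed simp

lemma approx_simple:
  assumes "f \<in> L0 I" shows "simple_function \<mu> (approx N f)"
proof (rule simple_function_borel_measurable[OF approx_measurable[OF assms]])
  have "approx N f ` space \<mu> \<subseteq> insert 0 (trunc N ` {0..})"
    by (auto simp: approx_def indicator_def)
  then show "finite (approx N f ` space \<mu>)"
    by (rule finite_subset) (simp add: trunc_finite)
qed

lemma approx_support:
  assumes "f \<in> L0 I" shows "emeasure \<mu> {x \<in> I. approx N f x \<noteq> 0} < \<infinity>"
proof -
  have "emeasure \<mu> {x \<in> I. approx N f x \<noteq> 0} = emeasure lebesgue {x \<in> I. approx N f x \<noteq> 0}"
    by (rule emeasure_mu) auto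
  also have "\<dots> \<le> emeasure lebesgue {0..real N}"
    by (intro emeasure_mono) (auto simp: approx_def indicator_def dest: I_pos split: if_splits)
  finally show ?thesis by (simp add: order.strict_trans1)
qed

end

section \<open>The modular and the Orlicz norm of the Orlicz-Lorentz space\<close>

locale orlicz = N_fun \<phi> + weight a I w for \<phi> a I w
begin

abbreviation "Lam \<equiv> orlicz_lorentz \<psi> w I"
abbreviation "nrm \<equiv> orlicz_lorentz_norm0 \<phi> w I"

text \<open>An infinite rearrangement counts as 0 here, exactly as in
  \<open>orlicz_lorentz_norm0\<close>, so that \<open>nrm_le\<close> holds on all of
  \<open>L0 I\<close>.\<close>

definition "\<rho> g = (\<integral>\<^sup>+ x. ennreal (\<psi> (enn2real (rearr I g x)) * w x) \<partial>\<mu>)"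

lemma rho_scale:
  assumes "0 < c"
  shows "\<rho> (\<lambda>x. c * g x) = orlicz_modular \<psi> w I (\<lambda>t. c * enn2real (rearr I g t))"
  unfolding \<rho>_def orlicz_modular_def using assms by (simp add: rearr_scale enn2real_mult)

lemma Lam_iff:
  "g \<in> Lam \<longleftrightarrow> g \<in> L0 I \<and> (\<forall>t\<in>I. rearr I g t < \<infinity>) \<and> (\<exists>c>0. \<rho> (\<lambda>x. c * g x) < \<infinity>)"
proof -
  have "(\<lambda>t. enn2real (rearr I g t)) \<in> L0 I" if "g \<in> L0 I"
    using rearr_measurable_mu[OF that] by (simp add: L0_def)
  then show ?thesis by (auto simp: orlicz_lorentz_def orlicz_space_def rho_scale)
qed

lemma modular_mono:
  assumes "\<And>x. x \<in> I \<Longrightarrow> \<bar>f x\<bar> \<le> \<bar>g x\<bar>"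
  shows "orlicz_modular \<phi> w I f \<le> orlicz_modular \<phi> w I g"
  unfolding orlicz_modular_def using assms w_pos
  by (intro nn_integral_mono ennreal_leI mult_right_mono phi_mono) (auto simp: less_imp_le)

text \<open>The Luxemburg infimum gives admissible divisors only arbitrarily close to 1; dividing by
  \<open>1 + 1/(n+1)\<close> and Fatou's lemma reach 1 itself.\<close>

lemma modular_le_1_of_norm:
  assumes k: "k \<in> L0 I" "orlicz_norm \<phi> w I k \<le> 1"
  shows "orlicz_modular \<phi> w I k \<le> 1"
proof -
  have [measurable]: "k \<in> borel_measurable \<mu>" using k(1) by (simp add: L0_def)
  define e where "e n = 1 + inverse (real (Suc n))" for n
  have e: "1 < e n" for n by (simp add: e_def)
  have elim: "e \<longlonglongrightarrow> 1" unfolding e_def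
    using tendsto_add[OF tendsto_const[of 1] LIMSEQ_inverse_real_of_nat] by simp
  have le: "orlicz_modular \<phi> w I (\<lambda>t. k t / e n) \<le> 1" for n
  proof -
    have "orlicz_norm \<phi> w I k < ennreal (e n)"
      using k(2) e[of n] by (auto intro: le_less_trans simp: ennreal_1[symmetric] ennreal_less_iff simp del: ennreal_1)
    then obtain d where d: "0 < d" "orlicz_modular \<phi> w I (\<lambda>t. k t / d) \<le> 1" "d < e n"
      by (auto simp: orlicz_norm_def luxemburg_def INF_less_iff ennreal_less_iff)
    have "orlicz_modular \<phi> w I (\<lambda>t. k t / e n) \<le> orlicz_modular \<phi> w I (\<lambda>t. k t / d)"
      using d by (intro modular_mono) (auto simp: abs_divide intro!: divide_left_mono)
    with d show ?thesis by simp
  qed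
  have "orlicz_modular \<phi> w I k \<le> (\<integral>\<^sup>+ t. liminf (\<lambda>n. ennreal (\<phi> \<bar>k t / e n\<bar> * w t)) \<partial>\<mu>)"
    unfolding orlicz_modular_def
  proof (rule nn_integral_mono)
    fix t
    have "(\<lambda>n. k t / e n) \<longlonglongrightarrow> k t / 1"
      by (intro tendsto_divide elim tendsto_const) simp
    then have "(\<lambda>n. \<bar>k t / e n\<bar>) \<longlonglongrightarrow> \<bar>k t\<bar>" by (intro tendsto_rabs) simp
    then have "(\<lambda>n. \<phi> \<bar>k t / e n\<bar>) \<longlonglongrightarrow> \<phi> \<bar>k t\<bar>"
      by (rule continuous_on_tendsto_compose[OF phi_continuous]) auto
    then have "(\<lambda>n. ennreal (\<phi> \<bar>k t / e n\<bar> * w t)) \<longlonglongrightarrow> ennreal (\<phi> \<bar>k t\<bar> * w t)"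
      by (intro tendsto_intros)
    from lim_imp_Liminf[OF _ this]
    show "ennreal (\<phi> \<bar>k t\<bar> * w t) \<le> liminf (\<lambda>n. ennreal (\<phi> \<bar>k t / e n\<bar> * w t))" by simp
  qed
  also have "\<dots> \<le> liminf (\<lambda>n. \<integral>\<^sup>+ t. ennreal (\<phi> \<bar>k t / e n\<bar> * w t) \<partial>\<mu>)"
    by (rule nn_integral_liminf) measurable
  also have "\<dots> \<le> 1"
    using le by (intro Liminf_le) (auto simp: orlicz_modular_def)
  finally show ?thesis .
qed

lemma norm_le_1_of_modular:
  assumes "orlicz_modular \<phi> w I k \<le> 1" shows "orlicz_norm \<phi> w I k \<le> 1"
  unfolding orlicz_norm_def luxemburg_def by (rule INF_lower2[of 1]) (use assms in auto)

lemma young_integral: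
  assumes "g \<in> L0 I" "k \<in> L0 I"
  shows "(\<integral>\<^sup>+ x. ennreal (enn2real (rearr I g x) * \<bar>k x\<bar> * w x) \<partial>\<mu>) \<le> orlicz_modular \<phi> w I k + \<rho> g"
proof -
  have [measurable]: "k \<in> borel_measurable \<mu>" "rearr I g \<in> borel_measurable \<mu>"
    using assms rearr_measurable_mu by (auto simp: L0_def)
  have "(\<integral>\<^sup>+ x. ennreal (enn2real (rearr I g x) * \<bar>k x\<bar> * w x) \<partial>\<mu>)
     \<le> (\<integral>\<^sup>+ x. ennreal (\<phi> \<bar>k x\<bar> * w x) + ennreal (\<psi> (enn2real (rearr I g x)) * w x) \<partial>\<mu>)"
  proof (rule nn_integral_mono)
    fix x assume "x \<in> space \<mu>"
    then have "0 \<le> w x" using w_pos by (simp add: less_imp_le)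
    then have "enn2real (rearr I g x) * \<bar>k x\<bar> * w x \<le> (\<phi> \<bar>k x\<bar> + \<psi> (enn2real (rearr I g x))) * w x"
      using young[of "\<bar>k x\<bar>" "enn2real (rearr I g x)"] by (intro mult_right_mono) (auto simp: mult.commute)
    then show "ennreal (enn2real (rearr I g x) * \<bar>k x\<bar> * w x) \<le> ennreal (\<phi> \<bar>k x\<bar> * w x) + ennreal (\<psi> (enn2real (rearr I g x)) * w x)"
      using \<open>0 \<le> w x\<close> by (simp add: ennreal_plus[symmetric] ring_distribs ennreal_leI del: ennreal_plus)
  qed
  also have "\<dots> = orlicz_modular \<phi> w I k + \<rho> g"
    unfolding orlicz_modular_def \<rho>_def by (rule nn_integral_add) measurable
  finally show ?thesis .
qed

text \<open>Young's inequality integrated: the easy half of the Amemiya formula for the Orlicz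
  norm.\<close>

lemma nrm_le: 
  assumes g: "g \<in> L0 I" shows "nrm g \<le> 1 + \<rho> g"
  unfolding orlicz_lorentz_norm0_def
proof (rule SUP_least)
  fix k assume "k \<in> {k \<in> orlicz_space \<phi> w I. orlicz_norm \<phi> w I k \<le> 1}"
  then have k: "k \<in> L0 I" "orlicz_norm \<phi> w I k \<le> 1" by (auto simp: orlicz_space_def)
  let ?h = "\<lambda>t. enn2real (rearr I g t) * k t * w t"
  have "ennreal (integral\<^sup>L \<mu> ?h) \<le> (\<integral>\<^sup>+ x. ennreal (norm (?h x)) \<partial>\<mu>)"
  proof (cases "integrable \<mu> ?h")
    case True
    have "ennreal (integral\<^sup>L \<mu> ?h) \<le> ennreal (norm (integral\<^sup>L \<mu> ?h))" by (intro ennreal_leI) simp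
    also have "\<dots> \<le> (\<integral>\<^sup>+ x. ennreal (norm (?h x)) \<partial>\<mu>)" by (rule integral_norm_bound_ennreal[OF True])
    finally show ?thesis .
  qed (simp add: not_integrable_integral_eq)
  also have "\<dots> = (\<integral>\<^sup>+ x. ennreal (enn2real (rearr I g x) * \<bar>k x\<bar> * w x) \<partial>\<mu>)"
    using w_pos by (intro nn_integral_cong) (auto simp: abs_mult less_imp_le)
  also have "\<dots> \<le> orlicz_modular \<phi> w I k + \<rho> g" by (rule young_integral[OF g k(1)])
  also have "\<dots> \<le> 1 + \<rho> g" by (intro add_mono modular_le_1_of_norm k) simp
  finally show "ennreal (integral\<^sup>L \<mu> ?h) \<le> 1 + \<rho> g" .
qed

lemma nrm_scale_le:
  assumes c: "0 < c" shows "nrm (\<lambda>x. c * g x) \<le> ennreal c * nrm g"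
  unfolding orlicz_lorentz_norm0_def[of _ _ _ "\<lambda>x. c * g x"]
proof (rule SUP_least)
  fix k assume k: "k \<in> {k \<in> orlicz_space \<phi> w I. orlicz_norm \<phi> w I k \<le> 1}"
  have "(\<integral>t. enn2real (rearr I (\<lambda>x. c * g x) t) * k t * w t \<partial>\<mu>) = (\<integral>t. c * (enn2real (rearr I g t) * k t * w t) \<partial>\<mu>)"
    using c by (simp add: rearr_scale enn2real_mult mult_ac)
  also have "\<dots> = c * (\<integral>t. enn2real (rearr I g t) * k t * w t \<partial>\<mu>)" by simp
  finally have "ennreal (\<integral>t. enn2real (rearr I (\<lambda>x. c * g x) t) * k t * w t \<partial>\<mu>)
      = ennreal c * ennreal (\<integral>t. enn2real (rearr I g t) * k t * w t \<partial>\<mu>)"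
    using c by (simp add: ennreal_mult')
  also have "\<dots> \<le> ennreal c * nrm g"
    unfolding orlicz_lorentz_norm0_def by (intro mult_left_mono SUP_upper k) simp
  finally show "ennreal (\<integral>t. enn2real (rearr I (\<lambda>x. c * g x) t) * k t * w t \<partial>\<mu>) \<le> ennreal c * nrm g" .
qed

lemma nrm_finite:
  assumes "g \<in> Lam" shows "nrm g < \<infinity>"
proof -
  obtain c where c: "0 < c" "\<rho> (\<lambda>x. c * g x) < \<infinity>" and g: "g \<in> L0 I" using assms by (auto simp: Lam_iff)
  have cg: "(\<lambda>x. c * g x) \<in> L0 I" using g by (simp add: L0_def)
  have "nrm g = nrm (\<lambda>x. (1/c) * (c * g x))" using c by simp
  also have "\<dots> \<le> ennreal (1/c) * nrm (\<lambda>x. c * g x)" using c by (intro nrm_scale_le) auto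
  also have "\<dots> \<le> ennreal (1/c) * (1 + \<rho> (\<lambda>x. c * g x))" by (intro mult_left_mono nrm_le cg) simp
  also have "\<dots> < \<infinity>" using c(2) by (simp add: ennreal_mult_less_top)
  finally show ?thesis .
qed

text \<open>The norm is built from Bochner integrals, which are 0 for a non-integrable product.
  Young's inequality for a multiple of \<open>g\<close> with finite modular shows that the product
  is integrable, so that the competitor \<open>k\<close> really counts.\<close>

lemma nrm_ge:
  assumes g: "g \<in> Lam" and k: "k \<in> L0 I" "\<And>x. 0 \<le> k x" "orlicz_modular \<phi> w I k \<le> 1"
  shows "(\<integral>\<^sup>+ x. ennreal (enn2real (rearr I g x) * k x * w x) \<partial>\<mu>) \<le> nrm g"
proof -
  obtain c where c: "0 < c" "\<rho> (\<lambda>x. c * g x) < \<infinity>" and g0: "g \<in> L0 I" using g by (auto simp: Lam_iff)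
  have cg: "(\<lambda>x. c * g x) \<in> L0 I" using g0 by (simp add: L0_def)
  let ?h = "\<lambda>x. enn2real (rearr I g x) * k x * w x"
  have [measurable]: "k \<in> borel_measurable \<mu>" "rearr I g \<in> borel_measurable \<mu>"
    using k(1) rearr_measurable_mu[OF g0] by (auto simp: L0_def)
  have h0: "0 \<le> ?h x" if "x \<in> I" for x using k(2)[of x] w_pos[OF that] by simp
  have "ennreal c * (\<integral>\<^sup>+ x. ennreal (?h x) \<partial>\<mu>) = (\<integral>\<^sup>+ x. ennreal (enn2real (rearr I (\<lambda>x. c * g x) x) * \<bar>k x\<bar> * w x) \<partial>\<mu>)"
    using c k(2) by (subst nn_integral_cmult[symmetric])
      (auto simp: rearr_scale enn2real_mult ennreal_mult'[symmetric] mult_ac intro!: nn_integral_cong)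
  also have "\<dots> \<le> orlicz_modular \<phi> w I k + \<rho> (\<lambda>x. c * g x)" by (rule young_integral[OF cg k(1)])
  also have "\<dots> < \<infinity>" using k(3) c(2) by (simp add: order.strict_trans1)
  finally have fin: "(\<integral>\<^sup>+ x. ennreal (?h x) \<partial>\<mu>) < \<infinity>"
    using c(1) by (auto simp: ennreal_mult_less_top)
  have int: "integrable \<mu> ?h"
  proof (rule integrableI_bounded)
    have "(\<integral>\<^sup>+ x. ennreal (norm (?h x)) \<partial>\<mu>) = (\<integral>\<^sup>+ x. ennreal (?h x) \<partial>\<mu>)"
      using h0 by (intro nn_integral_cong) (auto simp del: enn2real_nonneg)
    with fin show "(\<integral>\<^sup>+ x. ennreal (norm (?h x)) \<partial>\<mu>) < \<infinity>" by simp
  qed measurable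
  have "(\<integral>\<^sup>+ x. ennreal (?h x) \<partial>\<mu>) = ennreal (integral\<^sup>L \<mu> ?h)"
    using h0 by (intro nn_integral_eq_integral int AE_I2) auto
  also have "\<dots> \<le> nrm g"
    unfolding orlicz_lorentz_norm0_def
  proof (rule SUP_upper2[of k])
    have "orlicz_modular \<phi> w I (\<lambda>t. 1 * k t) < \<infinity>" using k(3) by (simp add: order.strict_trans1)
    then have "k \<in> orlicz_space \<phi> w I" unfolding orlicz_space_def using k(1) zero_less_one by blast
    then show "k \<in> {k \<in> orlicz_space \<phi> w I. orlicz_norm \<phi> w I k \<le> 1}"
      using norm_le_1_of_modular[OF k(3)] by simp
  qed simp
  finally show ?thesis .
qed

end

section \<open>Averaging along the transport\<close>

locale orlicz_steps = orlicz \<phi> a I w + steps a I w n A for \<phi> a I w n A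
begin

text \<open>The step function is only a minorant of \<open>|g|\<close>, so \<open>nrm g\<close>
  bounds all step approximations of \<open>g\<close> at once and the limit can be taken without any
  monotonicity of the norm.\<close>

lemma transported_bound:
  assumes v: "v \<in> L0 I" "\<And>x. x \<in> I \<Longrightarrow> 0 \<le> v x" "submajorized I v w"
    and h: "h \<in> L0 I" "\<And>x. x \<in> I \<Longrightarrow> 0 \<le> h x" "(\<integral>\<^sup>+ x. ennreal (\<phi> (h x) * v x) \<partial>\<mu>) \<le> 1"
    and g: "g \<in> Lam" and c: "\<And>i. i < n \<Longrightarrow> 0 \<le> c i" "\<And>i j. i \<le> j \<Longrightarrow> j < n \<Longrightarrow> c j \<le> c i"
    and cg: "\<And>x. x \<in> I \<Longrightarrow> step c x \<le> \<bar>g x\<bar>"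
  shows "(\<integral>\<^sup>+ x. ennreal (h x * v x * step c x) \<partial>\<mu>) \<le> nrm g"
proof -
  have g0: "g \<in> L0 I" using g by (simp add: Lam_iff)
  have [measurable]: "v \<in> borel_measurable \<mu>" "h \<in> borel_measurable \<mu>"
    using v(1) h(1) by (auto simp: L0_def)
  have [measurable]: "(\<lambda>x. \<phi> (h x)) \<in> borel_measurable \<mu>"
    using phi_measurable[of h \<mu>] h(2) by (subst measurable_cong[of _ _ "\<lambda>x. \<phi> \<bar>h x\<bar>"]) auto
  note rearr_measurable_mu[OF g0, measurable] A_sets[measurable]
  have phi1: "0 < \<phi> 1" by (simp add: phi_pos)
  \<comment> \<open>\<open>V\<close>, \<open>H\<close>, \<open>Q\<close> are the masses of
    \<open>v\<close>, \<open>h v\<close>, \<open>\<phi>(h) v\<close> on \<open>A i\<close>. They are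
    finite by submajorization, by the linear bound on \<open>\<phi>\<close>, and by the modular
    hypothesis, respectively.\<close>
  define V where "V i = enn2real (\<integral>\<^sup>+ x\<in>A i. ennreal (v x) \<partial>\<mu>)" for i
  define H where "H i = enn2real (\<integral>\<^sup>+ x\<in>A i. ennreal (h x * v x) \<partial>\<mu>)" for i
  define Q where "Q i = enn2real (\<integral>\<^sup>+ x\<in>A i. ennreal (\<phi> (h x) * v x) \<partial>\<mu>)" for i
  have init: "(\<integral>\<^sup>+ x\<in>(\<Union>i<j. A i). ennreal (v x) \<partial>\<mu>) \<le> ennreal (W (T j))" if j: "j \<le> n" for j
  proof -
    have "(\<integral>\<^sup>+ x\<in>(\<Union>i<j. A i). ennreal (v x) \<partial>\<mu>) \<le>
        (\<integral>\<^sup>+ x. ennreal (w x) * indicator {x. ennreal x < ennreal (T j)} x \<partial>\<mu>)"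
      unfolding emeasure_UN[OF j, symmetric] by (rule submajorized_integral_le[OF v UN_sets[OF j]])
    also have "\<dots> = (\<integral>\<^sup>+ x\<in>{0<..<T j}. ennreal (w x) \<partial>\<mu>)"
      using T_nonneg by (intro nn_integral_cong) (auto simp: indicator_def ennreal_less_iff dest: I_pos)
    also have "\<dots> = ennreal (W (T j))" by (rule W_initial[OF T_le_a[OF j]])
    finally show ?thesis .
  qed
  have V: "(\<integral>\<^sup>+ x\<in>A i. ennreal (v x) \<partial>\<mu>) = ennreal (V i)" if "i < n" for i
  proof -
    have "(\<integral>\<^sup>+ x\<in>A i. ennreal (v x) \<partial>\<mu>) \<le> (\<integral>\<^sup>+ x\<in>(\<Union>i<n. A i). ennreal (v x) \<partial>\<mu>)"
      using that by (intro nn_integral_mono) (auto simp: indicator_def)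
    also have "\<dots> \<le> ennreal (W (T n))" by (rule init) simp
    finally have "(\<integral>\<^sup>+ x\<in>A i. ennreal (v x) \<partial>\<mu>) < \<infinity>" by (simp add: order.strict_trans1)
    then show ?thesis by (simp add: V_def)
  qed
  have Q: "(\<integral>\<^sup>+ x\<in>A i. ennreal (\<phi> (h x) * v x) \<partial>\<mu>) = ennreal (Q i)" for i
  proof -
    have "(\<integral>\<^sup>+ x\<in>A i. ennreal (\<phi> (h x) * v x) \<partial>\<mu>) \<le> (\<integral>\<^sup>+ x. ennreal (\<phi> (h x) * v x) \<partial>\<mu>)"
      by (intro nn_integral_mono) (auto simp: indicator_def)
    then have "(\<integral>\<^sup>+ x\<in>A i. ennreal (\<phi> (h x) * v x) \<partial>\<mu>) < \<infinity>"
      using h(3) by (simp add: order.strict_trans1)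
    then show ?thesis by (simp add: Q_def)
  qed
  have H: "(\<integral>\<^sup>+ x\<in>A i. ennreal (h x * v x) \<partial>\<mu>) = ennreal (H i)" if i: "i < n" for i
  proof -
    have "(\<integral>\<^sup>+ x\<in>A i. ennreal (h x * v x) \<partial>\<mu>) \<le>
       (\<integral>\<^sup>+ x. ennreal (v x) * indicator (A i) x + ennreal (1 / \<phi> 1) * (ennreal (\<phi> (h x) * v x) * indicator (A i) x) \<partial>\<mu>)"
    proof (rule nn_integral_mono)
      fix x assume "x \<in> space \<mu>"
      then have x: "0 \<le> v x" "0 \<le> h x" using v(2) h(2) by auto
      have "h x * v x \<le> (1 + \<phi> (h x) / \<phi> 1) * v x"
        by (intro mult_right_mono phi_linear_bound x)
      then have "ennreal (h x * v x) \<le> ennreal (v x + (1 / \<phi> 1) * (\<phi> (h x) * v x))"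
        by (intro ennreal_leI) (simp add: algebra_simps)
      also have "\<dots> = ennreal (v x) + ennreal (1 / \<phi> 1) * ennreal (\<phi> (h x) * v x)"
        using x phi1 by (subst ennreal_plus) (auto simp: ennreal_mult'[symmetric])
      finally show "ennreal (h x * v x) * indicator (A i) x \<le>
         ennreal (v x) * indicator (A i) x + ennreal (1 / \<phi> 1) * (ennreal (\<phi> (h x) * v x) * indicator (A i) x)"
        by (auto simp: indicator_def)
    qed
    also have "\<dots> = ennreal (V i) + ennreal (1 / \<phi> 1) * ennreal (Q i)"
      using i A_sets[OF i] by (subst nn_integral_add) (auto simp: nn_integral_cmult V Q)
    finally have "(\<integral>\<^sup>+ x\<in>A i. ennreal (h x * v x) \<partial>\<mu>) < \<infinity>"
      by (rule order.strict_trans1) (simp add: ennreal_mult_less_top)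
    then show ?thesis by (simp add: H_def)
  qed
  have V0: "0 \<le> V i" and H0: "0 \<le> H i" and Q0: "0 \<le> Q i" for i by (simp_all add: V_def H_def Q_def)
  \<comment> \<open>The mean of \<open>h\<close> on \<open>A i\<close> with respect to
    \<open>v\<close>. If \<open>V i = 0\<close> the quotient is 0, and \<open>H i\<close> vanishes
    too, because \<open>v\<close> vanishes almost everywhere on \<open>A i\<close>.\<close>
  define b where "b i = H i / V i" for i
  have b0: "0 \<le> b i" for i using V0 H0 by (simp add: b_def)
  have HV: "H i = b i * V i" if i: "i < n" for i
  proof (cases "V i = 0")
    case True
    then have "(\<integral>\<^sup>+ x\<in>A i. ennreal (v x) \<partial>\<mu>) = 0" using V[OF i] by simp
    then have "AE x in \<mu>. ennreal (v x) * indicator (A i) x = 0"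
      using A_sets[OF i] by (subst (asm) nn_integral_0_iff_AE) auto
    then have "(\<integral>\<^sup>+ x\<in>A i. ennreal (h x * v x) \<partial>\<mu>) = (\<integral>\<^sup>+ x. 0 \<partial>\<mu>)"
    proof (intro nn_integral_cong_AE, elim AE_mp, intro AE_I2 impI)
      fix x assume "x \<in> space \<mu>" "ennreal (v x) * indicator (A i) x = 0"
      then show "ennreal (h x * v x) * indicator (A i) x = 0"
        using v(2)[of x] by (auto simp: indicator_def ennreal_eq_0_iff split: if_splits)
    qed
    then show ?thesis using True by (simp add: H_def)
  qed (simp add: b_def)
  \<comment> \<open>Jensen on \<open>A i\<close>, obtained by integrating the supporting line of
    \<open>\<phi>\<close> at \<open>b i\<close> against \<open>v\<close>. A second Jensen, across
    different steps, is inside \<open>transport_weights\<close>.\<close>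
  have jensen: "\<phi> (b i) * V i \<le> Q i" if i: "i < n" for i
  proof (cases "b i = 0")
    case False
    then have "0 < b i" using b0[of i] by simp
    then obtain p where p: "0 \<le> p" "\<And>y. 0 \<le> y \<Longrightarrow> \<phi> (b i) + p * (y - b i) \<le> \<phi> y"
      using phi_subgradient by blast
    have "ennreal (\<phi> (b i)) * ennreal (V i) + ennreal p * ennreal (H i) =
       (\<integral>\<^sup>+ x. ennreal (\<phi> (b i)) * (ennreal (v x) * indicator (A i) x) + ennreal p * (ennreal (h x * v x) * indicator (A i) x) \<partial>\<mu>)"
      using i A_sets[OF i] by (subst nn_integral_add) (auto simp: nn_integral_cmult V H)
    also have "\<dots> \<le> (\<integral>\<^sup>+ x. ennreal (\<phi> (h x) * v x) * indicator (A i) x + ennreal (p * b i) * (ennreal (v x) * indicator (A i) x) \<partial>\<mu>)"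
    proof (rule nn_integral_mono)
      fix x assume "x \<in> space \<mu>"
      then have x: "0 \<le> v x" "0 \<le> h x" using v(2) h(2) by auto
      have "(\<phi> (b i) + p * h x) * v x \<le> (\<phi> (h x) + p * b i) * v x"
        using p(2)[OF x(2)] x(1) by (intro mult_right_mono) (simp_all add: algebra_simps)
      then have "ennreal (\<phi> (b i) * v x + p * (h x * v x)) \<le> ennreal (\<phi> (h x) * v x + (p * b i) * v x)"
        by (intro ennreal_leI) (simp add: algebra_simps)
      then have "ennreal (\<phi> (b i)) * ennreal (v x) + ennreal p * ennreal (h x * v x) \<le> ennreal (\<phi> (h x) * v x) + ennreal (p * b i) * ennreal (v x)"
        using x p(1) b0[of i] by (simp add: ennreal_mult)
      then show "ennreal (\<phi> (b i)) * (ennreal (v x) * indicator (A i) x) + ennreal p * (ennreal (h x * v x) * indicator (A i) x)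
         \<le> ennreal (\<phi> (h x) * v x) * indicator (A i) x + ennreal (p * b i) * (ennreal (v x) * indicator (A i) x)"
        by (auto simp: indicator_def)
    qed
    also have "\<dots> = ennreal (Q i) + ennreal (p * b i) * ennreal (V i)"
      using i A_sets[OF i] by (subst nn_integral_add) (auto simp: nn_integral_cmult V Q)
    finally have "ennreal (\<phi> (b i) * V i + p * H i) \<le> ennreal (Q i + p * b i * V i)"
      using p(1) b0[of i] V0[of i] H0[of i] Q0[of i] by (simp add: ennreal_mult)
    then have "\<phi> (b i) * V i + p * H i \<le> Q i + p * b i * V i"
      using p(1) b0[of i] V0[of i] Q0[of i] by (subst (asm) ennreal_le_iff) auto
    then show ?thesis by (simp add: HV[OF i])
  qed (use Q0 in simp)
  have sumQ: "(\<Sum>i<n. Q i) \<le> 1"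
  proof -
    have "ennreal (\<Sum>i<n. Q i) = (\<Sum>i<n. \<integral>\<^sup>+ x\<in>A i. ennreal (\<phi> (h x) * v x) \<partial>\<mu>)"
      by (simp add: Q Q0)
    also have "\<dots> = (\<integral>\<^sup>+ x. (\<Sum>i<n. ennreal (\<phi> (h x) * v x) * indicator (A i) x) \<partial>\<mu>)"
      using A_sets by (intro nn_integral_sum[symmetric]) auto
    also have "\<dots> \<le> (\<integral>\<^sup>+ x. ennreal (\<phi> (h x) * v x) \<partial>\<mu>)"
    proof (rule nn_integral_mono)
      fix x
      have "(\<Sum>i<n. indicator (A i) x :: ennreal) = indicator (\<Union>i<n. A i) x"
        using A_disj by (intro indicator_UN_disjoint[symmetric]) (auto simp: disjoint_family_on_def)
      also have "\<dots> \<le> 1" by (simp add: indicator_def)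
      finally show "(\<Sum>i<n. ennreal (\<phi> (h x) * v x) * indicator (A i) x) \<le> ennreal (\<phi> (h x) * v x)"
        unfolding sum_distrib_left[symmetric] by (metis mult.right_neutral mult_left_mono zero_le)
    qed
    also have "\<dots> \<le> 1" by (rule h(3))
    finally show ?thesis by (simp add: ennreal_le_1)
  qed
  have cumV: "(\<Sum>i<j. V i) \<le> (\<Sum>i<j. \<omega> i)" if j: "j \<le> n" for j
  proof -
    have "ennreal (\<Sum>i<j. V i) = (\<Sum>i<j. \<integral>\<^sup>+ x\<in>A i. ennreal (v x) \<partial>\<mu>)"
      using j by (simp add: V V0)
    also have "\<dots> = (\<integral>\<^sup>+ x. (\<Sum>i<j. ennreal (v x) * indicator (A i) x) \<partial>\<mu>)"
      using A_sets j by (intro nn_integral_sum[symmetric]) auto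
    also have "\<dots> = (\<integral>\<^sup>+ x\<in>(\<Union>i<j. A i). ennreal (v x) \<partial>\<mu>)"
    proof (rule nn_integral_cong)
      fix x
      have "(\<Sum>i<j. indicator (A i) x :: ennreal) = indicator (\<Union>i<j. A i) x"
        using A_disj j by (intro indicator_UN_disjoint[symmetric]) (auto simp: disjoint_family_on_def)
      then show "(\<Sum>i<j. ennreal (v x) * indicator (A i) x) = ennreal (v x) * indicator (\<Union>i<j. A i) x"
        unfolding sum_distrib_left[symmetric] by simp
    qed
    also have "\<dots> \<le> ennreal (W (T j))" by (rule init[OF j])
    finally show ?thesis by (simp add: omega_sum W_nonneg)
  qed
  obtain k where k: "\<And>i. i < n \<Longrightarrow> 0 \<le> k i"
    and k1: "(\<Sum>i<n. \<phi> (k i) * \<omega> i) \<le> (\<Sum>i<n. \<phi> (b i) * V i)"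
    and k2: "(\<Sum>i<n. c i * b i * V i) \<le> (\<Sum>i<n. c i * k i * \<omega> i)"
    by (rule transport_weights[of n V \<omega> b c, OF V0 omega_pos cumV b0 c(2)]) (assumption+, rule that)
  \<comment> \<open>The transported averages are placed on the intervals of the rearrangement, where
    \<open>w\<close> has masses \<open>\<omega> i\<close>. This is the competitor in the Orlicz norm
    of \<open>g\<close>.\<close>
  define K where "K x = (\<Sum>i<n. k i * indicator {T i..<T (Suc i)} x)" for x
  have K_piece: "K x = k i" if "i < n" "T i \<le> x" "x < T (Suc i)" for i x
  proof -
    have "K x = (\<Sum>j<n. if j = i then k i else 0)"
      unfolding K_def
    proof (intro sum.cong refl)
      fix j assume "j \<in> {..<n}"
      consider "j = i" | "Suc j \<le> i" | "Suc i \<le> j" by linarith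
      then show "k j * indicator {T j..<T (Suc j)} x = (if j = i then k i else 0)"
      proof cases
        case 2
        from T_mono[OF this] that 2 show ?thesis by (auto simp: indicator_def)
      next
        case 3
        from T_mono[OF this] that 3 show ?thesis by (auto simp: indicator_def)
      qed (use that in auto)
    qed
    then show ?thesis using that by simp
  qed
  have K_0: "K x = 0" if "T n \<le> x" for x
  proof -
    have "T (Suc i) \<le> x" if "i < n" for i
      using T_mono[of "Suc i" n] that \<open>T n \<le> x\<close> by simp
    then show ?thesis unfolding K_def by (intro sum.neutral) (force simp: indicator_def)
  qed
  have K_nonneg: "0 \<le> K x" for x
    unfolding K_def using k by (intro sum_nonneg mult_nonneg_nonneg) auto
  have K_meas [measurable]: "K \<in> borel_measurable \<mu>"
    by (rule borel_mu) (unfold K_def[abs_def], measurable)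
  have K_mod: "orlicz_modular \<phi> w I K \<le> 1"
  proof -
    have "orlicz_modular \<phi> w I K = (\<integral>\<^sup>+ x\<in>{0<..<T n}. ennreal (\<phi> \<bar>K x\<bar> * w x) \<partial>\<mu>)"
      unfolding orlicz_modular_def using K_0 by (intro nn_integral_cong) (auto simp: indicator_def dest: I_pos)
    also have "\<dots> = (\<Sum>i<n. \<integral>\<^sup>+ x\<in>{T i..<T (Suc i)}. ennreal (\<phi> \<bar>K x\<bar> * w x) \<partial>\<mu>)"
      by (intro nn_integral_initial_T) auto
    also have "\<dots> = (\<Sum>i<n. ennreal (\<phi> (k i) * \<omega> i))"
    proof (intro sum.cong refl)
      fix i assume "i \<in> {..<n}"
      then have i: "i < n" by simp
      have "(\<integral>\<^sup>+ x\<in>{T i..<T (Suc i)}. ennreal (\<phi> \<bar>K x\<bar> * w x) \<partial>\<mu>) =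
         (\<integral>\<^sup>+ x. ennreal (\<phi> (k i)) * (ennreal (w x) * indicator {T i..<T (Suc i)} x) \<partial>\<mu>)"
        using K_piece[OF i] k[OF i] by (intro nn_integral_cong) (auto simp: indicator_def ennreal_mult')
      also have "\<dots> = ennreal (\<phi> (k i) * \<omega> i)"
        using k[OF i] omega_integral[OF i] by (simp add: nn_integral_cmult ennreal_mult')
      finally show "(\<integral>\<^sup>+ x\<in>{T i..<T (Suc i)}. ennreal (\<phi> \<bar>K x\<bar> * w x) \<partial>\<mu>) = ennreal (\<phi> (k i) * \<omega> i)" .
    qed
    also have "\<dots> = ennreal (\<Sum>i<n. \<phi> (k i) * \<omega> i)"
      using k omega_pos by (intro sum_ennreal) (auto simp: less_imp_le)
    also have "\<dots> \<le> ennreal (\<Sum>i<n. Q i)"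
      by (intro ennreal_leI order_trans[OF k1] sum_mono jensen) simp
    also have "\<dots> \<le> 1" using sumQ by (simp add: ennreal_le_1)
    finally show ?thesis .
  qed
  have "(\<integral>\<^sup>+ x. ennreal (h x * v x * step c x) \<partial>\<mu>) = (\<Sum>i<n. \<integral>\<^sup>+ x\<in>A i. ennreal (h x * v x * step c x) \<partial>\<mu>)"
    using step_0 by (intro nn_integral_pieces) (measurable, fastforce)
  also have "\<dots> = (\<Sum>i<n. ennreal (c i * b i * V i))"
  proof (intro sum.cong refl)
    fix i assume "i \<in> {..<n}"
    then have i: "i < n" by simp
    have "(\<integral>\<^sup>+ x\<in>A i. ennreal (h x * v x * step c x) \<partial>\<mu>) = (\<integral>\<^sup>+ x. ennreal (c i) * (ennreal (h x * v x) * indicator (A i) x) \<partial>\<mu>)"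
      using step_A[OF i, of _ c] c(1)[OF i] by (intro nn_integral_cong) (auto simp: indicator_def ennreal_mult'[symmetric] mult_ac)
    also have "\<dots> = ennreal (c i) * ennreal (H i)"
      using A_sets[OF i] H[OF i] by (subst nn_integral_cmult) auto
    finally show "(\<integral>\<^sup>+ x\<in>A i. ennreal (h x * v x * step c x) \<partial>\<mu>) = ennreal (c i * b i * V i)"
      using c(1)[OF i] HV[OF i] by (simp add: ennreal_mult'[symmetric] mult_ac)
  qed
  also have "\<dots> = ennreal (\<Sum>i<n. c i * b i * V i)"
    using c(1) b0 V0 by (intro sum_ennreal) auto
  also have "\<dots> \<le> ennreal (\<Sum>i<n. c i * k i * \<omega> i)" by (rule ennreal_leI[OF k2])
  also have "\<dots> = (\<Sum>i<n. ennreal (c i * k i * \<omega> i))"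
    using c(1) k omega_pos by (intro sum_ennreal[symmetric]) (auto simp: less_imp_le)
  also have "\<dots> \<le> (\<Sum>i<n. \<integral>\<^sup>+ x\<in>{T i..<T (Suc i)}. ennreal (enn2real (rearr I g x) * K x * w x) \<partial>\<mu>)"
  proof (intro sum_mono)
    fix i assume "i \<in> {..<n}"
    then have i: "i < n" by simp
    have "ennreal (c i * k i * \<omega> i) = (\<integral>\<^sup>+ x. ennreal (c i * k i) * (ennreal (w x) * indicator {T i..<T (Suc i)} x) \<partial>\<mu>)"
      using c(1)[OF i] k[OF i] omega_integral[OF i] by (simp add: nn_integral_cmult ennreal_mult')
    also have "\<dots> \<le> (\<integral>\<^sup>+ x\<in>{T i..<T (Suc i)}. ennreal (enn2real (rearr I g x) * K x * w x) \<partial>\<mu>)"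
    proof (rule nn_integral_mono)
      fix x assume "x \<in> space \<mu>"
      then have x: "x \<in> I" by simp
      show "ennreal (c i * k i) * (ennreal (w x) * indicator {T i..<T (Suc i)} x) \<le> ennreal (enn2real (rearr I g x) * K x * w x) * indicator {T i..<T (Suc i)} x"
      proof (cases "x \<in> {T i..<T (Suc i)}")
        case True
        have "ennreal (c i) \<le> rearr I (step c) x"
          using True by (intro rearr_step_ge c i) auto
        also have "\<dots> \<le> rearr I g x"
          using cg step_nonneg[of c, OF c(1)] by (intro rearr_mono g0) auto
        also have "\<dots> = ennreal (enn2real (rearr I g x))" using g x by (auto simp: Lam_iff)
        finally have ci: "c i \<le> enn2real (rearr I g x)" by simp
        have "c i * k i * w x \<le> enn2real (rearr I g x) * k i * w x"
          using ci k[OF i] w_pos[OF x] by (intro mult_right_mono) auto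
        then show ?thesis using True K_piece[OF i] c(1)[OF i] k[OF i]
          by (simp add: ennreal_mult'[symmetric] ennreal_leI)
      qed simp
    qed
    finally show "ennreal (c i * k i * \<omega> i) \<le> (\<integral>\<^sup>+ x\<in>{T i..<T (Suc i)}. ennreal (enn2real (rearr I g x) * K x * w x) \<partial>\<mu>)" .
  qed
  also have "\<dots> = (\<integral>\<^sup>+ x\<in>{0<..<T n}. ennreal (enn2real (rearr I g x) * K x * w x) \<partial>\<mu>)"
    by (intro nn_integral_initial_T[symmetric]) auto
  also have "\<dots> \<le> (\<integral>\<^sup>+ x. ennreal (enn2real (rearr I g x) * K x * w x) \<partial>\<mu>)"
    by (intro nn_integral_mono) (auto simp: indicator_def)
  also have "\<dots> \<le> nrm g"
    using K_meas K_nonneg K_mod by (intro nrm_ge g) (auto simp: L0_def)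
  finally show ?thesis .
qed

end

section \<open>The Hoelder inequality for arbitrary functions\<close>

context orlicz
begin

text \<open>The perspective function of \<open>\<phi>\<close>, closed at \<open>v = 0\<close> by the
  value that superlinear growth forces there. It is the integrand of
  \<open>P_modular\<close>.\<close>

abbreviation persp :: "real \<Rightarrow> real \<Rightarrow> ennreal" where
  "persp y v \<equiv> (if v = 0 then (if y = 0 then 0 else \<infinity>) else ennreal (\<phi> (\<bar>y\<bar> / v) * v))"

lemma persp_measurable [measurable]:
  assumes [measurable]: "f \<in> borel_measurable M" "v \<in> borel_measurable M" and v: "\<And>x. x \<in> space M \<Longrightarrow> 0 \<le> v x"
  shows "(\<lambda>x. persp (f x) (v x)) \<in> borel_measurable M"
proof -
  have "(\<lambda>x. if v x = 0 then (if f x = 0 then 0 else \<infinity>) else ennreal (\<phi> \<bar>f x / v x\<bar> * v x)) \<in> borel_measurable M"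
    by measurable
  moreover have "persp (f x) (v x) = (if v x = 0 then (if f x = 0 then 0 else \<infinity>) else ennreal (\<phi> \<bar>f x / v x\<bar> * v x))"
    if "x \<in> space M" for x using v[OF that] by (simp add: abs_divide)
  ultimately show ?thesis by (simp cong: measurable_cong)
qed

lemma holder_step_bound:
  assumes f: "f \<in> L0 I" and g: "g \<in> Lam" and v: "v \<in> L0 I" "\<And>x. x \<in> I \<Longrightarrow> 0 \<le> v x" "submajorized I v w"
    and P: "(\<integral>\<^sup>+ x. persp (f x) (v x) \<partial>\<mu>) \<le> ennreal d" and d: "1 \<le> d"
  shows "(\<integral>\<^sup>+ x. ennreal (\<bar>f x\<bar> * \<bar>g x\<bar>) \<partial>\<mu>) \<le> ennreal d * nrm g"
proof -
  have g0: "g \<in> L0 I" using g by (simp add: Lam_iff)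
  have [measurable]: "f \<in> borel_measurable \<mu>" "v \<in> borel_measurable \<mu>" "g \<in> borel_measurable \<mu>"
    using f v g0 by (auto simp: L0_def)
  have mp [measurable]: "(\<lambda>x. persp (f x) (v x)) \<in> borel_measurable \<mu>"
    using v(2) by (intro persp_measurable) auto
  note approx_measurable[OF g0, measurable]
  \<comment> \<open>Since \<open>d \<ge> 1\<close>, convexity with \<open>\<phi> 0 = 0\<close> turns
    division by \<open>d\<close> inside \<open>\<phi>\<close> into a factor \<open>1/d\<close>
    outside, which brings the modular down to 1.\<close>
  define h where "h x = \<bar>f x\<bar> / v x / d" for x
  have h0: "0 \<le> h x" if "x \<in> I" for x using v(2)[OF that] d by (simp add: h_def)
  have h: "h \<in> L0 I" by (simp add: h_def[abs_def] L0_def)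
  \<comment> \<open>Finiteness of the integrand forces \<open>f = 0\<close> almost everywhere on
    \<open>v = 0\<close>, so \<open>f\<close> can be recovered from \<open>h * v\<close> there
    too.\<close>
  have "AE x in \<mu>. persp (f x) (v x) \<noteq> \<infinity>"
    using P by (intro nn_integral_PInf_AE mp) (auto simp: top_unique)
  then have fh: "AE x in \<mu>. \<bar>f x\<bar> = d * (h x * v x)"
    by eventually_elim (use d in \<open>auto simp: h_def split: if_splits\<close>)
  have hmod: "(\<integral>\<^sup>+ x. ennreal (\<phi> (h x) * v x) \<partial>\<mu>) \<le> 1"
  proof -
    have "(\<integral>\<^sup>+ x. ennreal (\<phi> (h x) * v x) \<partial>\<mu>) \<le> (\<integral>\<^sup>+ x. ennreal (1/d) * persp (f x) (v x) \<partial>\<mu>)"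
    proof (rule nn_integral_mono)
      fix x assume "x \<in> space \<mu>"
      then have x: "0 \<le> v x" using v(2) by simp
      show "ennreal (\<phi> (h x) * v x) \<le> ennreal (1/d) * persp (f x) (v x)"
      proof (cases "v x = 0")
        case False
        have "\<phi> ((1/d) * (\<bar>f x\<bar> / v x)) \<le> (1/d) * \<phi> (\<bar>f x\<bar> / v x)"
          using d x by (intro phi_scale) auto
        then have "\<phi> (h x) * v x \<le> (1/d) * \<phi> (\<bar>f x\<bar> / v x) * v x"
          using x by (intro mult_right_mono) (auto simp: h_def mult.commute)
        then have "ennreal (\<phi> (h x) * v x) \<le> ennreal ((1/d) * (\<phi> (\<bar>f x\<bar> / v x) * v x))"
          by (intro ennreal_leI) (simp add: mult.assoc)
        also have "\<dots> = ennreal (1/d) * persp (f x) (v x)" using False d by (subst ennreal_mult') auto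
        finally show ?thesis .
      qed simp
    qed
    also have "\<dots> = ennreal (1/d) * (\<integral>\<^sup>+ x. persp (f x) (v x) \<partial>\<mu>)" by (rule nn_integral_cmult[OF mp])
    also have "\<dots> \<le> ennreal (1/d) * ennreal d" by (intro mult_left_mono P) simp
    also have "\<dots> = 1" using d by (simp add: ennreal_mult'[symmetric])
    finally show ?thesis .
  qed
  have bound: "(\<integral>\<^sup>+ x. ennreal (\<bar>f x\<bar> * approx N g x) \<partial>\<mu>) \<le> ennreal d * nrm g" for N
  proof -
    obtain n A c where st: "steps a I w n A" and A: "\<And>i. i < n \<Longrightarrow> A i = {x \<in> I. approx N g x = c i}"
      and c: "\<And>i. i < n \<Longrightarrow> 0 < c i" "\<And>i j. i < j \<Longrightarrow> j < n \<Longrightarrow> c j < c i"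
      and ae: "AE x in \<mu>. approx N g x = 0 \<or> x \<in> (\<Union>i<n. A i)"
      by (rule simple_steps[OF approx_simple[OF g0, of N] approx_nonneg approx_support[OF g0, of N]]) (rule that)
    interpret steps a I w n A by (rule st)
    interpret orlicz_steps \<phi> a I w n A ..
    have eq: "step c x = approx N g x" if "x \<in> (\<Union>i<n. A i)" for x
      using that A step_A by force
    have "(\<integral>\<^sup>+ x. ennreal (\<bar>f x\<bar> * approx N g x) \<partial>\<mu>) = (\<integral>\<^sup>+ x. ennreal d * ennreal (h x * v x * step c x) \<partial>\<mu>)"
    proof (rule nn_integral_cong_AE, use fh ae in eventually_elim)
      case (elim x)
      have "approx N g x = step c x"
        using elim(2) eq[of x] step_0[of x c] by (cases "x \<in> (\<Union>i<n. A i)") auto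
      then show ?case using elim(1) d by (simp add: ennreal_mult'[symmetric] mult_ac)
    qed
    also have "\<dots> = ennreal d * (\<integral>\<^sup>+ x. ennreal (h x * v x * step c x) \<partial>\<mu>)"
      using h by (intro nn_integral_cmult) (simp add: L0_def)
    also have "\<dots> \<le> ennreal d * nrm g"
    proof (intro mult_left_mono transported_bound v h h0 hmod g)
      show "0 \<le> c i" if "i < n" for i using c(1)[OF that] by simp
      show "c j \<le> c i" if "i \<le> j" "j < n" for i j
        using c(2)[of i j] that by (cases "i = j") auto
      show "step c x \<le> \<bar>g x\<bar>" for x
        using eq[of x] step_0[of x c] approx_le[of N g x] by (cases "x \<in> (\<Union>i<n. A i)") auto
    qed auto
    finally show ?thesis .
  qed
  have "(\<integral>\<^sup>+ x. ennreal (\<bar>f x\<bar> * \<bar>g x\<bar>) \<partial>\<mu>) \<le> (\<integral>\<^sup>+ x. liminf (\<lambda>N. ennreal (\<bar>f x\<bar> * approx N g x)) \<partial>\<mu>)"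
  proof (rule nn_integral_mono)
    fix x
    have "(\<lambda>N. ennreal (\<bar>f x\<bar> * approx N g x)) \<longlonglongrightarrow> ennreal (\<bar>f x\<bar> * \<bar>g x\<bar>)"
      by (intro tendsto_intros approx_tendsto)
    from lim_imp_Liminf[OF _ this] show "ennreal (\<bar>f x\<bar> * \<bar>g x\<bar>) \<le> liminf (\<lambda>N. ennreal (\<bar>f x\<bar> * approx N g x))" by simp
  qed
  also have "\<dots> \<le> liminf (\<lambda>N. \<integral>\<^sup>+ x. ennreal (\<bar>f x\<bar> * approx N g x) \<partial>\<mu>)"
    by (rule nn_integral_liminf) measurable
  also have "\<dots> \<le> ennreal d * nrm g" using bound by (intro Liminf_le) auto
  finally show ?thesis .
qed

text \<open>The hypothesis bounds an infimum over \<open>v\<close>, so some \<open>v\<close> is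
  admissible for each \<open>d > 1\<close>; then \<open>d\<close> tends to 1.\<close>

lemma holder:
  assumes f: "f \<in> L0 I" and g: "g \<in> Lam" and P: "P_modular \<phi> w I f \<le> 1"
  shows "(\<integral>\<^sup>+ x. ennreal (\<bar>f x\<bar> * \<bar>g x\<bar>) \<partial>\<mu>) \<le> nrm g"
proof -
  obtain r where r: "nrm g = ennreal r" "0 \<le> r" using nrm_finite[OF g] by (cases "nrm g") auto
  have le: "(\<integral>\<^sup>+ x. ennreal (\<bar>f x\<bar> * \<bar>g x\<bar>) \<partial>\<mu>) \<le> ennreal d * nrm g" if d: "1 < d" for d
  proof -
    have "P_modular \<phi> w I f < ennreal d" using P d by (auto intro: le_less_trans simp: ennreal_1[symmetric] ennreal_less_iff simp del: ennreal_1)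
    then obtain v where "v \<in> L0 I" "\<forall>t\<in>I. 0 \<le> v t" "submajorized I v w" "(\<integral>\<^sup>+ x. persp (f x) (v x) \<partial>\<mu>) < ennreal d"
      unfolding P_modular_def by (auto simp: INF_less_iff)
    then show ?thesis using d by (intro holder_step_bound[OF f g, of v]) (auto simp: less_imp_le)
  qed
  show ?thesis
  proof (rule ennreal_le_epsilon)
    fix e :: real assume e: "0 < e"
    \<comment> \<open>With this \<open>d\<close> the excess is
      \<open>e * r / (r + 1) \<le> e\<close>; the summand 1 in the denominator covers
      \<open>r = 0\<close>.\<close>
    have "(\<integral>\<^sup>+ x. ennreal (\<bar>f x\<bar> * \<bar>g x\<bar>) \<partial>\<mu>) \<le> ennreal (1 + e / (r + 1)) * nrm g"
      using e r by (intro le) simp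
    also have "\<dots> = ennreal ((1 + e / (r + 1)) * r)" using e r by (simp add: ennreal_mult'[symmetric] del: ennreal_plus)
    also have "\<dots> \<le> ennreal (r + e)"
    proof (rule ennreal_leI)
      have "e * (r / (r + 1)) \<le> e * 1" using e r by (intro mult_left_mono) auto
      then show "(1 + e / (r + 1)) * r \<le> r + e" by (simp add: algebra_simps)
    qed
    finally show "(\<integral>\<^sup>+ x. ennreal (\<bar>f x\<bar> * \<bar>g x\<bar>) \<partial>\<mu>) \<le> nrm g + ennreal e" using e r by simp
  qed
qed

end

section \<open>Attaining the modular\<close>

text \<open>Diagonal extraction. The values lie in the compact order
  \<open>[0, \<infinity>]\<close>, so no bound on the sequence is required.\<close>

lemma convergent_subseq_on_countable:
  fixes P :: "nat \<Rightarrow> 'b \<Rightarrow> ennreal"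
  assumes "countable D"
  obtains r where "strict_mono r" "\<And>d. d \<in> D \<Longrightarrow> convergent (\<lambda>k. P (r k) d)"
proof (cases "D = {}")
  case False
  define e where "e = from_nat_into D"
  interpret subseqs "\<lambda>i s. convergent (\<lambda>k. P (s k) (e i))"
  proof
    fix i and s :: "nat \<Rightarrow> nat" assume "strict_mono s"
    show "\<exists>r'. strict_mono r' \<and> convergent (\<lambda>k. P ((s \<circ> r') k) (e i))"
      using compact_complete_linorder[of "\<lambda>k. P (s k) (e i)"] by (auto simp: o_def convergent_def)
  qed
  have "convergent (\<lambda>k. P (diagseq k) d)" if dD: "d \<in> D" for d
  proof -
    obtain i where i: "d = e i" using from_nat_into_surj[OF assms dD] by (auto simp: e_def)
    have "convergent (\<lambda>k. P ((diagseq \<circ> ((+) (Suc i))) k) (e i))"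
    proof (rule diagseq_holds)
      fix r s :: "nat \<Rightarrow> nat" and n
      assume r: "strict_mono r" and "convergent (\<lambda>k. P (s k) (e n))"
      then obtain l where "(\<lambda>k. P (s k) (e n)) \<longlonglongrightarrow> l" by (auto simp: convergent_def)
      from LIMSEQ_subseq_LIMSEQ[OF this r] show "convergent (\<lambda>k. P ((s \<circ> r) k) (e n))"
        by (auto simp: convergent_def o_def)
    qed
    then obtain l where "(\<lambda>k. P (diagseq (k + Suc i)) d) \<longlonglongrightarrow> l"
      by (auto simp: convergent_def i add.commute)
    from LIMSEQ_offset[OF this] show ?thesis by (auto simp: convergent_def)
  qed
  with subseq_diagseq that show thesis by blast
qed (use that[of id] in \<open>auto simp: strict_mono_def\<close>)

lemma Rats_dense_in_ennreal:
  fixes x y :: ennreal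
  assumes "x < y" obtains q where "q \<in> \<rat>" "x < ennreal q" "ennreal q < y"
proof -
  obtain z where z: "x < z" "z < y" using dense[OF assms] by blast
  then have "x \<noteq> top" "z \<noteq> top" using top.extremum_strict by auto
  then obtain b c where b: "x = ennreal b" "0 \<le> b" and c: "z = ennreal c" "0 \<le> c"
    by (cases x; cases z) auto
  then have "b < c" using z by (simp add: ennreal_less_iff)
  then obtain q where q: "q \<in> \<rat>" "b < q" "q < c" using Rats_dense_in_real by blast
  show thesis
    by (rule that[of q]) (use q b c z in \<open>auto simp: ennreal_less_iff intro: less_trans[OF _ z(2)]\<close>)
qed

text \<open>Convergence on the rationals gives convergence wherever the one-sided limits
  \<open>lo\<close> and \<open>hi\<close> leave no gap; the countably many remaining points take a
  second extraction. Convergence at every point matters, because the limit is composed with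
  \<open>|f|\<close>, which may map a set of positive measure to a single exceptional point.\<close>

lemma helly_selection:
  fixes P :: "nat \<Rightarrow> real \<Rightarrow> ennreal"
  assumes mono: "\<And>n. mono (P n)"
  obtains r \<Psi> where "strict_mono r" "\<And>s. (\<lambda>k. P (r k) s) \<longlonglongrightarrow> \<Psi> s"
proof -
  obtain r where r: "strict_mono r" "\<And>q. q \<in> \<rat> \<Longrightarrow> convergent (\<lambda>k. P (r k) q)"
    using convergent_subseq_on_countable[OF countable_rat, of P] by blast
  define L where "L q = lim (\<lambda>k. P (r k) q)" for q
  have L: "(\<lambda>k. P (r k) q) \<longlonglongrightarrow> L q" if "q \<in> \<rat>" for q
    using r(2)[OF that] by (simp add: L_def convergent_LIMSEQ_iff)
  define lo hi where "lo s = (SUP q\<in>{q \<in> \<rat>. q < s}. L q)" and "hi s = (INF q\<in>{q \<in> \<rat>. s < q}. L q)" for s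
  define D where "D = {s. lo s < hi s}"
  have conv: "convergent (\<lambda>k. P (r k) s)" if "s \<notin> D" for s
  proof -
    have "(\<lambda>k. P (r k) s) \<longlonglongrightarrow> lo s"
    proof (rule order_tendstoI)
      fix b assume "b < lo s"
      then obtain q where q: "q \<in> \<rat>" "q < s" "b < L q" by (auto simp: lo_def less_SUP_iff)
      from order_tendstoD(1)[OF L[OF q(1)] q(3)] show "\<forall>\<^sub>F k in sequentially. b < P (r k) s"
        by eventually_elim (use monoD[OF mono, of q s] q in \<open>auto intro: less_le_trans\<close>)
    next
      fix b assume "lo s < b"
      then have "hi s < b" using that by (auto simp: D_def not_less)
      then obtain q where q: "q \<in> \<rat>" "s < q" "L q < b" by (auto simp: hi_def INF_less_iff)
      from order_tendstoD(2)[OF L[OF q(1)] q(3)] show "\<forall>\<^sub>F k in sequentially. P (r k) s < b"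
        by eventually_elim (use monoD[OF mono, of s q] q in \<open>auto intro: le_less_trans\<close>)
    qed
    then show ?thesis by (auto simp: convergent_def)
  qed
  \<comment> \<open>A rational number is chosen in the gap above each exceptional point. The gaps
    are ordered like the points, so the choice is injective and \<open>D\<close> is
    countable.\<close>
  have "\<exists>t. \<forall>s\<in>D. t s \<in> \<rat> \<and> lo s < ennreal (t s) \<and> ennreal (t s) < hi s"
  proof (rule bchoice, rule ballI)
    fix s assume "s \<in> D"
    then have "lo s < hi s" by (simp add: D_def)
    then show "\<exists>q. q \<in> \<rat> \<and> lo s < ennreal q \<and> ennreal q < hi s"
      using Rats_dense_in_ennreal by blast
  qed
  then obtain t where t: "\<And>s. s \<in> D \<Longrightarrow> t s \<in> \<rat>" "\<And>s. s \<in> D \<Longrightarrow> lo s < ennreal (t s)" "\<And>s. s \<in> D \<Longrightarrow> ennreal (t s) < hi s"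
    by blast
  have tless: "ennreal (t s) < ennreal (t s')" if "s \<in> D" "s' \<in> D" "s < s'" for s s'
  proof -
    obtain q where q: "q \<in> \<rat>" "s < q" "q < s'" using Rats_dense_in_real \<open>s < s'\<close> by blast
    have "ennreal (t s) < hi s" by (rule t) fact
    also have "\<dots> \<le> L q" unfolding hi_def by (rule INF_lower) (use q in auto)
    also have "\<dots> \<le> lo s'" unfolding lo_def by (rule SUP_upper) (use q in auto)
    also have "\<dots> < ennreal (t s')" by (rule t) fact
    finally show ?thesis .
  qed
  have "inj_on t D"
  proof (rule inj_onI, rule ccontr)
    fix s s' assume s: "s \<in> D" "s' \<in> D" "t s = t s'" "s \<noteq> s'"
    then show False using tless[of s s'] tless[of s' s] by (cases s s' rule: linorder_cases) auto
  qed
  moreover have "countable (t ` D)" using t(1) by (intro countable_subset[OF _ countable_rat]) auto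
  ultimately have "countable D" using countable_image_inj_on by blast
  then obtain r' where r': "strict_mono r'" "\<And>d. d \<in> D \<Longrightarrow> convergent (\<lambda>k. P (r (r' k)) d)"
    using convergent_subseq_on_countable[of D "\<lambda>k. P (r k)"] by blast
  have all: "convergent (\<lambda>k. P ((r \<circ> r') k) s)" for s
  proof (cases "s \<in> D")
    case False
    then obtain l where "(\<lambda>k. P (r k) s) \<longlonglongrightarrow> l" using conv by (auto simp: convergent_def)
    from LIMSEQ_subseq_LIMSEQ[OF this r'(1)] show ?thesis by (auto simp: convergent_def o_def)
  qed (use r'(2) in \<open>simp add: o_def\<close>)
  show thesis
    by (rule that[of "r \<circ> r'" "\<lambda>s. lim (\<lambda>k. P ((r \<circ> r') k) s)"])
      (use all r(1) r'(1) in \<open>auto simp: convergent_LIMSEQ_iff intro!: strict_mono_o\<close>)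
qed

context orlicz
begin

text \<open>Continuity of \<open>\<phi>\<close> settles a positive limit of \<open>v\<close>. If
  \<open>v\<close> tends to 0 while \<open>y\<close> stays away from 0, the quotient blows up and
  superlinear growth drives the perspective to \<infinity>.\<close>

lemma persp_liminf:
  assumes y: "y \<longlonglongrightarrow> y0" and v: "v \<longlonglongrightarrow> v0" and y0: "\<And>k. 0 \<le> y k" and v0: "\<And>k. 0 \<le> v k"
  shows "persp y0 v0 \<le> liminf (\<lambda>k. persp (y k) (v k))"
proof -
  have pos: "0 \<le> y0" "0 \<le> v0" using y v y0 v0 by (auto intro: LIMSEQ_le_const)
  consider "0 < v0" | "v0 = 0" "y0 = 0" | "v0 = 0" "0 < y0" using pos by fastforce
  then show ?thesis
  proof cases
    case 1
    have "(\<lambda>k. \<phi> (\<bar>y k\<bar> / v k)) \<longlonglongrightarrow> \<phi> (\<bar>y0\<bar> / v0)"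
      using 1 v0 by (intro continuous_on_tendsto_compose[OF phi_continuous] tendsto_intros y v) auto
    then have "(\<lambda>k. ennreal (\<phi> (\<bar>y k\<bar> / v k) * v k)) \<longlonglongrightarrow> ennreal (\<phi> (\<bar>y0\<bar> / v0) * v0)"
      by (intro tendsto_intros v)
    moreover have "\<forall>\<^sub>F k in sequentially. 0 < v k" using v 1 by (rule order_tendstoD)
    then have "\<forall>\<^sub>F k in sequentially. ennreal (\<phi> (\<bar>y k\<bar> / v k) * v k) = persp (y k) (v k)"
      by eventually_elim simp
    ultimately have "(\<lambda>k. persp (y k) (v k)) \<longlonglongrightarrow> ennreal (\<phi> (\<bar>y0\<bar> / v0) * v0)"
      by (rule Lim_transform_eventually)
    from lim_imp_Liminf[OF _ this] show ?thesis using 1 by simp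
  next
    case 3
    have ge: "ennreal K \<le> liminf (\<lambda>k. persp (y k) (v k))" if K: "0 < K" for K
    proof (rule Liminf_bounded)
      \<comment> \<open>Eventually \<open>y k > y0 / 2\<close>, so slope \<open>M\<close> gives a
        value of at least \<open>M * (y0 / 2) = K\<close>; the bound on \<open>v k\<close> below
        puts \<open>y k / v k\<close> beyond \<open>S\<close>.\<close>
      define M where "M = 2 * K / y0"
      have M: "0 < M" using K 3 by (simp add: M_def)
      obtain S where S: "\<And>t. S \<le> t \<Longrightarrow> M * t \<le> \<phi> t"
        using phi_superlinear[of M] by (auto simp: eventually_at_top_linorder)
      have "\<forall>\<^sub>F k in sequentially. v k < y0 / 2 / max S 1"
        using 3 v by (intro order_tendstoD(2)[of v 0]) auto
      moreover have "\<forall>\<^sub>F k in sequentially. y0 / 2 < y k"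
        using 3 by (intro order_tendstoD(1)[OF y]) auto
      ultimately show "\<forall>\<^sub>F k in sequentially. ennreal K \<le> persp (y k) (v k)"
      proof eventually_elim
        case (elim k)
        show ?case
        proof (cases "v k = 0")
          case False
          then have vk: "0 < v k" using v0[of k] by simp
          have "v k * max S 1 < y0 / 2" using elim(1) by (simp add: less_divide_eq)
          also have "\<dots> < y k" by (rule elim(2))
          finally have "max S 1 \<le> y k / v k" using vk by (simp add: le_divide_eq mult.commute)
          then have "M * (y k / v k) \<le> \<phi> (y k / v k)" by (intro S) simp
          then have "M * (y k / v k) * v k \<le> \<phi> (y k / v k) * v k" using vk by (intro mult_right_mono) auto
          then have "M * y k \<le> \<phi> (y k / v k) * v k" using vk by simp
          moreover have "M * (y0 / 2) \<le> M * y k" using M elim(2) by (intro mult_left_mono) auto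
          moreover have "M * (y0 / 2) = K" using 3 by (simp add: M_def)
          ultimately show ?thesis using False y0[of k] by (simp add: ennreal_leI)
        qed (use elim 3 in auto)
      qed
    qed
    have "liminf (\<lambda>k. persp (y k) (v k)) = \<infinity>"
    proof (rule ccontr)
      assume "liminf (\<lambda>k. persp (y k) (v k)) \<noteq> \<infinity>"
      then obtain l where l: "0 \<le> l" "liminf (\<lambda>k. persp (y k) (v k)) = ennreal l"
        by (cases "liminf (\<lambda>k. persp (y k) (v k))") auto
      have "ennreal (l + 1) \<le> ennreal l" using ge[of "l + 1"] l by simp
      then show False using l(1) by (simp del: ennreal_plus)
    qed
    then show ?thesis by simp
  qed simp
qed

end

context orlicz_steps
begin

lemma rho_step_le:
  assumes c: "\<And>i. i < n \<Longrightarrow> 0 \<le> c i" "\<And>i j. i \<le> j \<Longrightarrow> j < n \<Longrightarrow> c j \<le> c i"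
  shows "\<rho> (step c) \<le> ennreal (\<Sum>i<n. \<psi> (c i) * \<omega> i)"
proof -
  note rearr_measurable_mu[OF step_L0, measurable]
  have "\<rho> (step c) = (\<integral>\<^sup>+ x\<in>{0<..<T n}. ennreal (\<psi> (enn2real (rearr I (step c) x)) * w x) \<partial>\<mu>)"
    unfolding \<rho>_def using rearr_step_0[of _ c] by (intro nn_integral_cong) (auto simp: indicator_def dest: I_pos)
  also have "\<dots> = (\<Sum>i<n. \<integral>\<^sup>+ x\<in>{T i..<T (Suc i)}. ennreal (\<psi> (enn2real (rearr I (step c) x)) * w x) \<partial>\<mu>)"
    by (intro nn_integral_initial_T) auto
  also have "\<dots> \<le> (\<Sum>i<n. ennreal (\<psi> (c i) * \<omega> i))"
  proof (intro sum_mono)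
    fix i assume "i \<in> {..<n}"
    then have i: "i < n" by simp
    have "(\<integral>\<^sup>+ x\<in>{T i..<T (Suc i)}. ennreal (\<psi> (enn2real (rearr I (step c) x)) * w x) \<partial>\<mu>)
      \<le> (\<integral>\<^sup>+ x. ennreal (\<psi> (c i)) * (ennreal (w x) * indicator {T i..<T (Suc i)} x) \<partial>\<mu>)"
    proof (rule nn_integral_mono)
      fix x assume "x \<in> space \<mu>"
      then have x: "0 \<le> w x" using w_pos by (simp add: less_imp_le)
      show "ennreal (\<psi> (enn2real (rearr I (step c) x)) * w x) * indicator {T i..<T (Suc i)} x
         \<le> ennreal (\<psi> (c i)) * (ennreal (w x) * indicator {T i..<T (Suc i)} x)"
      proof (cases "x \<in> {T i..<T (Suc i)}")
        case True
        have "enn2real (rearr I (step c) x) \<le> c i"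
          using True by (intro enn2real_leI rearr_step_le c i) auto
        then have "\<psi> (enn2real (rearr I (step c) x)) * w x \<le> \<psi> (c i) * w x"
          using x by (intro mult_right_mono monoD[OF psi_mono]) auto
        then show ?thesis using True c(1)[OF i] x by (simp add: ennreal_mult'[symmetric] ennreal_leI)
      qed simp
    qed
    also have "\<dots> = ennreal (\<psi> (c i) * \<omega> i)"
      using c(1)[OF i] omega_integral[OF i] by (simp add: nn_integral_cmult ennreal_mult')
    finally show "(\<integral>\<^sup>+ x\<in>{T i..<T (Suc i)}. ennreal (\<psi> (enn2real (rearr I (step c) x)) * w x) \<partial>\<mu>) \<le> ennreal (\<psi> (c i) * \<omega> i)" .
  qed
  also have "\<dots> = ennreal (\<Sum>i<n. \<psi> (c i) * \<omega> i)"
    using c(1) omega_pos by (intro sum_ennreal) (auto simp: less_imp_le)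
  finally show ?thesis .
qed

lemma rearr_step_finite:
  assumes c: "\<And>i. i < n \<Longrightarrow> 0 \<le> c i" "\<And>i j. i \<le> j \<Longrightarrow> j < n \<Longrightarrow> c j \<le> c i" and x: "x \<in> I"
  shows "rearr I (step c) x < \<infinity>"
proof (cases "n = 0")
  case True
  then show ?thesis using rearr_step_0[of x c] I_pos[OF x] by simp
next
  case False
  then have "rearr I (step c) x \<le> ennreal (c 0)"
    using I_pos[OF x] by (intro rearr_step_le c) auto
  then show ?thesis by (simp add: order.strict_trans1)
qed

lemma step_simple: "simple_function \<mu> (step c)"
proof (rule simple_function_borel_measurable[OF step_measurable])
  have "step c x \<in> insert 0 (c ` {..<n})" for x by (rule step_cases[of x]) auto
  then have "step c ` space \<mu> \<subseteq> insert 0 (c ` {..<n})" by blast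
  then show "finite (step c ` space \<mu>)" by (rule finite_subset) simp
qed

lemma step_support: "emeasure \<mu> {x \<in> I. step c x \<noteq> 0} < \<infinity>"
proof -
  have "emeasure \<mu> {x \<in> I. step c x \<noteq> 0} \<le> emeasure \<mu> (\<Union>i<n. A i)"
    using step_0 by (intro emeasure_mono UN_sets) auto
  then show ?thesis by (simp add: emeasure_UN order.strict_trans1)
qed

end

section \<open>Optimal weights for step functions and their Helly limit\<close>

context orlicz
begin

definition "simple_fin = {g. simple_function \<mu> g \<and> (\<forall>x\<in>I. 0 \<le> g x) \<and> emeasure \<mu> {x \<in> I. g x \<noteq> (0::real)} < \<infinity>}"

lemma simple_fin_L0: "g \<in> simple_fin \<Longrightarrow> g \<in> L0 I"
  by (auto simp: simple_fin_def L0_def borel_measurable_simple_function)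

lemma simple_fin_cases:
  assumes "g \<in> simple_fin"
  obtains n A c where "steps a I w n A" "\<And>i. i < n \<Longrightarrow> A i = {x \<in> I. g x = c i}"
    "\<And>i. i < n \<Longrightarrow> 0 < c i" "\<And>i j. i < j \<Longrightarrow> j < n \<Longrightarrow> c j < c i"
    "AE x in \<mu>. g x = 0 \<or> x \<in> (\<Union>i<n. A i)" "AE x in \<mu>. g x = steps.step n A c x"
proof -
  obtain n A c where st: "steps a I w n A" and A: "\<And>i. i < n \<Longrightarrow> A i = {x \<in> I. g x = c i}"
    and c: "\<And>i. i < n \<Longrightarrow> 0 < c i" "\<And>i j. i < j \<Longrightarrow> j < n \<Longrightarrow> c j < c i"
    and ae: "AE x in \<mu>. g x = 0 \<or> x \<in> (\<Union>i<n. A i)"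
    using assms unfolding simple_fin_def by (auto intro: simple_steps[of g])
  interpret steps a I w n A by (rule st)
  have "AE x in \<mu>. g x = step c x"
    using ae
  proof eventually_elim
    case (elim x)
    then show ?case using step_A[of _ x c] step_0[of x c] A by (cases "x \<in> (\<Union>i<n. A i)") auto
  qed
  with st A c ae show thesis by (rule that)
qed

lemma simple_fin_Lam:
  assumes "g \<in> simple_fin" shows "g \<in> Lam" "\<rho> g < \<infinity>"
proof -
  have g0: "g \<in> L0 I" by (rule simple_fin_L0[OF assms])
  obtain n A c where st: "steps a I w n A" and c: "\<And>i. i < n \<Longrightarrow> 0 < c i" "\<And>i j. i < j \<Longrightarrow> j < n \<Longrightarrow> c j < c i"
    and ae: "AE x in \<mu>. g x = steps.step n A c x"
    by (rule simple_fin_cases[OF assms]) (rule that)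
  interpret steps a I w n A by (rule st)
  interpret orlicz_steps \<phi> a I w n A ..
  have c': "0 \<le> c i" if "i < n" for i using c(1)[OF that] by simp
  have c'': "c j \<le> c i" if "i \<le> j" "j < n" for i j using c(2)[of i j] that by (cases "i = j") auto
  have eq: "rearr I g = rearr I (step c)" by (rule rearr_cong_AE[OF g0 step_L0 ae])
  then have "\<rho> g = \<rho> (step c)" by (simp add: \<rho>_def)
  also have "\<dots> < \<infinity>" using rho_step_le[of c, OF c' c''] by (simp add: order.strict_trans1)
  finally show fin: "\<rho> g < \<infinity>" .
  show "g \<in> Lam" unfolding Lam_iff
    using g0 eq rearr_step_finite[of c, OF c' c''] fin by (auto intro!: exI[of _ 1])
qed

text \<open>The weight is delivered as a monotone function \<open>P\<close> of \<open>|f|\<close> on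
  the whole line, cut off at \<open>N\<close>, because this is the form in which Helly's theorem
  applies to the sequence in \<open>N\<close>.\<close>

lemma approx_modular_bound:
  assumes f: "f \<in> L0 I"
    and bound: "\<And>g. g \<in> simple_fin \<Longrightarrow> (\<integral>\<^sup>+ x. ennreal (\<bar>f x\<bar> * g x) \<partial>\<mu>) \<le> 1 + \<rho> g"
  shows "\<exists>P. mono P \<and> (\<forall>s. 0 \<le> P s) \<and>
    submajorized I (\<lambda>x. P \<bar>f x\<bar> * indicator {..<real N} x) w \<and>
    (\<integral>\<^sup>+ x. persp (approx N f x) (P \<bar>f x\<bar> * indicator {..<real N} x) \<partial>\<mu>) \<le> 1"
proof -
  have [measurable]: "f \<in> borel_measurable \<mu>" using f by (simp add: L0_def)
  note approx_measurable[OF f, measurable]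
  have "approx N f \<in> simple_fin"
    unfolding simple_fin_def using approx_simple[OF f] approx_support[OF f] approx_nonneg by simp
  then obtain n A c where st: "steps a I w n A" and A: "\<And>i. i < n \<Longrightarrow> A i = {x \<in> I. approx N f x = c i}"
    and c: "\<And>i. i < n \<Longrightarrow> 0 < c i" "\<And>i j. i < j \<Longrightarrow> j < n \<Longrightarrow> c j < c i"
    and ae: "AE x in \<mu>. approx N f x = 0 \<or> x \<in> (\<Union>i<n. A i)"
    and aes: "AE x in \<mu>. approx N f x = steps.step n A c x"
    by (rule simple_fin_cases) (rule that)
  interpret steps a I w n A by (rule st)
  interpret orlicz_steps \<phi> a I w n A ..
  have c': "c j \<le> c i" if "i \<le> j" "j < n" for i j using c(2)[of i j] that by (cases "i = j") auto
  define F where "F i = c i * m i" for i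
  have Fm: "F i / m i = c i" if "i < n" for i using m_pos[OF that] by (simp add: F_def)
  have F0: "0 < F i" if "i < n" for i using c(1)[OF that] m_pos[OF that] by (simp add: F_def)
  have Fmono: "F j / m j \<le> F i / m i" if "i \<le> j" "j < n" for i j
    using c'[OF that] that by (simp add: Fm)
  obtain h where "majorant_slopes n F \<omega> m h"
    using majorant_slopes_exist[of n F \<omega> m, OF F0 omega_pos m_pos Fmono omega_avg_antimono] by blast
  note h = majorant_slopesD[OF this]
  note h0 = h(1) and hmono = h(2)
  \<comment> \<open>Equal to \<open>c i / h i\<close>, so on \<open>A i\<close> the quotient of the
    approximation and the weight is the slope \<open>h i\<close>.\<close>
  define v where "v i = F i / h i / m i" for i
  have vmono: "v j \<le> v i" if "i \<le> j" "j < n" for i j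
    using h(5)[OF that] by (simp add: v_def)
  have vm: "v i * m i = F i / h i" if "i < n" for i using m_pos[OF that] by (simp add: v_def)
  have v0: "0 < v i" if "i < n" for i using F0[OF that] h0[OF that] m_pos[OF that] by (simp add: v_def)
  have cv: "c i / v i = h i" if "i < n" for i
    using c(1)[OF that] h0[OF that] m_pos[OF that] by (simp add: v_def F_def field_simps)

  \<comment> \<open>One subgradient is chosen for each point, not for each index: equal slopes then
    get equal values of \<open>p\<close>, and \<open>\<psi> (g i)\<close> is a function of
    \<open>h i\<close>, as clause (4) of \<open>majorant_slopesD\<close> requires.\<close>
  have "\<exists>p. \<forall>x\<in>{0<..}. 0 \<le> p x \<and> (\<forall>y\<ge>0. \<phi> x + p x * (y - x) \<le> \<phi> y)"
  proof (rule bchoice, rule ballI)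
    fix x :: real assume "x \<in> {0<..}"
    then have "0 < x" by simp
    then obtain p where "0 \<le> p" "\<And>y. 0 \<le> y \<Longrightarrow> \<phi> x + p * (y - x) \<le> \<phi> y"
      by (rule phi_subgradient) (rule that)
    then show "\<exists>p. 0 \<le> p \<and> (\<forall>y\<ge>0. \<phi> x + p * (y - x) \<le> \<phi> y)" by (intro exI[of _ p]) simp
  qed
  then obtain p where pp: "\<forall>x\<in>{0<..}. 0 \<le> p x \<and> (\<forall>y\<ge>0. \<phi> x + p x * (y - x) \<le> \<phi> y)" ..
  have p: "0 \<le> p x" "0 \<le> y \<Longrightarrow> \<phi> x + p x * (y - x) \<le> \<phi> y" if "0 < x" for x y
    using bspec[OF pp, of x] that by simp_all
  have pmono: "p x \<le> p y" if "0 < x" "x \<le> y" for x y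
  proof (cases "x = y")
    case False
    have "\<phi> x + p x * (y - x) \<le> \<phi> y" "\<phi> y + p y * (x - y) \<le> \<phi> x" using p(2) that by auto
    then have "p x * (y - x) \<le> p y * (y - x)" by (simp add: algebra_simps)
    then show ?thesis using False that by simp
  qed simp
  define g where "g i = p (h i)" for i
  have g0: "0 \<le> g i" if "i < n" for i using p(1) h0[OF that] by (simp add: g_def)
  have gmono: "g j \<le> g i" if "i \<le> j" "j < n" for i j
    using pmono hmono[OF that] h0 that by (simp add: g_def)
  have psig: "\<psi> (g i) = h i * g i - \<phi> (h i)" if "i < n" for i
    unfolding g_def by (rule psi_subgradient_eq[OF h0[OF that]]) (rule p(2)[OF h0[OF that]])

  \<comment> \<open>Test the bound with \<open>step g\<close>. Clause (4) replaces
    \<open>\<omega>\<close> by \<open>F / h\<close>, and equality in Young's inequality turns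
    \<open>\<psi> (g i) * (F i / h i)\<close> into
    \<open>c i * g i * m i - \<phi> (h i) * (F i / h i)\<close>. The terms
    \<open>c i * g i * m i\<close> cancel against the left side and leave the constant 1.\<close>
  have dual: "(\<Sum>i<n. \<phi> (h i) * (F i / h i)) \<le> 1"
  proof -
    have "ennreal (\<Sum>i<n. (c i * g i) * m i) = (\<integral>\<^sup>+ x. ennreal (approx N f x * step g x) \<partial>\<mu>)"
    proof (rule nn_integral_piecewise[symmetric])
      show "ennreal (approx N f x * step g x) = ennreal (c i * g i)" if "i < n" "x \<in> A i" for i x
        using that A step_A by auto
      show "AE x in \<mu>. x \<in> (\<Union>i<n. A i) \<or> ennreal (approx N f x * step g x) = 0"
      proof (rule AE_I2)
        fix x show "x \<in> (\<Union>i<n. A i) \<or> ennreal (approx N f x * step g x) = 0"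
          using step_0[of x g] by (cases "x \<in> (\<Union>i<n. A i)") simp_all
      qed
      show "0 \<le> c i * g i" if "i < n" for i using c(1)[OF that] g0[OF that] by simp
    qed measurable
    also have "\<dots> \<le> (\<integral>\<^sup>+ x. ennreal (\<bar>f x\<bar> * step g x) \<partial>\<mu>)"
      using step_nonneg[of g, OF g0] by (intro nn_integral_mono ennreal_leI mult_right_mono approx_le) auto
    also have "\<dots> \<le> 1 + \<rho> (step g)"
      using step_simple step_support step_nonneg[of g, OF g0] by (intro bound) (auto simp: simple_fin_def)
    also have "\<dots> \<le> 1 + ennreal (\<Sum>i<n. \<psi> (g i) * \<omega> i)"
      by (intro add_left_mono rho_step_le g0 gmono)
    also have "(\<Sum>i<n. \<psi> (g i) * \<omega> i) = (\<Sum>i<n. \<psi> (g i) * (F i / h i))"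
      using h(4)[of "\<lambda>y. \<psi> (p y)"] by (simp add: g_def)
    also have "\<dots> = (\<Sum>i<n. c i * g i * m i - \<phi> (h i) * (F i / h i))"
    proof (intro sum.cong refl)
      fix i assume "i \<in> {..<n}"
      then have i: "i < n" by simp
      have "\<psi> (g i) * (F i / h i) = g i * F i - \<phi> (h i) * (F i / h i)"
        using h0[OF i] by (simp add: psig[OF i] field_simps)
      then show "\<psi> (g i) * (F i / h i) = c i * g i * m i - \<phi> (h i) * (F i / h i)"
        by (simp add: F_def mult_ac)
    qed
    finally have le: "ennreal (\<Sum>i<n. c i * g i * m i) \<le> 1 + ennreal (\<Sum>i<n. c i * g i * m i - \<phi> (h i) * (F i / h i))" .
    \<comment> \<open>Needed to cancel in the reals: \<open>ennreal\<close> would cut off a negative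
      sum.\<close>
    have nonneg: "0 \<le> (\<Sum>i<n. c i * g i * m i - \<phi> (h i) * (F i / h i))"
    proof (rule sum_nonneg)
      fix i assume "i \<in> {..<n}"
      then have i: "i < n" by simp
      have "0 \<le> \<psi> (g i) * (F i / h i)" using g0[OF i] F0[OF i] h0[OF i] by simp
      also have "\<dots> = c i * g i * m i - \<phi> (h i) * (F i / h i)"
        using h0[OF i] by (simp add: psig[OF i] F_def field_simps)
      finally show "0 \<le> c i * g i * m i - \<phi> (h i) * (F i / h i)" .
    qed
    from le have "ennreal (\<Sum>i<n. c i * g i * m i) \<le> ennreal (1 + (\<Sum>i<n. c i * g i * m i - \<phi> (h i) * (F i / h i)))"
      using nonneg by simp
    then have "(\<Sum>i<n. c i * g i * m i) \<le> 1 + (\<Sum>i<n. c i * g i * m i - \<phi> (h i) * (F i / h i))"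
      using nonneg by (subst (asm) ennreal_le_iff) auto
    then show ?thesis by (simp add: sum_subtractf)
  qed

  \<comment> \<open>Both \<open>c\<close> and \<open>v\<close> decrease in the index, so at
    \<open>trunc N s = c i\<close> the maximum is attained at \<open>i\<close>. Lowering the
    threshold only removes candidates, hence monotonicity; the inserted 0 is the value when no step
    qualifies.\<close>
  define P where "P s = Max (insert 0 (v ` {i. i < n \<and> c i \<le> trunc N s}))" for s
  have Pmono: "mono P"
    unfolding P_def by (intro monoI Max_mono) (auto dest: monoD[OF trunc_mono] intro: order_trans)
  have P0: "0 \<le> P s" for s unfolding P_def by (intro Max_ge) auto
  define V where "V x = P \<bar>f x\<bar> * indicator {..<real N} x" for x
  have VA: "V x = v i" if i: "i < n" "x \<in> A i" for i x
  proof -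
    have ap: "approx N f x = c i" using A i by simp
    then have x: "x < real N" "trunc N \<bar>f x\<bar> = c i" using c(1)[OF i(1)] by (cases "x < real N"; simp add: approx_def)+
    have "P \<bar>f x\<bar> = v i"
      unfolding P_def
    proof (rule Max_eqI)
      fix y assume "y \<in> insert 0 (v ` {j. j < n \<and> c j \<le> trunc N \<bar>f x\<bar>})"
      then consider "y = 0" | j where "y = v j" "j < n" "c j \<le> c i" by (auto simp: x)
      then show "y \<le> v i"
      proof cases
        case 2
        then have "i \<le> j" using c(2)[of j i] i by (meson not_le)
        then show ?thesis using vmono[of i j] 2 by simp
      qed (use v0[OF i(1)] in simp)
    qed (use i x in auto)
    then show ?thesis using x by (simp add: V_def)
  qed
  have V0: "V x = 0" if "approx N f x = 0" for x
  proof (cases "x < real N")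
    case True
    then have "trunc N \<bar>f x\<bar> = 0" using that by (simp add: approx_def)
    then have none: "{i. i < n \<and> c i \<le> trunc N \<bar>f x\<bar>} = {}" using c(1) by (auto simp: not_le)
    show ?thesis unfolding V_def P_def none by simp
  qed (simp add: V_def)
  have [measurable]: "V \<in> borel_measurable \<mu>"
  proof -
    have [measurable]: "P \<in> borel_measurable borel" by (rule borel_measurable_mono[OF Pmono])
    have [measurable]: "(\<lambda>x. indicator {..<real N} x :: real) \<in> borel_measurable \<mu>" by (rule borel_mu) simp
    show ?thesis unfolding V_def[abs_def] by measurable
  qed
  have Vstep: "AE x in \<mu>. V x = step v x"
    using ae
  proof eventually_elim
    case (elim x)
    then show ?case using VA[of _ x] step_A[of _ x v] step_0[of x v] V0[of x] by (cases "x \<in> (\<Union>i<n. A i)") auto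
  qed
  have "submajorized I (step v) w"
  proof (rule submajorized_step)
    show "(\<Sum>i<j. v i * m i) \<le> W (T j)" if "j \<le> n" for j
      using h(3)[OF that] that by (simp add: vm omega_sum)
  qed (use v0 vmono in \<open>auto intro: less_imp_le\<close>)
  moreover have "rearr I V = rearr I (step v)"
    by (intro rearr_cong_AE step_L0 Vstep) (simp add: L0_def)
  ultimately have sub: "submajorized I V w" by (simp add: submajorized_def)
  have "(\<integral>\<^sup>+ x. persp (approx N f x) (V x) \<partial>\<mu>) = ennreal (\<Sum>i<n. (\<phi> (h i) * v i) * m i)"
  proof (rule nn_integral_piecewise)
    show "(\<lambda>x. persp (approx N f x) (V x)) \<in> borel_measurable \<mu>"
      by (rule persp_measurable) (measurable, simp add: V_def P0)
    show "persp (approx N f x) (V x) = ennreal (\<phi> (h i) * v i)" if "i < n" "x \<in> A i" for i x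
      using that A[OF that(1)] VA[OF that] v0[OF that(1)] cv[OF that(1)] c(1)[OF that(1)] by auto
    show "0 \<le> \<phi> (h i) * v i" if "i < n" for i using h0[OF that] v0[OF that] by simp
    show "AE x in \<mu>. x \<in> (\<Union>i<n. A i) \<or> persp (approx N f x) (V x) = 0"
      using ae by eventually_elim auto
  qed
  also have "(\<Sum>i<n. (\<phi> (h i) * v i) * m i) = (\<Sum>i<n. \<phi> (h i) * (F i / h i))"
    by (intro sum.cong) (auto simp: vm mult.assoc)
  also have "ennreal \<dots> \<le> 1" using dual by (simp add: ennreal_le_1)
  finally show ?thesis using Pmono P0 sub unfolding V_def[abs_def] by blast
qed

text \<open>The limit weight is the Helly limit composed with \<open>|f|\<close>. Fatou's lemma is
  used three times: for its finiteness, for its submajorization through \<open>rearr_liminf\<close>,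
  and for the modular through \<open>persp_liminf\<close>.\<close>

lemma P_modular_le_1:
  assumes f: "f \<in> L0 I"
    and bound: "\<And>g. g \<in> simple_fin \<Longrightarrow> (\<integral>\<^sup>+ x. ennreal (\<bar>f x\<bar> * g x) \<partial>\<mu>) \<le> 1 + \<rho> g"
  shows "P_modular \<phi> w I f \<le> 1"
proof -
  have [measurable]: "f \<in> borel_measurable \<mu>" using f by (simp add: L0_def)
  note approx_measurable[OF f, measurable]
  have "\<exists>P. \<forall>N. mono (P N) \<and> (\<forall>s. 0 \<le> P N s) \<and>
    submajorized I (\<lambda>x. P N \<bar>f x\<bar> * indicator {..<real N} x) w \<and>
    (\<integral>\<^sup>+ x. persp (approx N f x) (P N \<bar>f x\<bar> * indicator {..<real N} x) \<partial>\<mu>) \<le> 1"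
    by (intro choice allI approx_modular_bound f bound)
  then obtain P where Pmono: "\<And>N. mono (P N)" and P0: "\<And>N s. 0 \<le> P N s"
    and Psub: "\<And>N. submajorized I (\<lambda>x. P N \<bar>f x\<bar> * indicator {..<real N} x) w"
    and Pint: "\<And>N. (\<integral>\<^sup>+ x. persp (approx N f x) (P N \<bar>f x\<bar> * indicator {..<real N} x) \<partial>\<mu>) \<le> 1"
    by blast
  obtain r \<Psi> where r: "strict_mono r" and lim: "\<And>s. (\<lambda>k. ennreal (P (r k) s)) \<longlonglongrightarrow> \<Psi> s"
  proof (rule helly_selection[of "\<lambda>N s. ennreal (P N s)"])
    show "mono (\<lambda>s. ennreal (P N s))" for N using Pmono[of N] by (auto simp: mono_def intro: ennreal_leI)
  qed (rule that)
  define V where "V k x = P (r k) \<bar>f x\<bar> * indicator {..<real (r k)} x" for k x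
  have V0: "0 \<le> V k x" for k x by (simp add: V_def P0)
  have Vsub: "submajorized I (V k) w" for k using Psub[of "r k"] by (simp add: V_def[abs_def])
  have V_meas [measurable]: "V k \<in> borel_measurable \<mu>" for k
  proof -
    have [measurable]: "P (r k) \<in> borel_measurable borel" by (rule borel_measurable_mono[OF Pmono])
    have [measurable]: "(\<lambda>x. indicator {..<real (r k)} x :: real) \<in> borel_measurable \<mu>" by (rule borel_mu) simp
    show ?thesis unfolding V_def[abs_def] by measurable
  qed
  have VL0: "V k \<in> L0 I" for k by (simp add: L0_def)
  \<comment> \<open>The cut-off disappears in the limit, since at a fixed \<open>x\<close> it is
    inactive as soon as \<open>r k > x\<close>.\<close>
  have Vlim: "(\<lambda>k. ennreal (V k x)) \<longlonglongrightarrow> \<Psi> \<bar>f x\<bar>" for x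
  proof (rule Lim_transform_eventually[OF lim])
    obtain K where K: "x < real K" using reals_Archimedean2 by blast
    have "\<forall>\<^sub>F k in sequentially. K \<le> k" by (rule eventually_ge_at_top)
    then show "\<forall>\<^sub>F k in sequentially. ennreal (P (r k) \<bar>f x\<bar>) = ennreal (V k x)"
    proof eventually_elim
      case (elim k)
      have "K \<le> r k" using elim seq_suble[OF r, of k] by simp
      then have "x < real (r k)" using K by linarith
      then show ?case by (simp add: V_def)
    qed
  qed
  have Psi_eq: "\<Psi> \<bar>f x\<bar> = liminf (\<lambda>k. ennreal (V k x))" for x
    using lim_imp_Liminf[OF _ Vlim] by simp
  \<comment> \<open>Helly's theorem works in \<open>[0, \<infinity>]\<close>, so infinite limits
    must be excluded: every \<open>V k\<close> has mass at most \<open>W t\<close> on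
    \<open>(0, t)\<close>, and by Fatou so does the limit.\<close>
  have fin: "AE x in \<mu>. \<Psi> \<bar>f x\<bar> < \<infinity>"
  proof -
    obtain t where t: "\<And>n. t n \<in> I" "incseq t" "\<And>x. x \<in> I \<Longrightarrow> \<exists>n. x < t n" using I_exhaust by blast
    have "AE x in \<mu>. \<forall>n. (\<Psi> \<bar>f x\<bar> * indicator {0<..<t n} x) \<noteq> \<infinity>"
    proof (rule AE_all_countable[THEN iffD2], rule allI)
      fix n
      have sub: "{0<..<t n} \<subseteq> I" by (rule ioo_sub[OF I_le[OF t(1)]])
      have em: "emeasure \<mu> {0<..<t n} = ennreal (t n)" using sub I_pos[OF t(1)[of n]] by (simp add: emeasure_mu)
      have "(\<integral>\<^sup>+ x. \<Psi> \<bar>f x\<bar> * indicator {0<..<t n} x \<partial>\<mu>) = (\<integral>\<^sup>+ x. liminf (\<lambda>k. ennreal (V k x) * indicator {0<..<t n} x) \<partial>\<mu>)"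
        by (intro nn_integral_cong) (auto simp: indicator_def Psi_eq Liminf_const)
      also have "\<dots> \<le> liminf (\<lambda>k. \<integral>\<^sup>+ x. ennreal (V k x) * indicator {0<..<t n} x \<partial>\<mu>)"
        by (rule nn_integral_liminf) measurable
      also have "\<dots> \<le> ennreal (W (t n))"
      proof (intro Liminf_le always_eventually allI)
        fix k
        have "(\<integral>\<^sup>+ x. ennreal (V k x) * indicator {0<..<t n} x \<partial>\<mu>) \<le> (\<integral>\<^sup>+ x. ennreal (w x) * indicator {x. ennreal x < emeasure \<mu> {0<..<t n}} x \<partial>\<mu>)"
          using sub by (intro submajorized_integral_le VL0 V0 Vsub) (auto simp: sets_mu)
        also have "\<dots> = (\<integral>\<^sup>+ x\<in>{0<..<t n}. ennreal (w x) \<partial>\<mu>)"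
          unfolding em by (intro nn_integral_cong) (auto simp: indicator_def ennreal_less_iff dest: I_pos)
        also have "\<dots> = ennreal (W (t n))" by (rule W_initial[OF I_le[OF t(1)]])
        finally show "(\<integral>\<^sup>+ x. ennreal (V k x) * indicator {0<..<t n} x \<partial>\<mu>) \<le> ennreal (W (t n))" .
      qed simp
      finally have "(\<integral>\<^sup>+ x. \<Psi> \<bar>f x\<bar> * indicator {0<..<t n} x \<partial>\<mu>) \<noteq> \<infinity>" by (auto simp: top_unique)
      then show "AE x in \<mu>. \<Psi> \<bar>f x\<bar> * indicator {0<..<t n} x \<noteq> \<infinity>"
        by (intro nn_integral_PInf_AE) (auto simp: Psi_eq)
    qed
    then show ?thesis
    proof (rule AE_mp, intro AE_I2 impI)
      fix x assume x: "x \<in> space \<mu>" "\<forall>n. \<Psi> \<bar>f x\<bar> * indicator {0<..<t n} x \<noteq> \<infinity>"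
      then obtain n where "x < t n" using t(3) by auto
      with x(2)[rule_format, of n] I_pos[of x] x(1) show "\<Psi> \<bar>f x\<bar> < \<infinity>"
        by (simp add: less_top)
    qed
  qed
  define v where "v x = enn2real (\<Psi> \<bar>f x\<bar>)" for x
  have v_meas [measurable]: "v \<in> borel_measurable \<mu>"
    unfolding v_def[abs_def] Psi_eq by measurable
  have vL0: "v \<in> L0 I" by (simp add: L0_def)
  have v_lim: "AE x in \<mu>. (\<lambda>k. V k x) \<longlonglongrightarrow> v x"
    using fin
  proof eventually_elim
    case (elim x)
    then have "(\<lambda>k. ennreal (V k x)) \<longlonglongrightarrow> ennreal (v x)" using Vlim[of x] by (simp add: v_def)
    then show ?case using V0 by (subst (asm) tendsto_ennreal_iff) (auto simp: v_def)
  qed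
  have sub: "submajorized I v w"
  proof (rule submajorizedI)
    fix t assume t: "t \<in> I"
    note rearr_measurable_mu[OF VL0, measurable]
    have "(\<integral>\<^sup>+ s\<in>{0<..<t}. rearr I v s \<partial>\<mu>) \<le> (\<integral>\<^sup>+ s. liminf (\<lambda>k. rearr I (V k) s * indicator {0<..<t} s) \<partial>\<mu>)"
      using rearr_liminf[OF vL0 VL0 v_lim] by (intro nn_integral_mono) (auto simp: indicator_def)
    also have "\<dots> \<le> liminf (\<lambda>k. \<integral>\<^sup>+ s\<in>{0<..<t}. rearr I (V k) s \<partial>\<mu>)"
      by (rule nn_integral_liminf) measurable
    also have "\<dots> \<le> (\<integral>\<^sup>+ s\<in>{0<..<t}. ennreal (w s) \<partial>\<mu>)"
      using submajorizedD[OF Vsub t] by (intro Liminf_le) auto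
    finally show "(\<integral>\<^sup>+ s\<in>{0<..<t}. rearr I v s \<partial>\<mu>) \<le> (\<integral>\<^sup>+ s\<in>{0<..<t}. ennreal (w s) \<partial>\<mu>)" .
  qed
  have "(\<integral>\<^sup>+ x. persp (f x) (v x) \<partial>\<mu>) \<le> (\<integral>\<^sup>+ x. liminf (\<lambda>k. persp (approx (r k) f x) (V k x)) \<partial>\<mu>)"
  proof (rule nn_integral_mono_AE, use v_lim in eventually_elim)
    case (elim x)
    have "(\<lambda>k. approx (r k) f x) \<longlonglongrightarrow> \<bar>f x\<bar>"
      using LIMSEQ_subseq_LIMSEQ[OF approx_tendsto r] by (simp add: o_def)
    from persp_liminf[OF this elim approx_nonneg V0]
    have "persp \<bar>f x\<bar> (v x) \<le> liminf (\<lambda>k. persp (approx (r k) f x) (V k x))" .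
    moreover have "persp \<bar>f x\<bar> (v x) = persp (f x) (v x)" by simp
    ultimately show ?case by (simp only:)
  qed
  also have "\<dots> \<le> liminf (\<lambda>k. \<integral>\<^sup>+ x. persp (approx (r k) f x) (V k x) \<partial>\<mu>)"
    by (rule nn_integral_liminf, rule persp_measurable) (measurable, simp add: V0)
  also have "\<dots> \<le> 1"
    using Pint unfolding V_def by (intro Liminf_le always_eventually allI) auto
  finally have le: "(\<integral>\<^sup>+ x. persp (f x) (v x) \<partial>\<mu>) \<le> 1" .
  show ?thesis
    unfolding P_modular_def
  proof (rule INF_lower2[of v])
    show "v \<in> {v \<in> L0 I. (\<forall>t\<in>I. 0 \<le> v t) \<and> submajorized I v w}"
      using vL0 sub by (simp add: v_def)
  qed (rule le)
qed

end

section \<open>The Koethe dual\<close>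

context orlicz
begin

text \<open>The weight takes on \<open>A i\<close> the mean of \<open>w\<close> over the interval
  that carries the \<open>i\<close>-th step of the rearrangement. With
  \<open>weighted_le_rho\<close> this exhibits \<open>\<rho>\<close> as a maximum of functionals
  \<open>\<integral> v \<psi>(g)\<close>.\<close>

lemma rho_le_weighted:
  assumes g: "g \<in> simple_fin"
  obtains v where "v \<in> L0 I" "\<And>x. x \<in> I \<Longrightarrow> 0 \<le> v x" "submajorized I v w"
    "\<rho> g \<le> (\<integral>\<^sup>+ x. ennreal (v x) * ennreal (\<psi> (g x)) \<partial>\<mu>)"
proof -
  have g0: "g \<in> L0 I" by (rule simple_fin_L0[OF g])
  then have [measurable]: "g \<in> borel_measurable \<mu>" by (simp add: L0_def)
  obtain n A c where st: "steps a I w n A" and A: "\<And>i. i < n \<Longrightarrow> A i = {x \<in> I. g x = c i}"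
    and c: "\<And>i. i < n \<Longrightarrow> 0 < c i" "\<And>i j. i < j \<Longrightarrow> j < n \<Longrightarrow> c j < c i"
    and ae: "AE x in \<mu>. g x = 0 \<or> x \<in> (\<Union>i<n. A i)"
    and aes: "AE x in \<mu>. g x = steps.step n A c x"
    by (rule simple_fin_cases[OF g]) (rule that)
  interpret steps a I w n A by (rule st)
  interpret orlicz_steps \<phi> a I w n A ..
  have c': "0 \<le> c i" if "i < n" for i using c(1)[OF that] by simp
  have c'': "c j \<le> c i" if "i \<le> j" "j < n" for i j using c(2)[of i j] that by (cases "i = j") auto
  define b where "b i = \<omega> i / m i" for i
  have b0: "0 \<le> b i" if "i < n" for i using omega_pos[OF that] m_pos[OF that] by (simp add: b_def)
  have bm: "b i * m i = \<omega> i" if "i < n" for i using m_pos[OF that] by (simp add: b_def)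
  have sub: "submajorized I (step b) w"
  proof (rule submajorized_step[OF b0])
    show "b j \<le> b i" if "i \<le> j" "j < n" for i j
      using omega_avg_antimono[OF that] by (simp add: b_def)
    show "(\<Sum>i<j. b i * m i) \<le> W (T j)" if "j \<le> n" for j
      using that by (simp add: bm omega_sum)
  qed
  have "\<rho> g = \<rho> (step c)" using rearr_cong_AE[OF g0 step_L0 aes] by (simp add: \<rho>_def)
  also have "\<dots> \<le> ennreal (\<Sum>i<n. \<psi> (c i) * \<omega> i)" by (rule rho_step_le[of c, OF c' c''])
  also have "(\<Sum>i<n. \<psi> (c i) * \<omega> i) = (\<Sum>i<n. (b i * \<psi> (c i)) * m i)"
    by (intro sum.cong) (simp_all add: bm[symmetric])
  also have "ennreal \<dots> = (\<integral>\<^sup>+ x. ennreal (step b x) * ennreal (\<psi> (g x)) \<partial>\<mu>)"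
  proof (rule nn_integral_piecewise[symmetric])
    show "ennreal (step b x) * ennreal (\<psi> (g x)) = ennreal (b i * \<psi> (c i))" if "i < n" "x \<in> A i" for i x
    proof -
      have "g x = c i" using that A by simp
      then show ?thesis using that step_A[OF that, of b] b0[OF that(1)] by (simp add: ennreal_mult')
    qed
    show "0 \<le> b i * \<psi> (c i)" if "i < n" for i using b0[OF that] c'[OF that] by simp
    show "AE x in \<mu>. x \<in> (\<Union>i<n. A i) \<or> ennreal (step b x) * ennreal (\<psi> (g x)) = 0"
      using ae by eventually_elim auto
  qed measurable
  finally show thesis
    using step_L0 step_nonneg[of b, OF b0] sub by (intro that[of "step b"]) auto
qed

text \<open>Hardy-Littlewood for \<open>\<psi>(u)\<close>; by monotonicity of \<open>\<psi>\<close>,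
  its rearrangement is at most \<open>\<psi>\<close> of the rearrangement of
  \<open>u\<close>.\<close>

lemma weighted_le_rho:
  assumes v: "v \<in> L0 I" "\<And>x. x \<in> I \<Longrightarrow> 0 \<le> v x" "submajorized I v w"
    and u: "u \<in> simple_fin"
  shows "(\<integral>\<^sup>+ x. ennreal (v x) * ennreal (\<psi> (u x)) \<partial>\<mu>) \<le> \<rho> u"
proof -
  have u0: "u \<in> L0 I" by (rule simple_fin_L0[OF u])
  have upos: "0 \<le> u x" if "x \<in> I" for x using u that by (simp add: simple_fin_def)
  have [measurable]: "u \<in> borel_measurable \<mu>" using u0 by (simp add: L0_def)
  have pu: "(\<lambda>x. \<psi> (u x)) \<in> L0 I" by (simp add: L0_def)
  have le: "rearr I (\<lambda>x. \<psi> (u x)) t \<le> ennreal (\<psi> (enn2real (rearr I u t)))" if t: "t \<in> I" for t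
  proof (rule rearr_le)
    define s where "s = enn2real (rearr I u t)"
    have s: "0 \<le> s" "rearr I u t = ennreal s"
      using simple_fin_Lam(1)[OF u] t by (auto simp: s_def Lam_iff)
    have "{x \<in> I. \<psi> s < \<bar>\<psi> (u x)\<bar>} \<subseteq> {x \<in> I. s < \<bar>u x\<bar>}"
    proof safe
      fix x assume x: "x \<in> I" "\<psi> s < \<bar>\<psi> (u x)\<bar>"
      show "s < \<bar>u x\<bar>"
      proof (rule ccontr)
        assume "\<not> s < \<bar>u x\<bar>"
        then have "\<psi> (u x) \<le> \<psi> s" by (intro monoD[OF psi_mono]) simp
        then show False using x upos[OF x(1)] by simp
      qed
    qed
    then have "distrib_fun I (\<lambda>x. \<psi> (u x)) (\<psi> s) \<le> distrib_fun I u s"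
      unfolding distrib_mu by (intro emeasure_mono L0_sets u0)
    also have "\<dots> \<le> ennreal t" using rearr_le_iff[OF u0 s(1), of t] s(2) by simp
    finally show "distrib_fun I (\<lambda>x. \<psi> (u x)) (\<psi> (enn2real (rearr I u t))) \<le> ennreal t"
      by (simp add: s_def)
  qed simp
  have "(\<integral>\<^sup>+ x. ennreal (v x) * ennreal (\<psi> (u x)) \<partial>\<mu>) \<le> (\<integral>\<^sup>+ x. ennreal (w x) * rearr I (\<lambda>x. \<psi> (u x)) x \<partial>\<mu>)"
    by (intro hardy_littlewood v pu psi_nonneg upos)
  also have "\<dots> \<le> (\<integral>\<^sup>+ x. ennreal (w x) * ennreal (\<psi> (enn2real (rearr I u x))) \<partial>\<mu>)"
    using le by (intro nn_integral_mono mult_left_mono) auto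
  also have "\<dots> = \<rho> u"
    unfolding \<rho>_def by (intro nn_integral_cong) (simp add: ennreal_mult'' mult.commute)
  finally show ?thesis .
qed

lemma simple_fin_scale:
  assumes "u \<in> simple_fin" "0 \<le> c" shows "(\<lambda>x. c * u x) \<in> simple_fin"
proof -
  have "{x \<in> I. u x \<noteq> 0} = {x \<in> I. 0 < \<bar>u x\<bar>}" by auto
  then have "{x \<in> I. u x \<noteq> 0} \<in> sets \<mu>" using L0_sets[OF simple_fin_L0[OF assms(1)], of 0] by simp
  then have "emeasure \<mu> {x \<in> I. c * u x \<noteq> 0} \<le> emeasure \<mu> {x \<in> I. u x \<noteq> 0}"
    by (intro emeasure_mono) auto
  then show ?thesis using assms by (auto simp: simple_fin_def order.strict_trans1)
qed

lemma simple_fin_sum: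
  fixes N :: nat
  assumes "\<And>i. i < N \<Longrightarrow> u i \<in> simple_fin" shows "(\<lambda>x. \<Sum>i<N. u i x) \<in> simple_fin"
  using assms
proof (induction N)
  case (Suc N)
  let ?S = "\<lambda>x. \<Sum>i<N. u i x"
  have S: "?S \<in> simple_fin" and uN: "u N \<in> simple_fin" using Suc by auto
  have meas: "{x \<in> I. g x \<noteq> 0} \<in> sets \<mu>" if "g \<in> simple_fin" for g
  proof -
    have "{x \<in> I. g x \<noteq> 0} = {x \<in> I. 0 < \<bar>g x\<bar>}" by auto
    then show ?thesis using L0_sets[OF simple_fin_L0[OF that], of 0] by simp
  qed
  have "emeasure \<mu> {x \<in> I. ?S x + u N x \<noteq> 0} \<le> emeasure \<mu> ({x \<in> I. ?S x \<noteq> 0} \<union> {x \<in> I. u N x \<noteq> 0})"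
    by (intro emeasure_mono sets.Un meas S uN) auto
  also have "\<dots> \<le> emeasure \<mu> {x \<in> I. ?S x \<noteq> 0} + emeasure \<mu> {x \<in> I. u N x \<noteq> 0}"
    by (intro emeasure_subadditive meas S uN)
  also have "\<dots> < \<infinity>" using S uN by (simp add: simple_fin_def)
  finally show ?case using S uN by (auto simp: simple_fin_def)
qed (simp add: simple_fin_def)

lemma rho_scale_le:
  assumes u: "u \<in> L0 I" and "0 < c" "c \<le> 1" shows "\<rho> (\<lambda>x. c * u x) \<le> ennreal c * \<rho> u"
proof -
  note rearr_measurable_mu[OF u, measurable]
  have "\<rho> (\<lambda>x. c * u x) = (\<integral>\<^sup>+ x. ennreal (\<psi> (c * enn2real (rearr I u x)) * w x) \<partial>\<mu>)"
    using assms by (simp add: \<rho>_def rearr_scale enn2real_mult)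
  also have "\<dots> \<le> (\<integral>\<^sup>+ x. ennreal c * ennreal (\<psi> (enn2real (rearr I u x)) * w x) \<partial>\<mu>)"
  proof (rule nn_integral_mono)
    fix x assume "x \<in> space \<mu>"
    then have "0 \<le> w x" using w_pos by (simp add: less_imp_le)
    then have "\<psi> (c * enn2real (rearr I u x)) * w x \<le> c * \<psi> (enn2real (rearr I u x)) * w x"
      using assms by (intro mult_right_mono psi_scale) auto
    then show "ennreal (\<psi> (c * enn2real (rearr I u x)) * w x) \<le> ennreal c * ennreal (\<psi> (enn2real (rearr I u x)) * w x)"
      using assms by (simp add: ennreal_mult'[symmetric] ennreal_leI mult.assoc)
  qed
  also have "\<dots> = ennreal c * \<rho> u"
    unfolding \<rho>_def by (rule nn_integral_cmult) measurable
  finally show ?thesis .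
qed

lemma geometric_sum_le: "(\<Sum>i<N. (1/2) ^ Suc i) \<le> (1::real)"
proof -
  have "(\<Sum>i<N. (1/2::real) ^ Suc i) = 1 - (1/2) ^ N" by (induction N) auto
  then show ?thesis by simp
qed

text \<open>The weight \<open>v\<close> attaining \<open>\<rho>\<close> at a partial sum does not exceed \<open>\<rho>\<close> at each summand, so
  \<open>\<rho>\<close> inherits convexity from \<open>\<psi>\<close>.\<close>
lemma rho_geometric_sum_le:
  assumes u: "\<And>i. u i \<in> simple_fin" "\<And>i. \<rho> (u i) \<le> 1"
  shows "\<rho> (\<lambda>x. \<Sum>i<N. (1/2) ^ Suc i * u i x) \<le> 1"
proof -
  let ?S = "\<lambda>x. \<Sum>i<N. (1/2) ^ Suc i * u i x"
  have S: "?S \<in> simple_fin" by (intro simple_fin_sum simple_fin_scale u) simp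
  obtain v where v: "v \<in> L0 I" "\<And>x. x \<in> I \<Longrightarrow> 0 \<le> v x" "submajorized I v w"
    "\<rho> ?S \<le> (\<integral>\<^sup>+ x. ennreal (v x) * ennreal (\<psi> (?S x)) \<partial>\<mu>)"
    by (rule rho_le_weighted[OF S]) (rule that)
  have [measurable]: "v \<in> borel_measurable \<mu>" "u i \<in> borel_measurable \<mu>" for i
    using v(1) simple_fin_L0[OF u(1)] by (auto simp: L0_def)
  have "\<rho> ?S \<le> (\<integral>\<^sup>+ x. ennreal (v x) * ennreal (\<psi> (?S x)) \<partial>\<mu>)" by (rule v)
  also have "\<dots> \<le> (\<integral>\<^sup>+ x. (\<Sum>i<N. ennreal ((1/2) ^ Suc i) * (ennreal (v x) * ennreal (\<psi> (u i x)))) \<partial>\<mu>)"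
  proof (rule nn_integral_mono)
    fix x assume "x \<in> space \<mu>"
    then have x: "0 \<le> v x" "0 \<le> u i x" for i using v(2) u(1)[of i] by (auto simp: simple_fin_def)
    have "\<psi> (?S x) \<le> (\<Sum>i<N. (1/2) ^ Suc i * \<psi> (u i x))"
      by (rule convex_on_subconvex_sum[OF psi_convex]) (use geometric_sum_le[of N] in auto)
    then have "v x * \<psi> (?S x) \<le> v x * (\<Sum>i<N. (1/2) ^ Suc i * \<psi> (u i x))"
      using x by (intro mult_left_mono)
    also have "\<dots> = (\<Sum>i<N. (1/2) ^ Suc i * (v x * \<psi> (u i x)))"
      by (simp add: sum_distrib_left mult_ac)
    finally have "ennreal (v x * \<psi> (?S x)) \<le> ennreal (\<Sum>i<N. (1/2) ^ Suc i * (v x * \<psi> (u i x)))"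
      by (rule ennreal_leI)
    also have "\<dots> = (\<Sum>i<N. ennreal ((1/2) ^ Suc i * (v x * \<psi> (u i x))))"
      using x by (intro sum_ennreal[symmetric]) auto
    also have "\<dots> = (\<Sum>i<N. ennreal ((1/2) ^ Suc i) * (ennreal (v x) * ennreal (\<psi> (u i x))))"
      using x by (intro sum.cong refl) (simp add: ennreal_mult' del: power_Suc)
    finally show "ennreal (v x) * ennreal (\<psi> (?S x)) \<le> (\<Sum>i<N. ennreal ((1/2) ^ Suc i) * (ennreal (v x) * ennreal (\<psi> (u i x))))"
      using x by (simp add: ennreal_mult')
  qed
  also have "\<dots> = (\<Sum>i<N. ennreal ((1/2) ^ Suc i) * (\<integral>\<^sup>+ x. ennreal (v x) * ennreal (\<psi> (u i x)) \<partial>\<mu>))"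
    by (subst nn_integral_sum) (auto intro!: sum.cong nn_integral_cmult)
  also have "\<dots> \<le> (\<Sum>i<N. ennreal ((1/2) ^ Suc i) * 1)"
    by (intro sum_mono mult_left_mono order_trans[OF weighted_le_rho[OF v(1-3) u(1)] u(2)]) auto
  also have "\<dots> = ennreal (\<Sum>i<N. (1/2) ^ Suc i)" by (simp add: sum_ennreal del: power_Suc)
  also have "\<dots> \<le> 1" using geometric_sum_le[of N] by (simp add: ennreal_le_1 del: power_Suc)
  finally show ?thesis .
qed

text \<open>On \<open>(0, t)\<close> the rearrangement is at least its value \<open>y\<close> at
  \<open>t\<close>, so \<open>\<psi>(y) * W t \<le> 1\<close>; Young's inequality against
  \<open>s = 1\<close> recovers \<open>y\<close>. The bound is uniform in \<open>g\<close>, which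
  keeps limits of partial sums finite.\<close>

lemma rearr_bound:
  assumes g: "g \<in> Lam" "\<rho> g \<le> 1" and t: "t \<in> I"
  shows "rearr I g t \<le> ennreal (\<phi> 1 + 1 / W t)"
proof -
  define y where "y = enn2real (rearr I g t)"
  have y: "0 \<le> y" "rearr I g t = ennreal y" using g(1) t by (auto simp: y_def Lam_iff)
  have Wt: "0 < W t" using W_strict[of 0 t] I_pos[OF t] I_le[OF t] by simp
  have "ennreal (\<psi> y * W t) = ennreal (\<psi> y) * (\<integral>\<^sup>+ x\<in>{0<..<t}. ennreal (w x) \<partial>\<mu>)"
    using y by (simp add: W_initial I_le t ennreal_mult')
  also have "\<dots> = (\<integral>\<^sup>+ x. ennreal (\<psi> y) * (ennreal (w x) * indicator {0<..<t} x) \<partial>\<mu>)"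
    by (intro nn_integral_cmult[symmetric]) measurable
  also have "\<dots> \<le> \<rho> g"
    unfolding \<rho>_def
  proof (rule nn_integral_mono)
    fix x assume "x \<in> space \<mu>"
    then have x: "x \<in> I" by simp
    show "ennreal (\<psi> y) * (ennreal (w x) * indicator {0<..<t} x) \<le> ennreal (\<psi> (enn2real (rearr I g x)) * w x)"
    proof (cases "x \<in> {0<..<t}")
      case True
      have "y \<le> enn2real (rearr I g x)"
        unfolding y_def using rearr_antimono[of x t g] True g(1) x by (intro enn2real_mono) (auto simp: Lam_iff)
      then have "\<psi> y * w x \<le> \<psi> (enn2real (rearr I g x)) * w x"
        using w_pos[OF x] by (intro mult_right_mono monoD[OF psi_mono]) auto
      then show ?thesis using True y by (simp add: ennreal_mult'[symmetric] ennreal_leI)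
    qed simp
  qed
  also have "\<dots> \<le> 1" by (rule g)
  finally have "\<psi> y * W t \<le> 1" by (simp add: ennreal_le_1)
  then have "\<psi> y \<le> 1 / W t" using Wt by (simp add: le_divide_eq)
  moreover have "y \<le> \<phi> 1 + \<psi> y" using young[of 1 y] y by simp
  ultimately show ?thesis using y by (simp add: ennreal_leI)
qed

text \<open>A substitute for completeness. The partial sums all have \<open>\<rho> \<le> 1\<close>;
  the uniform bound on rearrangements makes their limit finite almost everywhere, and Fatou's lemma
  gives it \<open>\<rho> \<le> 1\<close>. The termwise bounds hold almost everywhere, as
  \<open>G\<close> is 0 where the sum diverges.\<close>

lemma geometric_sum_in_Lam:
  assumes u: "\<And>i. u i \<in> simple_fin" "\<And>i. \<rho> (u i) \<le> 1"
  obtains G where "G \<in> Lam" "\<And>x. 0 \<le> G x" "\<And>i. AE x in \<mu>. (1/2) ^ Suc i * u i x \<le> G x"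
proof -
  define S where "S N x = (\<Sum>i<N. (1/2) ^ Suc i * u i x)" for N x
  have upos: "0 \<le> u i x" if "x \<in> I" for i x using u(1)[of i] that by (simp add: simple_fin_def)
  have S: "S N \<in> simple_fin" for N unfolding S_def[abs_def] by (intro simple_fin_sum simple_fin_scale u) simp
  have S1: "\<rho> (S N) \<le> 1" for N unfolding S_def[abs_def] by (rule rho_geometric_sum_le[OF u])
  have SL0: "S N \<in> L0 I" for N by (rule simple_fin_L0[OF S])
  have [measurable]: "S N \<in> borel_measurable \<mu>" for N using SL0 by (simp add: L0_def)
  have S0: "0 \<le> S N x" if "x \<in> I" for N x
    unfolding S_def using upos[OF that] by (intro sum_nonneg) auto
  have Smono: "S N x \<le> S M x" if "x \<in> I" "N \<le> M" for N M x
    unfolding S_def using that upos by (intro sum_mono2) auto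
  have Sterm: "(1/2) ^ Suc i * u i x \<le> S (Suc i) x" if "x \<in> I" for i x
    using S0[OF that, of i] by (simp add: S_def)
  define K where "K t = \<phi> 1 + 1 / W t" for t
  have K0: "0 \<le> K t" for t using W_nonneg[of t] by (simp add: K_def)
  have SK: "rearr I (S N) t \<le> ennreal (K t)" if "t \<in> I" for N t
    unfolding K_def by (rule rearr_bound[OF simple_fin_Lam(1)[OF S] S1 that])
  define Ge where "Ge x = (SUP N. ennreal (S N x))" for x
  have [measurable]: "Ge \<in> borel_measurable \<mu>" unfolding Ge_def[abs_def] by measurable
  have Slim: "(\<lambda>N. ennreal (S N x)) \<longlonglongrightarrow> Ge x" if "x \<in> I" for x
    unfolding Ge_def by (rule LIMSEQ_SUP) (auto simp: incseq_def intro!: ennreal_leI Smono that)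
  have fin: "AE x in \<mu>. Ge x < \<infinity>"
  proof -
    define Z where "Z = {x \<in> I. Ge x = \<infinity>}"
    have Z: "Z \<in> sets \<mu>"
    proof -
      have "{x \<in> space \<mu>. Ge x = \<infinity>} \<in> sets \<mu>" by measurable
      then show ?thesis by (simp add: Z_def)
    qed
    \<comment> \<open>Where the sum diverges, some partial sum exceeds the level \<open>K t\<close>.
      The sets where this happens increase with \<open>N\<close> and have measure at most
      \<open>t\<close>; letting \<open>t\<close> tend to 0 makes \<open>Z\<close> a null
      set.\<close>
    have Zle: "emeasure \<mu> Z \<le> ennreal t" if t: "t \<in> I" for t
    proof -
      have "Z \<subseteq> (\<Union>N. {x \<in> I. K t < \<bar>S N x\<bar>})"
      proof
        fix x assume x: "x \<in> Z"
        then have "ennreal (K t) < Ge x" by (simp add: Z_def less_top)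
        then obtain N where "ennreal (K t) < ennreal (S N x)" by (auto simp: Ge_def less_SUP_iff)
        then have "K t < \<bar>S N x\<bar>" using K0[of t] by (auto simp: ennreal_less_iff)
        then show "x \<in> (\<Union>N. {x \<in> I. K t < \<bar>S N x\<bar>})" using x by (auto simp: Z_def)
      qed
      then have "emeasure \<mu> Z \<le> emeasure \<mu> (\<Union>N. {x \<in> I. K t < \<bar>S N x\<bar>})"
        using L0_sets[OF SL0] by (intro emeasure_mono) auto
      also have "\<dots> = (SUP N. emeasure \<mu> {x \<in> I. K t < \<bar>S N x\<bar>})"
      proof (rule SUP_emeasure_incseq[symmetric])
        show "incseq (\<lambda>N. {x \<in> I. K t < \<bar>S N x\<bar>})"
        proof (rule incseq_SucI, safe)
          fix N x assume x: "x \<in> I" "K t < \<bar>S N x\<bar>"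
          show "K t < \<bar>S (Suc N) x\<bar>" using x Smono[OF x(1), of N "Suc N"] S0[OF x(1), of N] by simp
        qed
      qed (use L0_sets[OF SL0] in auto)
      also have "\<dots> \<le> ennreal t"
        using SK[OF t] rearr_le_iff[OF SL0 K0] by (intro SUP_least) (auto simp: distrib_mu)
      finally show ?thesis .
    qed
    have "emeasure \<mu> Z = 0"
    proof (rule ccontr)
      assume "emeasure \<mu> Z \<noteq> 0"
      obtain r :: "nat \<Rightarrow> real" where r: "\<And>n. r n \<in> I" by (rule I_exhaust) (rule that)
      define t where "t = r 0"
      have t: "t \<in> I" unfolding t_def by (rule r)
      have fin: "emeasure \<mu> Z < \<infinity>" using Zle[OF t] by (simp add: order.strict_trans1)
      then obtain z where z: "emeasure \<mu> Z = ennreal z" "0 < z"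
        using \<open>emeasure \<mu> Z \<noteq> 0\<close> by (cases "emeasure \<mu> Z") auto
      have "min t (z/2) \<in> I" using I_pos[OF t] z by (intro I_down[OF t]) auto
      from Zle[OF this] z have "z \<le> min t (z/2)" using I_pos[OF t] by simp
      with z show False by simp
    qed
    then have "Z \<in> null_sets \<mu>" using Z by auto
    from AE_not_in[OF this] show ?thesis
      by (rule AE_mp) (auto intro!: AE_I2 simp: Z_def less_top)
  qed
  define G where "G x = enn2real (Ge x)" for x
  have [measurable]: "G \<in> borel_measurable \<mu>" unfolding G_def[abs_def] by measurable
  have GL0: "G \<in> L0 I" by (simp add: L0_def)
  have SG: "AE x in \<mu>. (\<lambda>N. S N x) \<longlonglongrightarrow> G x"
    using fin AE_space
  proof eventually_elim
    case (elim x)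
    then have x: "x \<in> I" by simp
    have "(\<lambda>N. ennreal (S N x)) \<longlonglongrightarrow> ennreal (G x)" using Slim[OF x] elim by (simp add: G_def)
    then show ?case using S0[OF x] by (subst (asm) tendsto_ennreal_iff) (auto simp: G_def)
  qed
  have Gge: "AE x in \<mu>. (1/2) ^ Suc i * u i x \<le> G x" for i
    using fin AE_space
  proof eventually_elim
    case (elim x)
    then have x: "x \<in> I" by simp
    have "ennreal (S (Suc i) x) \<le> Ge x" unfolding Ge_def by (rule SUP_upper) simp
    also have "\<dots> = ennreal (G x)" using elim by (simp add: G_def)
    finally have "S (Suc i) x \<le> G x" by (simp add: G_def)
    with Sterm[OF x, of i] show ?case by simp
  qed
  define R where "R t = (SUP N. rearr I (S N) t)" for t
  have Rlim: "(\<lambda>N. rearr I (S N) t) \<longlonglongrightarrow> R t" for t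
    unfolding R_def
  proof (rule LIMSEQ_SUP, rule incseq_SucI)
    fix N show "rearr I (S N) t \<le> rearr I (S (Suc N)) t"
      by (rule rearr_mono[OF SL0]) (use S0 Smono[of _ N "Suc N"] in auto)
  qed
  have RK: "R t \<le> ennreal (K t)" if "t \<in> I" for t
    unfolding R_def using SK[OF that] by (intro SUP_least) auto
  have GR: "rearr I G t \<le> R t" for t
  proof -
    have "rearr I G t \<le> liminf (\<lambda>N. rearr I (S N) t)" by (rule rearr_liminf[OF GL0 SL0 SG])
    also have "\<dots> = R t" by (rule lim_imp_Liminf[OF _ Rlim]) simp
    finally show ?thesis .
  qed
  note rearr_measurable_mu[OF SL0, measurable]
  have "\<rho> G \<le> (\<integral>\<^sup>+ x. liminf (\<lambda>N. ennreal (\<psi> (enn2real (rearr I (S N) x)) * w x)) \<partial>\<mu>)"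
    unfolding \<rho>_def
  proof (rule nn_integral_mono)
    fix x assume "x \<in> space \<mu>"
    then have x: "x \<in> I" by simp
    have Rfin: "R x < \<infinity>" using RK[OF x] by (simp add: order.strict_trans1)
    have "(\<lambda>N. enn2real (rearr I (S N) x)) \<longlonglongrightarrow> enn2real (R x)"
    proof -
      have "ennreal (enn2real (rearr I (S N) x)) = rearr I (S N) x" for N
        using SK[OF x, of N] by (simp add: order.strict_trans1)
      then have "(\<lambda>N. ennreal (enn2real (rearr I (S N) x))) \<longlonglongrightarrow> ennreal (enn2real (R x))"
        using Rlim[of x] Rfin by simp
      then show ?thesis by (subst (asm) tendsto_ennreal_iff) auto
    qed
    then have "(\<lambda>N. \<psi> (enn2real (rearr I (S N) x))) \<longlonglongrightarrow> \<psi> (enn2real (R x))"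
      by (rule continuous_on_tendsto_compose[OF psi_continuous]) auto
    then have "(\<lambda>N. ennreal (\<psi> (enn2real (rearr I (S N) x)) * w x)) \<longlonglongrightarrow> ennreal (\<psi> (enn2real (R x)) * w x)"
      by (intro tendsto_intros)
    then have "liminf (\<lambda>N. ennreal (\<psi> (enn2real (rearr I (S N) x)) * w x)) = ennreal (\<psi> (enn2real (R x)) * w x)"
      by (rule lim_imp_Liminf[rotated]) simp
    moreover have "\<psi> (enn2real (rearr I G x)) * w x \<le> \<psi> (enn2real (R x)) * w x"
      using GR[of x] Rfin w_pos[OF x] by (intro mult_right_mono monoD[OF psi_mono] enn2real_mono) auto
    ultimately show "ennreal (\<psi> (enn2real (rearr I G x)) * w x) \<le> liminf (\<lambda>N. ennreal (\<psi> (enn2real (rearr I (S N) x)) * w x))"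
      by (simp add: ennreal_leI)
  qed
  also have "\<dots> \<le> liminf (\<lambda>N. \<rho> (S N))"
    unfolding \<rho>_def by (rule nn_integral_liminf) measurable
  also have "\<dots> \<le> 1" using S1 by (intro Liminf_le) auto
  finally have G1: "\<rho> G \<le> 1" .
  show thesis
  proof (rule that[OF _ _ Gge])
    have "\<rho> (\<lambda>x. 1 * G x) < \<infinity>" using G1 by (simp add: order.strict_trans1)
    moreover have "rearr I G t < \<infinity>" if "t \<in> I" for t
      using order_trans[OF GR RK[OF that]] by (simp add: order.strict_trans1)
    ultimately show "G \<in> Lam" unfolding Lam_iff using GL0 zero_less_one by blast
  qed (simp add: G_def)
qed

lemma M_norm_leI:
  assumes "0 < e" "P_modular \<phi> w I (\<lambda>t. f t / e) \<le> 1" shows "M_norm \<phi> w I f \<le> ennreal e"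
  unfolding M_norm_def luxemburg_def by (rule INF_lower) (use assms in auto)

lemma L0_divide: "f \<in> L0 I \<Longrightarrow> (\<lambda>t. f t / e) \<in> L0 I"
  by (simp add: L0_def)

lemma nn_integral_divide:
  assumes "f \<in> L0 I" "g \<in> L0 I" "0 < e"
  shows "(\<integral>\<^sup>+ x. ennreal (\<bar>f x\<bar> * \<bar>g x\<bar>) \<partial>\<mu>) = ennreal e * (\<integral>\<^sup>+ x. ennreal (\<bar>f x / e\<bar> * \<bar>g x\<bar>) \<partial>\<mu>)"
proof -
  have [measurable]: "f \<in> borel_measurable \<mu>" "g \<in> borel_measurable \<mu>" using assms by (auto simp: L0_def)
  show ?thesis using assms(3)
    by (subst nn_integral_cmult[symmetric]) (auto simp: ennreal_mult'[symmetric] abs_divide)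
qed

lemma M_space_bound:
  assumes f: "f \<in> L0 I" and g: "g \<in> Lam" and e: "0 < e" "P_modular \<phi> w I (\<lambda>t. f t / e) \<le> 1"
  shows "(\<integral>\<^sup>+ x. ennreal (\<bar>f x\<bar> * \<bar>g x\<bar>) \<partial>\<mu>) \<le> ennreal e * nrm g"
proof -
  have g0: "g \<in> L0 I" using g by (simp add: Lam_iff)
  show ?thesis unfolding nn_integral_divide[OF f g0 e(1)]
    by (intro mult_left_mono holder[OF L0_divide[OF f] g e(2)]) simp
qed

lemma M_space_subset_kothe: "M_space \<phi> w I \<subseteq> kothe_dual I Lam"
proof
  fix f assume f: "f \<in> M_space \<phi> w I"
  then have f0: "f \<in> L0 I" and "M_norm \<phi> w I f < \<infinity>" by (auto simp: M_space_def)
  then obtain e where e: "0 < e" "P_modular \<phi> w I (\<lambda>t. f t / e) \<le> 1"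
    by (auto simp: M_norm_def luxemburg_def INF_less_iff)
  have "integrable \<mu> (\<lambda>t. f t * g t)" if g: "g \<in> Lam" for g
  proof (rule integrableI_bounded)
    have "g \<in> L0 I" using g by (simp add: Lam_iff)
    then show "(\<lambda>t. f t * g t) \<in> borel_measurable \<mu>" using f0 by (simp add: L0_def)
    have "(\<integral>\<^sup>+ x. ennreal (norm (f x * g x)) \<partial>\<mu>) \<le> ennreal e * nrm g"
      using M_space_bound[OF f0 g e] by (simp add: abs_mult)
    also have "\<dots> < \<infinity>" using nrm_finite[OF g] by (simp add: ennreal_mult_less_top)
    finally show "(\<integral>\<^sup>+ x. ennreal (norm (f x * g x)) \<partial>\<mu>) < \<infinity>" .
  qed
  then show "f \<in> kothe_dual I Lam" using f0 by (simp add: kothe_dual_def)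
qed

text \<open>If no multiple of \<open>f\<close> has modular at most 1, \<open>P_modular_le_1\<close>
  must fail at every scale, which supplies test functions with \<open>\<rho> \<le> 1\<close> and
  arbitrarily large pairing with \<open>|f|\<close>. A single \<open>G\<close> dominating fixed
  multiples of all of them contradicts integrability.\<close>

lemma kothe_subset_M_space: "kothe_dual I Lam \<subseteq> M_space \<phi> w I"
proof
  fix f assume f: "f \<in> kothe_dual I Lam"
  then have f0: "f \<in> L0 I" by (simp add: kothe_dual_def)
  then have [measurable]: "f \<in> borel_measurable \<mu>" by (simp add: L0_def)
  show "f \<in> M_space \<phi> w I"
  proof (rule ccontr)
    assume "f \<notin> M_space \<phi> w I"
    then have inf: "M_norm \<phi> w I f = \<infinity>" using f0 by (simp add: M_space_def less_top[symmetric])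
    have ex: "\<exists>u. u \<in> simple_fin \<and> \<rho> u \<le> 1 \<and> ennreal (4 ^ Suc i) \<le> (\<integral>\<^sup>+ x. ennreal (\<bar>f x\<bar> * u x) \<partial>\<mu>)" for i
    proof -
      \<comment> \<open>The weight \<open>(1/2) ^ Suc i\<close> in the sum still leaves a pairing of
        at least \<open>2 ^ Suc i\<close> from the \<open>i\<close>-th function.\<close>
      define e :: real where "e = 4 ^ Suc i"
      have e: "0 < e" by (simp add: e_def)
      have "\<not> P_modular \<phi> w I (\<lambda>t. f t / e) \<le> 1"
        using M_norm_leI[OF e, of f] inf by (auto simp: top_unique)
      then have "\<exists>g\<in>simple_fin. \<not> (\<integral>\<^sup>+ x. ennreal (\<bar>f x / e\<bar> * g x) \<partial>\<mu>) \<le> 1 + \<rho> g"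
        using P_modular_le_1[OF L0_divide[OF f0], of e] by blast
      then obtain g where g: "g \<in> simple_fin" "1 + \<rho> g < (\<integral>\<^sup>+ x. ennreal (\<bar>f x / e\<bar> * g x) \<partial>\<mu>)"
        unfolding not_le by blast
      obtain q where q: "0 \<le> q" "\<rho> g = ennreal q" using simple_fin_Lam(2)[OF g(1)] by (cases "\<rho> g") auto
      \<comment> \<open>Normalization: \<open>\<rho>(c g) \<le> c q \<le> 1\<close> by convexity,
        while the strict bound on the pairing of \<open>f / e\<close> with \<open>g\<close>,
        multiplied by \<open>e * c\<close>, becomes \<open>e\<close>.\<close>
      define c where "c = 1 / (1 + q)"
      have c: "0 < c" "c \<le> 1" "c * (1 + q) = 1" using q by (auto simp: c_def)
      have gm [measurable]: "g \<in> borel_measurable \<mu>" using simple_fin_L0[OF g(1)] by (simp add: L0_def)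
      have gp: "0 \<le> g x" if "x \<in> I" for x using g(1) that by (simp add: simple_fin_def)
      have "\<rho> (\<lambda>x. c * g x) \<le> ennreal c * \<rho> g" by (rule rho_scale_le[OF simple_fin_L0[OF g(1)] c(1,2)])
      also have "\<dots> = ennreal (c * q)" using c q by (simp add: ennreal_mult)
      also have "\<dots> \<le> 1" using c q by (simp add: ennreal_le_1 algebra_simps)
      finally have 1: "\<rho> (\<lambda>x. c * g x) \<le> 1" .
      have "ennreal e = ennreal (e * c) * (1 + \<rho> g)"
      proof -
        have "1 + \<rho> g = ennreal (1 + q)" using q by simp
        then show ?thesis using e c q by (simp add: ennreal_mult'[symmetric] mult.assoc del: ennreal_plus)
      qed
      also have "\<dots> \<le> ennreal (e * c) * (\<integral>\<^sup>+ x. ennreal (\<bar>f x / e\<bar> * g x) \<partial>\<mu>)"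
        using g(2) by (intro mult_left_mono) (auto simp: less_imp_le)
      also have "\<dots> = (\<integral>\<^sup>+ x. ennreal (e * c) * ennreal (\<bar>f x / e\<bar> * g x) \<partial>\<mu>)"
        by (rule nn_integral_cmult[symmetric]) measurable
      also have "\<dots> = (\<integral>\<^sup>+ x. ennreal (\<bar>f x\<bar> * (c * g x)) \<partial>\<mu>)"
        using e c by (intro nn_integral_cong) (simp add: ennreal_mult'[symmetric] abs_divide mult_ac)
      finally show ?thesis using 1 simple_fin_scale[OF g(1), of c] c(1)
        by (intro exI[of _ "\<lambda>x. c * g x"]) (simp add: e_def)
    qed
    have "\<exists>u. \<forall>i. u i \<in> simple_fin \<and> \<rho> (u i) \<le> 1 \<and> ennreal (4 ^ Suc i) \<le> (\<integral>\<^sup>+ x. ennreal (\<bar>f x\<bar> * u i x) \<partial>\<mu>)"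
      by (intro choice allI ex)
    then obtain u where u: "\<And>i. u i \<in> simple_fin" "\<And>i. \<rho> (u i) \<le> 1"
      "\<And>i. ennreal (4 ^ Suc i) \<le> (\<integral>\<^sup>+ x. ennreal (\<bar>f x\<bar> * u i x) \<partial>\<mu>)"
      by blast
    obtain G where G: "G \<in> Lam" "\<And>x. 0 \<le> G x" "\<And>i. AE x in \<mu>. (1/2) ^ Suc i * u i x \<le> G x"
      by (rule geometric_sum_in_Lam[OF u(1,2)]) (rule that)
    have "integrable \<mu> (\<lambda>t. f t * G t)" using f G(1) by (simp add: kothe_dual_def)
    then have "(\<integral>\<^sup>+ x. ennreal (norm (f x * G x)) \<partial>\<mu>) < \<infinity>" by (simp add: integrable_iff_bounded)
    then obtain B where B: "(\<integral>\<^sup>+ x. ennreal (\<bar>f x\<bar> * G x) \<partial>\<mu>) = ennreal B"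
      using G(2) by (cases "\<integral>\<^sup>+ x. ennreal (\<bar>f x\<bar> * G x) \<partial>\<mu>") (auto simp: abs_mult)
    have big: "ennreal (2 ^ Suc i) \<le> ennreal B" for i
    proof -
      have um [measurable]: "u i \<in> borel_measurable \<mu>" using simple_fin_L0[OF u(1)] by (simp add: L0_def)
      have "ennreal (2 ^ Suc i) = ennreal ((1/2) ^ Suc i) * ennreal (4 ^ Suc i)"
        by (simp add: ennreal_mult'[symmetric] power_mult_distrib[symmetric] del: power_Suc)
      also have "\<dots> \<le> ennreal ((1/2) ^ Suc i) * (\<integral>\<^sup>+ x. ennreal (\<bar>f x\<bar> * u i x) \<partial>\<mu>)"
        by (intro mult_left_mono u(3)) simp
      also have "\<dots> = (\<integral>\<^sup>+ x. ennreal ((1/2) ^ Suc i) * ennreal (\<bar>f x\<bar> * u i x) \<partial>\<mu>)"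
        by (rule nn_integral_cmult[symmetric]) measurable
      also have "\<dots> \<le> (\<integral>\<^sup>+ x. ennreal (\<bar>f x\<bar> * G x) \<partial>\<mu>)"
      proof (rule nn_integral_mono_AE, use G(3)[of i] in eventually_elim)
        case (elim x)
        have "(1/2) ^ Suc i * (\<bar>f x\<bar> * u i x) = \<bar>f x\<bar> * ((1/2) ^ Suc i * u i x)" by (simp only: mult_ac)
        also have "\<dots> \<le> \<bar>f x\<bar> * G x" by (intro mult_left_mono elim) simp
        finally show ?case by (simp add: ennreal_mult'[symmetric] ennreal_leI del: power_Suc)
      qed
      finally show ?thesis by (simp only: B)
    qed
    obtain i where i: "B < 2 ^ i" using real_arch_pow[of 2 B] by auto
    have "2 ^ Suc i \<le> B \<or> B \<le> 0" using big[of i] by (auto simp: ennreal_le_iff2 simp del: power_Suc)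
    moreover have "\<not> B \<le> 0"
    proof
      assume "B \<le> 0"
      then have "ennreal B = 0" by (simp add: ennreal_neg)
      with big[of 0] show False by simp
    qed
    moreover have "(2::real) ^ i \<le> 2 ^ Suc i" by simp
    ultimately show False using i by linarith
  qed
qed

lemma kothe_norm_eq:
  assumes f: "f \<in> M_space \<phi> w I"
  shows "kothe_dual_norm I Lam nrm f = M_norm \<phi> w I f"
proof (rule antisym)
  have f0: "f \<in> L0 I" using f by (simp add: M_space_def)
  then have [measurable]: "f \<in> borel_measurable \<mu>" by (simp add: L0_def)
  show "kothe_dual_norm I Lam nrm f \<le> M_norm \<phi> w I f"
    unfolding kothe_dual_norm_def M_norm_def luxemburg_def
  proof (intro SUP_least INF_greatest)
    fix g e assume "g \<in> {g \<in> Lam. nrm g \<le> 1}" "e \<in> {\<epsilon>. 0 < \<epsilon> \<and> P_modular \<phi> w I (\<lambda>t. f t / \<epsilon>) \<le> 1}"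
    then have g: "g \<in> Lam" "nrm g \<le> 1" and e: "0 < e" "P_modular \<phi> w I (\<lambda>t. f t / e) \<le> 1" by auto
    have "(\<integral>\<^sup>+ t. ennreal \<bar>f t * g t\<bar> \<partial>\<mu>) \<le> ennreal e * nrm g"
      using M_space_bound[OF f0 g(1) e] by (simp add: abs_mult)
    also have "\<dots> \<le> ennreal e * 1" by (intro mult_left_mono g) simp
    finally show "(\<integral>\<^sup>+ t. ennreal \<bar>f t * g t\<bar> \<partial>\<mu>) \<le> ennreal e" by simp
  qed
  show "M_norm \<phi> w I f \<le> kothe_dual_norm I Lam nrm f"
  \<comment> \<open>Working strictly above the dual norm provides a positive \<open>e\<close>, even
    if the dual norm is 0.\<close>
  proof (rule dense_ge)
    fix y assume y: "kothe_dual_norm I Lam nrm f < y"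
    show "M_norm \<phi> w I f \<le> y"
    proof (cases y)
      case (real e)
      then have e: "0 < e" using y by (cases "e = 0") auto
      have "P_modular \<phi> w I (\<lambda>t. f t / e) \<le> 1"
      proof (rule P_modular_le_1[OF L0_divide[OF f0]])
        fix g assume g: "g \<in> simple_fin"
        have g0: "g \<in> L0 I" by (rule simple_fin_L0[OF g])
        then have gm [measurable]: "g \<in> borel_measurable \<mu>" by (simp add: L0_def)
        have gp: "0 \<le> g x" if "x \<in> I" for x using g that by (simp add: simple_fin_def)
        obtain q where q: "0 \<le> q" "\<rho> g = ennreal q" using simple_fin_Lam(2)[OF g] by (cases "\<rho> g") auto
        \<comment> \<open>\<open>nrm (c g) \<le> 1\<close> by \<open>nrm_le\<close>, so
          \<open>c g\<close> is admissible in the dual norm. Dividing its pairing with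
          \<open>f\<close> by \<open>c * e\<close> yields exactly the bound
          \<open>1 / c = 1 + \<rho> g\<close>, with no loss of constant.\<close>
        define c where "c = 1 / (1 + q)"
        have c: "0 < c" "c * (1 + q) = 1" "1 / c = 1 + q" using q by (auto simp: c_def)
        have q1: "1 + \<rho> g = ennreal (1 + q)" using q by simp
        have "nrm (\<lambda>x. c * g x) \<le> ennreal c * nrm g" by (rule nrm_scale_le[OF c(1)])
        also have "\<dots> \<le> ennreal c * (1 + \<rho> g)" by (intro mult_left_mono nrm_le g0) simp
        also have "\<dots> = 1" unfolding q1 using c by (simp add: ennreal_mult'[symmetric] del: ennreal_plus)
        finally have n1: "nrm (\<lambda>x. c * g x) \<le> 1" .
        have "(\<lambda>x. c * g x) \<in> Lam" using c by (intro simple_fin_Lam simple_fin_scale g) simp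
        then have "(\<integral>\<^sup>+ t. ennreal \<bar>f t * (c * g t)\<bar> \<partial>\<mu>) \<le> kothe_dual_norm I Lam nrm f"
          unfolding kothe_dual_norm_def using n1 by (intro SUP_upper) simp
        also have "\<dots> \<le> ennreal e" using y real by simp
        finally have le: "(\<integral>\<^sup>+ t. ennreal \<bar>f t * (c * g t)\<bar> \<partial>\<mu>) \<le> ennreal e" .
        have "(\<integral>\<^sup>+ x. ennreal (\<bar>f x / e\<bar> * g x) \<partial>\<mu>) = (\<integral>\<^sup>+ x. ennreal (1 / (c * e)) * ennreal \<bar>f x * (c * g x)\<bar> \<partial>\<mu>)"
          using c(1) e gp by (intro nn_integral_cong) (simp add: ennreal_mult'[symmetric] abs_mult abs_divide)
        also have "\<dots> = ennreal (1 / (c * e)) * (\<integral>\<^sup>+ x. ennreal \<bar>f x * (c * g x)\<bar> \<partial>\<mu>)"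
          by (rule nn_integral_cmult) measurable
        also have "\<dots> \<le> ennreal (1 / (c * e)) * ennreal e" by (intro mult_left_mono le) simp
        also have "\<dots> = ennreal (1 / c)" using e c(1) by (simp add: ennreal_mult'[symmetric])
        also have "\<dots> = 1 + \<rho> g" using q1 c(3) by simp
        finally show "(\<integral>\<^sup>+ x. ennreal (\<bar>f x / e\<bar> * g x) \<partial>\<mu>) \<le> 1 + \<rho> g" .
      qed
      from M_norm_leI[OF e this] show ?thesis using real by simp
    qed simp
  qed
qed

end

theorem corollary4p12:
  fixes \<phi> w :: "real \<Rightarrow> real" and a :: ereal and I :: "real set"
  assumes "N_function \<phi>"
    and "0 < a" and "I = interval a"
    and "weight_function I w" and "\<forall>t\<in>I. 0 < w t"
    and "\<forall>t\<in>I. (\<integral>\<^sup>+ s. ennreal (w s) \<partial>lebesgue_on {0<..<t}) < \<infinity>"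
  shows "kothe_dual I (orlicz_lorentz (complementary \<phi>) w I) = M_space \<phi> w I \<and>
    (\<forall>f \<in> M_space \<phi> w I.
       kothe_dual_norm I (orlicz_lorentz (complementary \<phi>) w I) (orlicz_lorentz_norm0 \<phi> w I) f
       = M_norm \<phi> w I f)"
proof -
  interpret orlicz \<phi> a I w
    using assms by unfold_locales auto
  show ?thesis
    using M_space_subset_kothe kothe_subset_M_space kothe_norm_eq by blast
qed

end
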